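(* Let $\bar{\mathcal C}\subset\mathbb P^2$ be a reduced curve of degree $k$ with $P_y=[0:1:0]\notin\bar{\mathcal C}$ and not containing $\bar L_Y=\{Y=0\}$. Let $\tilde\nabla=(\tau_1,\dots,\tau_{r+1})\in\mathbb B_{k,1}^{\,r+1}$ be an extended braid monodromy of $(\bar{\mathcal C},P_y,\bar L_\infty)$ with respect to $\bar L_Y$, where $\tau_{r+1}$ is the braid corresponding to $\bar L_0=\{X=0\}$. Let $\pi_n([X:Y:Z])=[X^n:Y^n:Z^n]$ be the $n$-th Kummer cover and $\bar{\mathcal C}_n:=\pi_n^{-1}(\bar{\mathcal C})$. Then the list of braids $\tilde\nabla_n\in\mathbb B_{nk,1}^{\,nr+1}$ induced by $\tilde\nabla$, $$\tilde\nabla_n=(w_0,w_1,\dots,w_{n-1},\tilde\rho_n(\tau_{r+1}^n)),\qquad w_j=\big(\tilde\rho_n(\tau_1^{\tau_{r+1}^{j}}),\dots,\tilde\rho_n(\tau_r^{\tau_{r+1}^{j}})\big),$$ is an extended braid monodromy for the triple $(\bar{\mathcal C}_n,P_y,\bar L_\infty)=\pi_n^{-1}(\bar{\mathcal C},P_y,\bar L_\infty)$ with respect to $\pi_n^{-1}(\bar L_Y)=\bar L_Y$.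
   Context: Conjugation: $a^b=b^{-1}ab$; loops and braids are composed from left to right. Lines: $\bar L_t=\{X-tZ=0\}$ ($t\in\mathbb C$) are the lines through $P_y=[0:1:0]$ other than $\bar L_\infty=\{Z=0\}$; $L_t=\bar L_t\cap\mathbb C^2$ with $\mathbb C^2=\mathbb P^2\setminus\bar L_\infty$, affine coordinates $(x,y)$, so $L_t=\{x=t\}\cong\mathbb C$ via $y$. Geometric basis: for a finite set $S\subset\mathbb C$, $(\gamma_1,\dots,\gamma_m)$ is an (ordered) geometric basis of the free group $\pi_1(\mathbb C\setminus S;t_0)$ if it is a free basis consisting of one positively oriented meridian about each point of $S$ and $\gamma_m\cdots\gamma_1$ is represented by the counterclockwise boundary of a large disk containing $S$ (the inverse of a meridian of $\infty$). Braid groups: $\mathbb B_{k,1}$ is the group of braids on $k+1$ strands whose permutation fixes the point $0$; it is identified with the fundamental group of the space of unordered configurations of $k$ distinct points of $\mathbb C^*$ (the constant string $0$ being added). Extended braid monodromy: let $\bar{\mathcal D}$ be a reduced curve of degree $k$ with $P_y\notin\bar{\mathcal D}$, $\bar L_Y\not\subset\bar{\mathcal D}$, $\mathcal D=\bar{\mathcal D}\cap\mathbb C^2$, $L_Y=\{y=0\}$. Put $B=\{t\in\mathbb P^1:\bar L_t\text{ is not transversal to }\bar{\mathcal D}\cup\bar L_Y\}$, $B^*=B\cap\mathbb C^*$, $\tilde B=B^*\cup\{0\}$, $r=\#B^*$. For $t\in\mathbb C\setminus\tilde B$ the set $L_t\cap\mathcal D$ consists of $k$ nonzero values of $y$; the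 motion of these points (together with the constant point $y=0$ of $L_Y$) along loops in $\mathbb C\setminus\tilde B$ defines the morphism $\tilde\nabla:\pi_1(\mathbb C\setminus\tilde B;t_0)\to\mathbb B_{k,1}$, called the extended braid monodromy of $(\bar{\mathcal D},P_y,\bar L_\infty)$ with respect to $\bar L_Y$. It is also represented by the list $(\tilde\nabla(\gamma_1),\dots,\tilde\nabla(\gamma_{r+1}))$ for a geometric basis; in this list for $\bar{\mathcal C}$ the last element $\gamma_{r+1}$ is a meridian of $0\in\tilde B$. The morphism $\tilde\rho_n:\mathbb B_{k,1}\to\mathbb B_{nk,1}$ is induced by replacing a configuration of $k$ points in $\mathbb C^*$ by the configuration of the $nk$ $n$-th roots of these points. The list $\tilde\nabla_n$ is the list of images, under $\pi_1(\mathbb C\setminus\tilde B_n;t_{0,n})\hookrightarrow\pi_1(\mathbb C\setminus\tilde B;t_0)\xrightarrow{\tilde\nabla}\mathbb B_{k,1}\xrightarrow{\tilde\rho_n}\mathbb B_{nk,1}$ (the first map induced by $t\mapsto t^n$, $t_{0,n}^n=t_0$, $\tilde B_n$ being the preimage of $\tilde B$), of the geometric basis $(v_0,\dots,v_{n-1},\gamma_{r+1}^n)$, $v_j=(\gamma_1^{\gamma_{r+1}^j},\dots,\gamma_r^{\gamma_{r+1}^j})$. *)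

theory Defs
  imports
    "HOL-Complex_Analysis.Complex_Analysis"
    "HOL-Computational_Algebra.Computational_Algebra"
    "HOL-Algebra.Group"
begin

section \<open>The complex projective plane\<close>

definition proj_rel :: "complex \<times> complex \<times> complex \<Rightarrow> complex \<times> complex \<times> complex \<Rightarrow> bool" where
  "proj_rel u v \<longleftrightarrow> u \<noteq> (0, 0, 0) \<and> v \<noteq> (0, 0, 0) \<and>
     (\<exists>c. c \<noteq> 0 \<and> v = (case u of (x, y, z) \<Rightarrow> (c * x, c * y, c * z)))"

lemma part_equivp_proj_rel: "part_equivp proj_rel"
proof (rule part_equivpI)
  have "proj_rel (1, 1, 1) (1, 1, 1)"
    by (auto simp: proj_rel_def intro!: exI[of _ 1])
  then show "\<exists>u. proj_rel u u" by blast
  show "symp proj_rel"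
  proof (rule sympI)
    fix u v assume "proj_rel u v"
    then obtain c where c: "c \<noteq> 0" "u \<noteq> (0, 0, 0)" "v \<noteq> (0, 0, 0)"
        "v = (case u of (x, y, z) \<Rightarrow> (c * x, c * y, c * z))"
      by (auto simp: proj_rel_def)
    then show "proj_rel v u"
      unfolding proj_rel_def by (cases u) (auto intro!: exI[of _ "inverse c"])
  qed
  show "transp proj_rel"
  proof (rule transpI)
    fix u v w assume "proj_rel u v" "proj_rel v w"
    then obtain c d where c: "c \<noteq> 0" "u \<noteq> (0, 0, 0)"
        "v = (case u of (x, y, z) \<Rightarrow> (c * x, c * y, c * z))"
      and d: "d \<noteq> 0" "w \<noteq> (0, 0, 0)"
        "w = (case v of (x, y, z) \<Rightarrow> (d * x, d * y, d * z))"
      by (auto simp: proj_rel_def)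
    then show "proj_rel u w"
      unfolding proj_rel_def by (cases u) (auto intro!: exI[of _ "d * c"])
  qed
qed

quotient_type cp2 = "complex \<times> complex \<times> complex" / partial: proj_rel
  by (rule part_equivp_proj_rel)

text \<open>The point \<open>[x:y:z]\<close>; only meaningful if \<open>(x, y, z) \<noteq> (0, 0, 0)\<close>.\<close>

definition hpoint :: "complex \<Rightarrow> complex \<Rightarrow> complex \<Rightarrow> cp2" where
  "hpoint x y z = abs_cp2 (x, y, z)"

lift_definition kummer :: "nat \<Rightarrow> cp2 \<Rightarrow> cp2" is "\<lambda>n (x, y, z). (x ^ n, y ^ n, z ^ n)"
  by (auto simp: proj_rel_def power_mult_distrib intro: exI[of _ "_ ^ _"])


section \<open>Plane curves\<close>

text \<open>
  Polynomials in \<open>X, Y, Z\<close> are elements of \<open>\<complex>[X][Z][Y]\<close>: the innermost variable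
  is \<open>X\<close>, the middle one \<open>Z\<close>, the outermost one \<open>Y\<close>.
\<close>

type_synonym tpoly = "complex poly poly poly"

definition var_X :: tpoly where "var_X = [:[:[:0, 1:]:]:]"
definition var_Z :: tpoly where "var_Z = [:[:0, 1:]:]"
definition var_Y :: tpoly where "var_Y = [:0, 1:]"
definition const3 :: "complex \<Rightarrow> tpoly" where "const3 c = [:[:[:c:]:]:]"

definition eval3 :: "tpoly \<Rightarrow> complex \<Rightarrow> complex \<Rightarrow> complex \<Rightarrow> complex" where
  "eval3 F x y z = poly (poly (poly F [:[:y:]:]) [:z:]) x"

definition deriv_X :: "tpoly \<Rightarrow> tpoly" where "deriv_X = map_poly (map_poly pderiv)"
definition deriv_Z :: "tpoly \<Rightarrow> tpoly" where "deriv_Z = map_poly pderiv"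
definition deriv_Y :: "tpoly \<Rightarrow> tpoly" where "deriv_Y = pderiv"

text \<open>\<open>coeff (coeff (coeff F b) c) a\<close> is the coefficient of \<open>X\<^sup>a Y\<^sup>b Z\<^sup>c\<close>.\<close>

definition homogeneous :: "nat \<Rightarrow> tpoly \<Rightarrow> bool" where
  "homogeneous k F \<longleftrightarrow> (\<forall>a b c. coeff (coeff (coeff F b) c) a \<noteq> 0 \<longrightarrow> a + b + c = k)"

definition zero_locus :: "tpoly \<Rightarrow> cp2 set" where
  "zero_locus F = {hpoint x y z | x y z. (x, y, z) \<noteq> (0, 0, 0) \<and> eval3 F x y z = 0}"

definition reduced_equation :: "nat \<Rightarrow> tpoly \<Rightarrow> cp2 set \<Rightarrow> bool" where
  "reduced_equation k F C \<longleftrightarrow> 0 < k \<and> homogeneous k F \<and> squarefree F \<and> C = zero_locus F"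

definition reduced_curve :: "nat \<Rightarrow> cp2 set \<Rightarrow> bool" where
  "reduced_curve k C \<longleftrightarrow> (\<exists>F. reduced_equation k F C)"

definition point_Py :: cp2 where "point_Py = hpoint 0 1 0"
definition line_inf :: "cp2 set" where "line_inf = zero_locus var_Z"
definition line_Y :: "cp2 set" where "line_Y = zero_locus var_Y"

text \<open>
  Transversality of the curves with (reduced) equations \<open>F\<close> and \<open>G\<close>: at every common
  point the two gradients are linearly independent, i.e. both curves are smooth there
  with distinct tangent lines.
\<close>

definition transversal :: "tpoly \<Rightarrow> tpoly \<Rightarrow> bool" where
  "transversal F G \<longleftrightarrow>
     (\<forall>x y z. (x, y, z) \<noteq> (0, 0, 0) \<and> eval3 F x y z = 0 \<and> eval3 G x y z = 0 \<longrightarrow>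
        (\<forall>a b. (\<forall>D\<in>{deriv_X, deriv_Y, deriv_Z}.
                  a * eval3 (D F) x y z + b * eval3 (D G) x y z = 0) \<longrightarrow> a = 0 \<and> b = 0))"

text \<open>
  \<open>line_form t\<close> is the equation of the line \<open>X - tZ = 0\<close>. The set \<open>B\<close> below is only formed
  inside \<open>\<complex>\<close>: whether the value \<open>\<infinity>\<close> belongs to it is irrelevant for \<open>B\<^sup>* = B \<inter> \<complex>\<^sup>*\<close>.
  Since \<open>Y\<close> does not divide \<open>F\<close>, \<open>var_Y * F\<close> is the reduced equation of the union of the curve
  with the line \<open>Y = 0\<close>.
\<close>

definition line_form :: "complex \<Rightarrow> tpoly" where
  "line_form t = var_X - const3 t * var_Z"

definition nontransversal_values :: "tpoly \<Rightarrow> complex set" where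
  "nontransversal_values F = {t. \<not> transversal (line_form t) (var_Y * F)}"

definition extended_values :: "tpoly \<Rightarrow> complex set" where
  "extended_values F = (nontransversal_values F - {0}) \<union> {0}"

definition fibre :: "cp2 set \<Rightarrow> complex \<Rightarrow> complex set" where
  "fibre C t = {y. hpoint t y 1 \<in> C}"


section \<open>Fundamental groups\<close>

text \<open>
  The library's \<open>homotopic_paths\<close> and \<open>+++\<close> require a topological type class; the
  configuration spaces below are abstract topologies on \<open>complex set\<close>.
\<close>

definition path_class :: "'a topology \<Rightarrow> (real \<Rightarrow> 'a) \<Rightarrow> (real \<Rightarrow> 'a) set" where
  "path_class X p = {q. homotopic_with (\<lambda>r. r 0 = p 0 \<and> r 1 = p 1) (top_of_set {0..1}) X p q}"

lemma path_class_top_of_set: "path_class (top_of_set S) p = {q. homotopic_paths S p q}"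
  by (simp add: path_class_def homotopic_paths_def pathstart_def pathfinish_def)

definition path_concat :: "(real \<Rightarrow> 'a) \<Rightarrow> (real \<Rightarrow> 'a) \<Rightarrow> real \<Rightarrow> 'a" where
  "path_concat p q = (\<lambda>s. if s \<le> 1/2 then p (2 * s) else q (2 * s - 1))"

lemma path_concat_eq_joinpaths: "path_concat p q = p +++ q"
  by (simp add: path_concat_def joinpaths_def)

text \<open>The product of two classes runs through the left factor first.\<close>

definition fundamental_group :: "'a topology \<Rightarrow> 'a \<Rightarrow> (real \<Rightarrow> 'a) set monoid" where
  "fundamental_group X x =
     \<lparr>carrier = {path_class X p | p. pathin X p \<and> p 0 = x \<and> p 1 = x},
      mult = (\<lambda>g h. \<Union>p\<in>g. \<Union>q\<in>h. path_class X (path_concat p q)),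
      one = path_class X (\<lambda>_. x)\<rparr>"

text \<open>The map on classes induced by a map into \<open>Y\<close>.\<close>

definition pi1_map :: "'b topology \<Rightarrow> ('a \<Rightarrow> 'b) \<Rightarrow> (real \<Rightarrow> 'a) set \<Rightarrow> (real \<Rightarrow> 'b) set" where
  "pi1_map Y \<phi> g = (\<Union>p\<in>g. path_class Y (\<phi> \<circ> p))"

text \<open>\<open>a\<^sup>b = b\<^sup>-\<^sup>1ab\<close>\<close>

definition conj_by :: "('g, 'm) monoid_scheme \<Rightarrow> 'g \<Rightarrow> 'g \<Rightarrow> 'g" where
  "conj_by G a b = inv\<^bsub>G\<^esub> b \<otimes>\<^bsub>G\<^esub> a \<otimes>\<^bsub>G\<^esub> b"

text \<open>
  A word is a list of letters \<open>(i, e)\<close>, standing for \<open>gs ! i\<close> if \<open>e\<close> is true and for its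
  inverse otherwise.
\<close>

definition eval_word :: "('g, 'm) monoid_scheme \<Rightarrow> 'g list \<Rightarrow> (nat \<times> bool) list \<Rightarrow> 'g" where
  "eval_word G gs w =
     foldr (\<lambda>(i, e) g. (if e then gs ! i else inv\<^bsub>G\<^esub> (gs ! i)) \<otimes>\<^bsub>G\<^esub> g) w \<one>\<^bsub>G\<^esub>"

definition reduced_word :: "nat \<Rightarrow> (nat \<times> bool) list \<Rightarrow> bool" where
  "reduced_word m w \<longleftrightarrow> (\<forall>(i, e)\<in>set w. i < m) \<and>
     successively (\<lambda>(i, e) (j, e'). \<not> (i = j \<and> e \<noteq> e')) w"

definition free_basis :: "('g, 'm) monoid_scheme \<Rightarrow> 'g list \<Rightarrow> bool" where
  "free_basis G gs \<longleftrightarrow> set gs \<subseteq> carrier G \<and>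
     (\<forall>g\<in>carrier G. \<exists>!w. reduced_word (length gs) w \<and> eval_word G gs w = g)"


section \<open>Geometric bases\<close>

abbreviation pi1_compl :: "complex set \<Rightarrow> complex \<Rightarrow> (real \<Rightarrow> complex) set monoid" where
  "pi1_compl S t0 \<equiv> fundamental_group (top_of_set (- S)) t0"

definition positive_meridian ::
  "complex set \<Rightarrow> complex \<Rightarrow> complex \<Rightarrow> (real \<Rightarrow> complex) set \<Rightarrow> bool" where
  "positive_meridian S t0 s g \<longleftrightarrow>
     (\<exists>\<epsilon> \<delta>. 0 < \<epsilon> \<and> cball s \<epsilon> \<inter> S = {s} \<and>
        path \<delta> \<and> path_image \<delta> \<subseteq> - S \<and> pathstart \<delta> = t0 \<and> pathfinish \<delta> = s + of_real \<epsilon> \<and>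
        g = path_class (top_of_set (- S)) (\<delta> +++ circlepath s \<epsilon> +++ reversepath \<delta>))"

text \<open>
  The counterclockwise boundary of a large disk, joined to the base point by a path, i.e.
  the inverse of a meridian of \<open>\<infinity>\<close>.
\<close>

definition large_circle :: "complex set \<Rightarrow> complex \<Rightarrow> (real \<Rightarrow> complex) set \<Rightarrow> bool" where
  "large_circle S t0 g \<longleftrightarrow>
     (\<exists>R \<delta>. 0 < R \<and> S \<subseteq> ball 0 R \<and>
        path \<delta> \<and> path_image \<delta> \<subseteq> - S \<and> pathstart \<delta> = t0 \<and> pathfinish \<delta> = of_real R \<and>
        g = path_class (top_of_set (- S)) (\<delta> +++ circlepath 0 R +++ reversepath \<delta>))"

text \<open>
  The list \<open>ts\<close> enumerates the punctures in the order in which the members of the basis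
  encircle them.
\<close>

definition geometric_basis ::
  "complex list \<Rightarrow> complex \<Rightarrow> (real \<Rightarrow> complex) set list \<Rightarrow> bool" where
  "geometric_basis ts t0 gs \<longleftrightarrow>
     distinct ts \<and> length gs = length ts \<and>
     free_basis (pi1_compl (set ts) t0) gs \<and>
     (\<forall>i<length ts. positive_meridian (set ts) t0 (ts ! i) (gs ! i)) \<and>
     large_circle (set ts) t0
       (foldr (mult (pi1_compl (set ts) t0)) (rev gs) (one (pi1_compl (set ts) t0)))"


section \<open>Configuration spaces and braid groups\<close>

definition ordered_conf :: "nat \<Rightarrow> complex set \<Rightarrow> (nat \<Rightarrow> complex) topology" where
  "ordered_conf k A =
     subtopology (product_topology (\<lambda>_. top_of_set A) {..<k}) {c. inj_on c {..<k}}"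

text \<open>The quotient of \<open>ordered_conf k A\<close> by the symmetric group, carried by the \<open>k\<close>-subsets of \<open>A\<close>.\<close>

definition unordered_conf :: "nat \<Rightarrow> complex set \<Rightarrow> complex set topology" where
  "unordered_conf k A = topology (\<lambda>U.
     U \<subseteq> (\<lambda>c. c ` {..<k}) ` topspace (ordered_conf k A) \<and>
     openin (ordered_conf k A) {c \<in> topspace (ordered_conf k A). c ` {..<k} \<in> U})"

lemma openin_unordered_conf:
  "openin (unordered_conf k A) U \<longleftrightarrow>
     U \<subseteq> (\<lambda>c. c ` {..<k}) ` topspace (ordered_conf k A) \<and>
     openin (ordered_conf k A) {c \<in> topspace (ordered_conf k A). c ` {..<k} \<in> U}"
proof -
  let ?T = "topspace (ordered_conf k A)"
  let ?L = "\<lambda>U. U \<subseteq> (\<lambda>c. c ` {..<k}) ` ?T \<and>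
     openin (ordered_conf k A) {c \<in> ?T. c ` {..<k} \<in> U}"
  have "istopology ?L"
    unfolding istopology_def
  proof (intro conjI allI impI)
    fix S T assume S: "?L S" and T: "?L T"
    have eq: "{c \<in> ?T. c ` {..<k} \<in> S \<inter> T} =
        {c \<in> ?T. c ` {..<k} \<in> S} \<inter> {c \<in> ?T. c ` {..<k} \<in> T}" by blast
    show "S \<inter> T \<subseteq> (\<lambda>c. c ` {..<k}) ` ?T" using S by blast
    show "openin (ordered_conf k A) {c \<in> ?T. c ` {..<k} \<in> S \<inter> T}"
      unfolding eq using S T by blast
  next
    fix \<K> assume K: "\<forall>K\<in>\<K>. ?L K"
    have eq: "{c \<in> ?T. c ` {..<k} \<in> \<Union>\<K>} = (\<Union>K\<in>\<K>. {c \<in> ?T. c ` {..<k} \<in> K})" by blast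
    show "\<Union>\<K> \<subseteq> (\<lambda>c. c ` {..<k}) ` ?T" using K by blast
    show "openin (ordered_conf k A) {c \<in> ?T. c ` {..<k} \<in> \<Union>\<K>}"
      unfolding eq using K by blast
  qed
  then show ?thesis
    unfolding unordered_conf_def by simp
qed

lemma topspace_unordered_conf:
  "topspace (unordered_conf k A) = (\<lambda>c. c ` {..<k}) ` topspace (ordered_conf k A)" (is "_ = ?R")
proof
  show "topspace (unordered_conf k A) \<subseteq> ?R"
    using openin_unordered_conf openin_topspace by blast
  have "{c \<in> topspace (ordered_conf k A). c ` {..<k} \<in> ?R} = topspace (ordered_conf k A)" by blast
  then have "openin (unordered_conf k A) ?R"
    by (auto simp: openin_unordered_conf)
  then show "?R \<subseteq> topspace (unordered_conf k A)" by (rule openin_subset)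
qed

lemma quotient_map_unordered_conf:
  "quotient_map (ordered_conf k A) (unordered_conf k A) (\<lambda>c. c ` {..<k})"
  unfolding quotient_map_def topspace_unordered_conf openin_unordered_conf by blast

text \<open>
  \<open>\<bool>\<^bsub>k,1\<^esub>\<close> as the fundamental group of the space of \<open>k\<close> unordered distinct points of
  \<open>\<complex>\<^sup>*\<close>, based at the configuration \<open>c\<close>.
\<close>

definition braid_group :: "nat \<Rightarrow> complex set \<Rightarrow> (real \<Rightarrow> complex set) set monoid" where
  "braid_group k c = fundamental_group (unordered_conf k (- {0})) c"

text \<open>\<open>rho n k : \<bool>\<^bsub>k,1\<^esub> \<rightarrow> \<bool>\<^bsub>nk,1\<^esub>\<close>, based at \<open>c\<close> and at its set of \<open>n\<close>-th roots.\<close>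

definition rho :: "nat \<Rightarrow> nat \<Rightarrow> (real \<Rightarrow> complex set) set \<Rightarrow> (real \<Rightarrow> complex set) set" where
  "rho n k = pi1_map (unordered_conf (n * k) (- {0})) (\<lambda>c. {y. y ^ n \<in> c})"


section \<open>Extended braid monodromy\<close>

definition ext_monodromy ::
  "nat \<Rightarrow> cp2 set \<Rightarrow> (real \<Rightarrow> complex) set \<Rightarrow> (real \<Rightarrow> complex set) set" where
  "ext_monodromy k C = pi1_map (unordered_conf k (- {0})) (fibre C)"

text \<open>
  The list \<open>\<tau>s\<close> represents the extended braid monodromy of \<open>C\<close> with respect to the line
  \<open>Y = 0\<close>, through the base point \<open>t0\<close> and the geometric basis \<open>gs\<close> (member \<open>gs ! i\<close> encircling
  \<open>ts ! i\<close>). The reduced equation \<open>F\<close> of \<open>C\<close> is unique up to a constant factor, so its choice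
  does not matter.
\<close>

definition extended_braid_monodromy ::
  "nat \<Rightarrow> cp2 set \<Rightarrow> complex \<Rightarrow> complex list \<Rightarrow> (real \<Rightarrow> complex) set list \<Rightarrow>
   (real \<Rightarrow> complex set) set list \<Rightarrow> bool" where
  "extended_braid_monodromy k C t0 ts gs \<tau>s \<longleftrightarrow>
     point_Py \<notin> C \<and> \<not> line_Y \<subseteq> C \<and>
     (\<exists>F. reduced_equation k F C \<and> set ts = extended_values F) \<and>
     t0 \<notin> set ts \<and> geometric_basis ts t0 gs \<and>
     \<tau>s = map (ext_monodromy k C) gs"

text \<open>
  From \<open>(a\<^sub>1, \<dots>, a\<^sub>r, b)\<close> the list \<open>(v\<^sub>0, \<dots>, v\<^bsub>n-1\<^esub>, b\<^sup>n)\<close> with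
  \<open>v\<^sub>j\<close> the list of the conjugates of \<open>a\<^sub>1, \<dots>, a\<^sub>r\<close> by \<open>b\<^sup>j\<close>.
\<close>

definition kummer_list :: "('g, 'm) monoid_scheme \<Rightarrow> nat \<Rightarrow> 'g list \<Rightarrow> 'g list" where
  "kummer_list G n xs =
     concat (map (\<lambda>j. map (\<lambda>a. conj_by G a (last xs [^]\<^bsub>G\<^esub> j)) (butlast xs)) [0..<n])
       @ [last xs [^]\<^bsub>G\<^esub> n]"

end

theory Submission
  imports Defs
begin

text \<open>
  Write \<open>S\<close> for the finite set of special values of \<open>C\<close> (it contains \<open>0\<close>) and \<open>S\<^sub>n\<close> for its
  preimage under \<open>t \<mapsto> t\<^sup>n\<close>. The statement has an algebraic, a topological and a formal part.

  \<^bold>\<open>The curve upstairs.\<close> The equation of the pull-back is \<open>F(X\<^sup>n, Y\<^sup>n, Z\<^sup>n)\<close>. Since \<open>P\<^sub>y\<close> does not lie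
  on \<open>C\<close>, the polynomial \<open>F\<close> is monic in \<open>Y\<close> up to a constant, and by Euler's relation the line
  \<open>X = tZ\<close> is transversal to \<open>Y F = 0\<close> if and only if \<open>F(t, Y, 1)\<close> has only simple non-zero roots.
  This property passes from \<open>f(Y)\<close> to \<open>f(Y\<^sup>n)\<close> and back, so the special values of the pull-back
  are exactly \<open>S\<^sub>n\<close>. It holds outside the finite set \<open>S\<^sub>n\<close>, and one such \<open>t\<close> already makes
  \<open>F(X\<^sup>n, Y\<^sup>n, Z\<^sup>n)\<close> squarefree: a repeated factor would have positive degree in \<open>Y\<close> and would
  specialise to a repeated root (\<open>kummer_poly_reduced_equation\<close>).

  \<^bold>\<open>The geometric basis upstairs.\<close> The power map is a covering of \<open>\<complex> - S\<close> by \<open>\<complex> - S\<^sub>n\<close>, hence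
  injective on fundamental groups. Let \<open>(a\<^sub>1, \<dots>, a\<^sub>r, b)\<close> be the given basis, \<open>b\<close> a meridian of \<open>0\<close>.
  \<^item> A conjugate of a meridian of \<open>s \<noteq> 0\<close> is a meridian of \<open>s\<close> and lifts to a meridian, because
    near \<open>s\<close> there is a branch of the root; \<open>b\<^sup>n\<close> lifts to a meridian of \<open>0\<close>
    (\<open>meridian_lift\<close>, \<open>meridian_power_lift\<close>).
  \<^item> The product of the new list in reverse order telescopes to the \<open>n\<close>-th power of
    \<open>b a\<^sub>r \<cdots> a\<^sub>1\<close>, the large circle, and this power lifts to a large circle
    (\<open>kummer_list_product\<close>, \<open>large_circle_power_lift\<close>).
  \<^item> The lifted loops form one meridian about each point of \<open>S\<^sub>n\<close>: their product is a large
    circle, whose winding number about every point of \<open>S\<^sub>n\<close> is \<open>1\<close>, and each of them contributes \<open>1\<close>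
    at its own point and \<open>0\<close> elsewhere
    (\<open>meridians_of_large_circle\<close>).
  \<^item> The winding number about \<open>0\<close> of a loop coming from upstairs is divisible by \<open>n\<close>, and the
    elements with this property are freely generated by the new list. This is the
    Reidemeister-Schreier theorem for the transversal \<open>1, b, \<dots>, b\<^sup>n\<^sup>-\<^sup>1\<close>, proved by letting the
    group act on pairs of a coset representative and a reduced word (\<open>kummer_list_free\<close>).

  \<^bold>\<open>Compatibility.\<close> The fibre of the pull-back over \<open>t\<close> is the set of \<open>n\<close>-th roots of the fibre of
  \<open>C\<close> over \<open>t\<^sup>n\<close>. As the roots of a polynomial depend continuously on it, both the fibre and the set
  of \<open>n\<close>-th roots define continuous maps into configuration spaces, so they induce homomorphisms
  of fundamental groups, and functoriality identifies the two lists of braids.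
\<close>

section \<open>Free bases and reduced words\<close>

lemma eval_word_Nil [simp]: "eval_word G gs [] = \<one>\<^bsub>G\<^esub>"
  by (simp add: eval_word_def)

lemma eval_word_Cons [simp]:
  "eval_word G gs ((i, e) # w) = (if e then gs ! i else inv\<^bsub>G\<^esub> (gs ! i)) \<otimes>\<^bsub>G\<^esub> eval_word G gs w"
  by (simp add: eval_word_def)

definition word_over :: "nat \<Rightarrow> (nat \<times> bool) list \<Rightarrow> bool" where
  "word_over m w \<longleftrightarrow> (\<forall>x\<in>set w. fst x < m)"

lemma word_over_simps [simp]:
  "word_over m []" "word_over m (x # w) \<longleftrightarrow> fst x < m \<and> word_over m w"
  "word_over m (v @ w) \<longleftrightarrow> word_over m v \<and> word_over m w"
  by (auto simp: word_over_def)

lemma reduced_word_imp_over: "reduced_word m w \<Longrightarrow> word_over m w"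
  by (auto simp: reduced_word_def word_over_def)

lemma reduced_word_Nil [simp]: "reduced_word m []"
  by (simp add: reduced_word_def)

lemma reduced_word_Cons:
  "reduced_word m (x # w) \<longleftrightarrow> fst x < m \<and> reduced_word m w \<and>
     (case w of [] \<Rightarrow> True | y # v \<Rightarrow> \<not> (fst x = fst y \<and> snd x \<noteq> snd y))"
  by (cases w) (auto simp: reduced_word_def split: prod.splits)

text \<open>
  Left multiplication of a reduced word by a letter, with the one cancellation that may occur.
  Multiplying by a letter and then by its inverse is the identity on reduced words, so the letters
  act on reduced words by permutations.
\<close>

fun letter_mult :: "nat \<times> bool \<Rightarrow> (nat \<times> bool) list \<Rightarrow> (nat \<times> bool) list" where
  "letter_mult x [] = [x]"
| "letter_mult x (y # w) = (if fst x = fst y \<and> snd x \<noteq> snd y then w else x # y # w)"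

lemma reduced_letter_mult:
  "reduced_word m w \<Longrightarrow> fst x < m \<Longrightarrow> reduced_word m (letter_mult x w)"
  by (cases w) (auto simp: reduced_word_Cons split: if_splits)

lemma letter_mult_of_reduced: "reduced_word m (x # w) \<Longrightarrow> letter_mult x w = x # w"
  by (cases w) (auto simp: reduced_word_Cons)

lemma letter_mult_inverse:
  "reduced_word m w \<Longrightarrow> letter_mult (i, \<not> e) (letter_mult (i, e) w) = w"
  by (cases w; cases "tl w") (auto simp: reduced_word_Cons)

definition reduce_word :: "(nat \<times> bool) list \<Rightarrow> (nat \<times> bool) list" where
  "reduce_word w = foldr letter_mult w []"

lemma reduced_reduce_word: "word_over m w \<Longrightarrow> reduced_word m (reduce_word w)"
  unfolding reduce_word_def by (induction w) (auto intro: reduced_letter_mult)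

context group
begin

lemma eval_word_closed:
  assumes "set gs \<subseteq> carrier G" "word_over (length gs) w"
  shows "eval_word G gs w \<in> carrier G"
  using assms(2) by (induction w) (use assms(1) in \<open>auto simp: subset_iff\<close>)

lemma eval_letter_mult:
  assumes "set gs \<subseteq> carrier G" "word_over (length gs) (x # w)"
  shows "eval_word G gs (letter_mult x w) = eval_word G gs (x # w)"
proof (cases w)
  case (Cons y v)
  obtain i e where x: "x = (i, e)" by force
  have g: "gs ! i \<in> carrier G" "eval_word G gs v \<in> carrier G"
    using assms Cons x by (auto intro!: eval_word_closed simp: subset_iff)
  show ?thesis
    using Cons x g by (cases y) (auto simp flip: m_assoc)
qed (cases x, simp)

lemma eval_reduce_word:
  assumes "set gs \<subseteq> carrier G" "word_over (length gs) w"
  shows "eval_word G gs (reduce_word w) = eval_word G gs w"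
  using assms(2)
proof (induction w)
  case (Cons x w)
  have "word_over (length gs) (reduce_word w)"
    by (rule reduced_word_imp_over, rule reduced_reduce_word) (use Cons.prems in simp)
  then show ?case
    using eval_letter_mult[OF assms(1), of x "reduce_word w"] Cons
    by (cases x) (auto simp: reduce_word_def)
qed (simp add: reduce_word_def)

text \<open>
  Reduction does not change the value of a word, and in a free basis the reduced word is determined
  by the value. Hence anything that depends only on the reduced form of a word depends only on the
  group element.
\<close>

lemma free_basis_eval_eq_imp_reduce_eq:
  assumes "free_basis G gs" "word_over (length gs) w" "word_over (length gs) w'"
    "eval_word G gs w = eval_word G gs w'"
  shows "reduce_word w = reduce_word w'"
proof -
  have gs: "set gs \<subseteq> carrier G" using assms by (simp add: free_basis_def)
  have "\<exists>!v. reduced_word (length gs) v \<and> eval_word G gs v = eval_word G gs w"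
    using assms(1) eval_word_closed[OF gs assms(2)] by (simp add: free_basis_def)
  then show ?thesis
    using assms gs by (metis eval_reduce_word reduced_reduce_word)
qed

lemma eval_word_append:
  assumes "set gs \<subseteq> carrier G" "word_over (length gs) v" "word_over (length gs) w"
  shows "eval_word G gs (v @ w) = eval_word G gs v \<otimes> eval_word G gs w"
  using assms(2)
proof (induction v)
  case (Cons x v)
  obtain i e where x: "x = (i, e)" by force
  have "gs ! i \<in> carrier G" "eval_word G gs v \<in> carrier G" "eval_word G gs w \<in> carrier G"
    using assms Cons.prems x by (auto intro!: eval_word_closed simp: subset_iff)
  then show ?case using Cons x by (simp add: m_assoc)
qed (simp add: eval_word_closed assms)

end

text \<open>
  If every letter acts by a permutation and its inverse letter by the inverse permutation, then
  cancelling does not change the action of a word. Together with the previous fact this makes a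
  free group act.
\<close>

lemma foldr_act_reduce_word:
  assumes act: "\<And>i e \<omega>. i < m \<Longrightarrow> \<omega> \<in> \<Omega> \<Longrightarrow> act (i, e) \<omega> \<in> \<Omega> \<and> act (i, \<not> e) (act (i, e) \<omega>) = \<omega>"
    and "word_over m w" "\<omega> \<in> \<Omega>"
  shows "foldr act w \<omega> \<in> \<Omega> \<and> foldr act (reduce_word w) \<omega> = foldr act w \<omega>"
  using assms(2)
proof (induction w)
  case (Cons x w)
  obtain i e where x: "x = (i, e)" by force
  have i: "i < m" and w: "word_over m w" using Cons.prems x by auto
  let ?v = "reduce_word w"
  have v: "word_over m ?v" by (intro reduced_word_imp_over reduced_reduce_word w)
  have inv: "foldr act u \<omega> \<in> \<Omega>" if "word_over m u" for u
    using that by (induction u) (use act assms(3) in force)+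
  have "foldr act (letter_mult x u) \<omega> = act x (foldr act u \<omega>)" if "word_over m u" for u
  proof (cases u)
    case (Cons y z)
    then obtain j e' where y: "y = (j, e')" by force
    show ?thesis
    proof (cases "i = j \<and> e \<noteq> e'")
      case True
      then have e: "e = (\<not> e')" by auto
      have "foldr act z \<omega> \<in> \<Omega>" using that Cons inv by auto
      then show ?thesis using act[of i "foldr act z \<omega>" e'] True x y Cons i e by auto
    qed (use x y Cons in auto)
  qed simp
  then show ?case
    using Cons.IH[OF w] v x act[OF i] inv[OF w] by (simp add: reduce_word_def)
qed (simp add: reduce_word_def assms)

lemma length_kummer_list: "xs \<noteq> [] \<Longrightarrow> length (kummer_list G n xs) = n * (length xs - 1) + 1"
  by (simp add: kummer_list_def length_concat o_def sum_list_triv)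

lemma concat_map_nth:
  assumes "j < n" "i < r" "\<And>j. length (f j) = r"
  shows "concat (map f [0..<n]) ! (j * r + i) = f j ! i"
  using assms(1)
proof (induction n)
  case (Suc n)
  have len: "length (concat (map f [0..<n])) = n * r"
    using assms(3) by (simp add: length_concat o_def sum_list_triv)
  show ?case
  proof (cases "j = n")
    case True
    then show ?thesis using assms(2) len by (simp add: nth_append)
  next
    case False
    then have "j < n" using Suc.prems by simp
    moreover have "j * r + i < n * r"
    proof -
      have "j * r + i < Suc j * r" using assms(2) by simp
      also have "\<dots> \<le> n * r" using \<open>j < n\<close> by (intro mult_le_mono1) simp
      finally show ?thesis .
    qed
    ultimately show ?thesis using Suc.IH len by (simp add: nth_append)
  qed
qed simp

lemma kummer_index_less: "j < n \<Longrightarrow> i < r \<Longrightarrow> j * r + i < n * (r::nat)"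
proof -
  assume "j < n" "i < r"
  then have "j * r + i < Suc j * r" by simp
  also have "\<dots> \<le> n * r" using \<open>j < n\<close> by (intro mult_le_mono1) simp
  finally show ?thesis .
qed

lemma kummer_index_div_mod: "i < r \<Longrightarrow> (j * r + i) div r = j \<and> (j * r + i) mod r = (i::nat)"
  by (auto simp: div_mult_self3)

lemma kummer_list_nth:
  assumes "j < n" "i < length as"
  shows "kummer_list G n (as @ [b]) ! (j * length as + i) = conj_by G (as ! i) (b [^]\<^bsub>G\<^esub> j)"
proof -
  have len: "length (concat (map (\<lambda>j. map (\<lambda>a. conj_by G a (b [^]\<^bsub>G\<^esub> j)) as) [0..<n])) = n * length as"
    by (simp add: length_concat o_def sum_list_triv)
  then show ?thesis
    unfolding kummer_list_def
    using assms kummer_index_less[OF assms] by (simp add: nth_append concat_map_nth)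
qed

lemma kummer_list_nth_last:
  "kummer_list G n (as @ [b]) ! (n * length as) = b [^]\<^bsub>G\<^esub> n"
  unfolding kummer_list_def by (simp add: nth_append length_concat o_def sum_list_triv)

text \<open>
  The position \<open>j r + i\<close> of the Kummer list holds the conjugate of the \<open>i\<close>-th generator by \<open>b\<^sup>j\<close>; the
  last position \<open>n r\<close> holds \<open>b\<^sup>n\<close>.
\<close>

lemma kummer_index_cases:
  assumes "p < n * r + (1::nat)"
  obtains (conj) j i where "j < n" "i < r" "p = j * r + i" | (power) "p = n * r"
proof (cases "p = n * r")
  case False
  then have "p < n * r" using assms by simp
  then have "r > 0" by (cases r) auto
  then show ?thesis
    using conj[of "p div r" "p mod r"] \<open>p < n * r\<close> by (simp add: less_mult_imp_div_less)
qed (use power in auto)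

text \<open>
  With \<open>b\<close> the last of \<open>r + 1\<close> free generators, the pair \<open>(c, u)\<close> stands for the element
  \<open>b\<^sup>c u\<close>, where \<open>c < n\<close> is a coset representative and \<open>u\<close> a reduced word in the Kummer list.
  The following is left multiplication by a letter, written in these coordinates.
\<close>

definition coset_act ::
  "nat \<Rightarrow> nat \<Rightarrow> nat \<times> bool \<Rightarrow> nat \<times> (nat \<times> bool) list \<Rightarrow> nat \<times> (nat \<times> bool) list" where
  "coset_act n r x \<omega> = (case (x, \<omega>) of ((i, e), (c, u)) \<Rightarrow>
     if i < r then (c, letter_mult (c * r + i, e) u)
     else if e then (if Suc c < n then (Suc c, u) else (0, letter_mult (n * r, True) u))
     else (if 0 < c then (c - 1, u) else (n - 1, letter_mult (n * r, False) u)))"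

definition coset_states :: "nat \<Rightarrow> nat \<Rightarrow> (nat \<times> (nat \<times> bool) list) set" where
  "coset_states n r = {(c, u). c < n \<and> reduced_word (n * r + 1) u}"

lemma coset_act_inverse:
  assumes "i < r + 1" "\<omega> \<in> coset_states n r"
  shows "coset_act n r (i, e) \<omega> \<in> coset_states n r \<and>
     coset_act n r (i, \<not> e) (coset_act n r (i, e) \<omega>) = \<omega>"
proof -
  obtain c u where \<omega>: "\<omega> = (c, u)" "c < n" "reduced_word (n * r + 1) u"
    using assms(2) by (auto simp: coset_states_def)
  have inv: "letter_mult (p, False) (letter_mult (p, True) u) = u"
    "letter_mult (p, True) (letter_mult (p, False) u) = u" for p
    using letter_mult_inverse[OF \<omega>(3), of p True] letter_mult_inverse[OF \<omega>(3), of p False] by auto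
  have red: "reduced_word (n * r + 1) (letter_mult (p, e) u)" if "p \<le> n * r" for p
    using that by (intro reduced_letter_mult[OF \<omega>(3)]) simp
  show ?thesis
  proof (cases "i < r")
    case True
    have "c * r + i \<le> n * r" using kummer_index_less[OF \<omega>(2) True] by simp
    from red[OF this] show ?thesis using True \<omega> letter_mult_inverse[OF \<omega>(3)]
      by (simp add: coset_act_def coset_states_def)
  next
    case False
    show ?thesis using False \<omega> inv red[of "n * r"]
      by (cases e; cases "Suc c < n"; cases c) (auto simp: coset_act_def coset_states_def)
  qed
qed

definition expand_letter :: "nat \<Rightarrow> nat \<Rightarrow> nat \<times> bool \<Rightarrow> (nat \<times> bool) list" where
  "expand_letter n r x = (case x of (p, e) \<Rightarrow>
     if p < n * r
     then replicate (p div r) (r, False) @ [(p mod r, e)] @ replicate (p div r) (r, True)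
     else replicate n (r, e))"

text \<open>
  Going up to level \<open>j\<close>, multiplying there and coming back down multiplies \<open>u\<close> by the Kummer letter:
  on the level \<open>0\<close> the action restricts to left multiplication of reduced Kummer words. This is
  what makes different reduced Kummer words distinguishable.
\<close>

lemma coset_act_expand_letter:
  assumes "fst x < n * r + 1" "0 < n"
  shows "foldr (coset_act n r) (expand_letter n r x) (0, u) = (0, letter_mult x u)"
proof -
  obtain p e where x: "x = (p, e)" by force
  have up: "foldr (coset_act n r) (replicate j (r, True)) (0, v) = (j, v)" if "j < n" for j v
    using that by (induction j) (auto simp: coset_act_def)
  have down: "foldr (coset_act n r) (replicate j (r, False)) (j, v) = (0, v)" for j v
  proof (induction j)
    case (Suc j)
    then show ?case
      unfolding replicate_append_same[symmetric] replicate_Suc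
      by (simp add: coset_act_def)
  qed simp
  show ?thesis
    using assms(1)[unfolded x, simplified fst_conv]
  proof (cases rule: kummer_index_cases)
    case (conj j i)
    then have "p < n * r" "p div r = j" "p mod r = i"
      using kummer_index_less[OF conj(1,2)] kummer_index_div_mod[OF conj(2), of j] by auto
    then show ?thesis
      using up down conj x by (simp add: expand_letter_def coset_act_def)
  next
    case power
    obtain n' where n: "n = Suc n'" using assms by (cases n) auto
    show ?thesis
    proof (cases e)
      case True
      have "coset_act n r (r, True) (n', u) = (0, letter_mult (n * r, True) u)"
        by (simp add: n coset_act_def)
      then show ?thesis using True up[of n' u] power x n by (simp add: expand_letter_def)
    next
      case False
      have "foldr (coset_act n r) (replicate n' (r, False)) (coset_act n r (r, False) (0, u)) =
          (0, letter_mult (n * r, False) u)"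
        using down[of n'] by (simp add: n coset_act_def)
      moreover have "replicate n (r, False) = replicate n' (r, False) @ [(r, False)]"
        by (simp add: n replicate_append_same)
      ultimately show ?thesis using False power x by (simp add: expand_letter_def)
    qed
  qed
qed

lemma word_over_expand_letter:
  assumes "fst x < n * r + 1"
  shows "word_over (r + 1) (expand_letter n r x)"
proof -
  obtain p e where x: "x = (p, e)" by force
  have "p < n * r \<Longrightarrow> p mod r < r" by (cases r) auto
  then show ?thesis using x by (auto simp: expand_letter_def word_over_def)
qed

context group
begin

lemma conj_by_closed [simp]: "a \<in> carrier G \<Longrightarrow> b \<in> carrier G \<Longrightarrow> conj_by G a b \<in> carrier G"
  by (simp add: conj_by_def)

lemma kummer_list_closed:
  assumes "set xs \<subseteq> carrier G" "xs \<noteq> []"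
  shows "set (kummer_list G n xs) \<subseteq> carrier G"
  using assms in_set_butlastD[of _ xs] last_in_set[of xs]
  by (auto simp: kummer_list_def subset_iff)

lemma eval_word_replicate:
  assumes "set gs \<subseteq> carrier G" "i < length gs"
  shows "eval_word G gs (replicate j (i, True)) = gs ! i [^] j"
    "eval_word G gs (replicate j (i, False)) = inv (gs ! i [^] j)"
proof -
  have g: "gs ! i \<in> carrier G" using assms by auto
  show "eval_word G gs (replicate j (i, True)) = gs ! i [^] j"
    by (induction j) (use g in \<open>auto simp: nat_pow_Suc2[symmetric] nat_pow_Suc2\<close>)
  show "eval_word G gs (replicate j (i, False)) = inv (gs ! i [^] j)"
    by (induction j) (use g in \<open>auto simp: inv_mult_group\<close>)
qed

lemma eval_expand_letter:
  assumes gs: "set (as @ [b]) \<subseteq> carrier G" and x: "fst x < n * length as + 1"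
  shows "eval_word G (as @ [b]) (expand_letter n (length as) x) =
     eval_word G (kummer_list G n (as @ [b])) [x]"
proof -
  obtain p e where xp: "x = (p, e)" by force
  have b: "b \<in> carrier G" using gs by simp
  let ?ks = "kummer_list G n (as @ [b])"
  note rep = eval_word_replicate[OF gs, of "length as"]
  show ?thesis
    using x[unfolded xp, simplified fst_conv]
  proof (cases rule: kummer_index_cases)
    case (conj j i)
    let ?r = "length as"
    have p: "p < n * ?r" "p div ?r = j" "p mod ?r = i"
      using kummer_index_less[OF conj(1,2)] kummer_index_div_mod[OF conj(2), of j] conj(3) by auto
    have a: "as ! i \<in> carrier G" using gs conj by auto
    have "eval_word G (as @ [b]) (replicate j (?r, False) @ [(i, e)] @ replicate j (?r, True)) =
        inv (b [^] j) \<otimes> ((if e then as ! i else inv (as ! i)) \<otimes> b [^] j)"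
      using rep[of j] conj a b gs
      by (subst eval_word_append[OF gs]) (auto simp: word_over_def nth_append)
    moreover have "?ks ! p = conj_by G (as ! i) (b [^] j)"
      using kummer_list_nth[of j n i as] conj by auto
    ultimately show ?thesis
      using p a b xp by (auto simp: expand_letter_def conj_by_def inv_mult_group m_assoc)
  next
    case power
    then show ?thesis
      using xp rep[of n] kummer_list_nth_last[of G n as b] b
      by (auto simp: expand_letter_def)
  qed
qed

lemma eval_expand_word:
  assumes gs: "set (as @ [b]) \<subseteq> carrier G" and w: "word_over (n * length as + 1) w"
  shows "eval_word G (as @ [b]) (concat (map (expand_letter n (length as)) w)) =
     eval_word G (kummer_list G n (as @ [b])) w"
    and "word_over (length as + 1) (concat (map (expand_letter n (length as)) w))"
proof -
  let ?ks = "kummer_list G n (as @ [b])"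
  have ks: "set ?ks \<subseteq> carrier G" by (rule kummer_list_closed[OF gs]) simp
  have len: "length ?ks = n * length as + 1" by (simp add: length_kummer_list)
  have "eval_word G (as @ [b]) (concat (map (expand_letter n (length as)) w)) = eval_word G ?ks w \<and>
    word_over (length as + 1) (concat (map (expand_letter n (length as)) w))"
    using w
  proof (induction w)
    case (Cons x w)
    have x: "fst x < n * length as + 1" and w: "word_over (n * length as + 1) w"
      using Cons.prems by auto
    have "eval_word G ?ks (x # w) = eval_word G ?ks [x] \<otimes> eval_word G ?ks w"
      using eval_word_append[OF ks, of "[x]" w] x w len by simp
    moreover have "eval_word G (as @ [b]) (expand_letter n (length as) x @
        concat (map (expand_letter n (length as)) w)) =
        eval_word G (as @ [b]) (expand_letter n (length as) x) \<otimes>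
        eval_word G (as @ [b]) (concat (map (expand_letter n (length as)) w))"
      using word_over_expand_letter[OF x] Cons.IH[OF w] by (intro eval_word_append[OF gs]) simp_all
    ultimately show ?case
      using Cons.IH[OF w] eval_expand_letter[OF gs x] word_over_expand_letter[OF x] by simp
  qed simp
  then show "eval_word G (as @ [b]) (concat (map (expand_letter n (length as)) w)) = eval_word G ?ks w"
    "word_over (length as + 1) (concat (map (expand_letter n (length as)) w))" by auto
qed

text \<open>
  The action is the left regular one in the coordinates \<open>b\<^sup>c u\<close>; wrapping around from level \<open>n - 1\<close> to
  level \<open>0\<close>, or back, is where the letter \<open>b\<^sup>n\<close> comes in.
\<close>

lemma eval_coset_act:
  assumes gs: "set (as @ [b]) \<subseteq> carrier G" and i: "i < length as + 1"
    and \<omega>: "(c, u) \<in> coset_states n (length as)"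
    and eq: "coset_act n (length as) (i, e) (c, u) = (c', u')"
  shows "b [^] c' \<otimes> eval_word G (kummer_list G n (as @ [b])) u' =
     eval_word G (as @ [b]) [(i, e)] \<otimes> (b [^] c \<otimes> eval_word G (kummer_list G n (as @ [b])) u)"
proof -
  let ?ks = "kummer_list G n (as @ [b])" and ?r = "length as"
  have ks: "set ?ks \<subseteq> carrier G" by (rule kummer_list_closed[OF gs]) simp
  have len: "length ?ks = n * length as + 1" by (simp add: length_kummer_list)
  have b: "b \<in> carrier G" using gs by simp
  have c: "c < n" and u: "reduced_word (n * ?r + 1) u" using \<omega> by (auto simp: coset_states_def)
  have u': "word_over (length ?ks) u" using reduced_word_imp_over[OF u] len by simp
  have U: "eval_word G ?ks u \<in> carrier G" by (rule eval_word_closed[OF ks u'])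
  have lm: "eval_word G ?ks (letter_mult (p, e) u) =
      (if e then ?ks ! p else inv (?ks ! p)) \<otimes> eval_word G ?ks u" if "p \<le> n * ?r" for p e
    using eval_letter_mult[OF ks, of "(p, e)" u] u' that len by simp
  show ?thesis
  proof (cases "i < ?r")
    case True
    then have p: "c * ?r + i \<le> n * ?r" using kummer_index_less[OF c True] by simp
    have a: "as ! i \<in> carrier G" using gs True by auto
    have "b [^] c \<otimes> ((if e then conj_by G (as ! i) (b [^] c) else inv (conj_by G (as ! i) (b [^] c))) \<otimes> eval_word G ?ks u)
       = (if e then as ! i else inv (as ! i)) \<otimes> (b [^] c \<otimes> eval_word G ?ks u)"
      using a b U
      by (simp add: conj_by_def inv_mult_group m_assoc[symmetric])
    then show ?thesis
      using eq True lm[OF p, of e] kummer_list_nth[OF c True, of G b] a b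
      by (auto simp: coset_act_def nth_append)
  next
    case False
    then have i: "i = ?r" using i by simp
    have last: "?ks ! (n * ?r) = b [^] n" by (rule kummer_list_nth_last)
    show ?thesis
    proof (cases e)
      case True
      have B: "b \<otimes> (b [^] c \<otimes> V) = b [^] Suc c \<otimes> V" if "V \<in> carrier G" for V
        using b that by (simp add: m_assoc[symmetric] nat_pow_Suc2[symmetric] del: nat_pow_Suc)
      show ?thesis
      proof (cases "Suc c < n")
        case True
        then show ?thesis using eq \<open>e\<close> i B[OF U] b by (auto simp: coset_act_def)
      next
        case F: False
        then have "n = Suc c" using c by simp
        then show ?thesis
          using eq \<open>e\<close> i B[OF U] F b last U lm[of "n * ?r" True]
          by (auto simp: coset_act_def simp del: nat_pow_Suc)
      qed
    next
      case False
      have B: "inv b \<otimes> (b [^] Suc d \<otimes> V) = b [^] d \<otimes> V" if "V \<in> carrier G" for V d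
      proof -
        have "inv b \<otimes> (b \<otimes> (b [^] d \<otimes> V)) = b [^] d \<otimes> V"
          using b that by (simp flip: m_assoc)
        then show ?thesis using b that nat_pow_Suc2[OF b, of d] by (simp add: m_assoc)
      qed
      show ?thesis
      proof (cases c)
        case 0
        obtain n' where n: "n = Suc n'" using c by (cases n) auto
        have "inv b \<otimes> eval_word G ?ks u = b [^] n' \<otimes> (inv (b [^] n) \<otimes> eval_word G ?ks u)"
        proof -
          have B': "inv b \<otimes> (b [^] n \<otimes> V) = b [^] n' \<otimes> V" if "V \<in> carrier G" for V
            using B[OF that] n by simp
          have "inv b \<otimes> (b [^] n \<otimes> (inv (b [^] n) \<otimes> eval_word G ?ks u)) =
             b [^] n' \<otimes> (inv (b [^] n) \<otimes> eval_word G ?ks u)"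
            by (rule B') (use b U in simp)
          moreover have "b [^] n \<otimes> (inv (b [^] n) \<otimes> eval_word G ?ks u) = eval_word G ?ks u"
            using b U by (simp add: m_assoc[symmetric])
          ultimately show ?thesis by simp
        qed
        then show ?thesis
          using eq False 0 i b U last lm[of "n * ?r" False] n by (auto simp: coset_act_def)
      next
        case (Suc d)
        then show ?thesis using eq False i B[OF U, of d] b U by (auto simp: coset_act_def simp del: nat_pow_Suc)
      qed
    qed
  qed
qed

lemma eval_as_coset_form:
  assumes gs: "set (as @ [b]) \<subseteq> carrier G" and "0 < n" and w: "word_over (length as + 1) w"
    and "foldr (coset_act n (length as)) w (0, []) = (c, u)"
  shows "(c, u) \<in> coset_states n (length as) \<and>
     eval_word G (as @ [b]) w = b [^] c \<otimes> eval_word G (kummer_list G n (as @ [b])) u"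
  using w assms(4)
proof (induction w arbitrary: c u)
  case Nil
  then show ?case using assms by (auto simp: coset_states_def)
next
  case (Cons x w)
  obtain i e where x: "x = (i, e)" by force
  obtain c1 u1 where 1: "foldr (coset_act n (length as)) w (0, []) = (c1, u1)" by force
  have w: "word_over (length as + 1) w" and i: "i < length as + 1" using Cons.prems x by auto
  note IH = Cons.IH[OF w 1]
  have st: "coset_act n (length as) (i, e) (c1, u1) = (c, u)" using Cons.prems x 1 by simp
  have b: "b \<in> carrier G" using gs by simp
  have cl: "eval_word G (as @ [b]) w \<in> carrier G"
    by (rule eval_word_closed[OF gs]) (use w in simp)
  have g: "(as @ [b]) ! i \<in> carrier G" using gs i by (auto simp: nth_append)
  show ?case
    using eval_coset_act[OF gs i IH[THEN conjunct1] st] coset_act_inverse[OF i IH[THEN conjunct1], of e] st IH x cl g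
    by (auto simp: m_assoc)
qed

text \<open>
  Existence: writing \<open>g\<close> as a word and letting it act on \<open>(0, [])\<close> gives \<open>g = b\<^sup>c u\<close> with
  \<open>0 \<le> c < n\<close>. As \<open>n\<close> divides \<open>\<omega> g\<close> and \<open>\<omega> u\<close>, it divides \<open>c\<close>, so \<open>c = 0\<close>.
  Uniqueness: two reduced Kummer words with the same value have expansions in the original
  generators with the same value, hence with the same action; but they send \<open>(0, [])\<close> to \<open>(0, w)\<close>
  and \<open>(0, w')\<close>.
\<close>

lemma kummer_list_free:
  assumes fb: "free_basis G (as @ [b])" and n: "0 < n"
    and \<omega>: "\<And>x y. x \<in> carrier G \<Longrightarrow> y \<in> carrier G \<Longrightarrow> \<omega> (x \<otimes> y) = \<omega> x + (\<omega> y :: int)"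
    and \<omega>a: "\<And>a. a \<in> set as \<Longrightarrow> \<omega> a = 0" and \<omega>b: "\<omega> b = 1"
    and g: "g \<in> carrier G" "int n dvd \<omega> g"
  shows "\<exists>!w. reduced_word (length (kummer_list G n (as @ [b]))) w \<and>
     eval_word G (kummer_list G n (as @ [b])) w = g"
proof -
  let ?ks = "kummer_list G n (as @ [b])" and ?r = "length as"
  have gs: "set (as @ [b]) \<subseteq> carrier G" using fb by (simp add: free_basis_def)
  have b: "b \<in> carrier G" using gs by simp
  have ks: "set ?ks \<subseteq> carrier G" by (rule kummer_list_closed[OF gs]) simp
  have len: "length ?ks = n * ?r + 1" by (simp add: length_kummer_list)
  have \<omega>1: "\<omega> \<one> = 0" using \<omega>[of \<one> \<one>] by simp
  have \<omega>inv: "\<omega> (inv x) = - \<omega> x" if "x \<in> carrier G" for x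
    using \<omega>[of x "inv x"] that \<omega>1 by simp
  have \<omega>pow: "\<omega> (b [^] j) = int j" for j :: nat
    by (induction j) (use b \<omega>1 \<omega> \<omega>b in auto)
  have \<omega>ks: "int n dvd \<omega> (?ks ! p)" if "p < n * ?r + 1" for p
    using that
  proof (cases rule: kummer_index_cases)
    case (conj j i)
    have a: "as ! i \<in> carrier G" "as ! i \<in> set as" using gs conj by auto
    then show ?thesis
      using conj b \<omega> \<omega>inv \<omega>a by (simp add: kummer_list_nth conj_by_def)
  qed (simp add: kummer_list_nth_last \<omega>pow)
  have \<omega>eval: "int n dvd \<omega> (eval_word G ?ks u)" if "word_over (length ?ks) u" for u
    using that
  proof (induction u)
    case (Cons x u)
    obtain p e where x: "x = (p, e)" by force
    have "?ks ! p \<in> carrier G" using Cons.prems x ks by auto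
    moreover have "eval_word G ?ks u \<in> carrier G"
      using Cons.prems by (intro eval_word_closed[OF ks]) simp
    ultimately show ?case using Cons \<omega>ks[of p] x \<omega> \<omega>inv len by (auto simp: dvd_add)
  qed (simp add: \<omega>1)
  show ?thesis
  proof (rule ex_ex1I)
    obtain w where w: "reduced_word (?r + 1) w" "eval_word G (as @ [b]) w = g"
      using fb g by (auto simp: free_basis_def)
    obtain c u where cu: "foldr (coset_act n ?r) w (0, []) = (c, u)" by force
    note form = eval_as_coset_form[OF gs n reduced_word_imp_over[OF w(1)] cu]
    have c: "c < n" and u: "reduced_word (length ?ks) u"
      using form len by (auto simp: coset_states_def)
    have "\<omega> g = int c + \<omega> (eval_word G ?ks u)"
      using form w(2) b \<omega> \<omega>pow eval_word_closed[OF ks reduced_word_imp_over[OF u]] by auto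
    then have "int n dvd int c"
      using \<omega>eval[OF reduced_word_imp_over[OF u]] g(2) by (simp add: dvd_add_left_iff)
    then have "c = 0" using c by (metis int_dvd_int_iff nat_dvd_not_less neq0_conv)
    then show "\<exists>w. reduced_word (length ?ks) w \<and> eval_word G ?ks w = g"
      using form w(2) u eval_word_closed[OF ks reduced_word_imp_over[OF u]] by auto
  next
    fix w w'
    assume "reduced_word (length ?ks) w \<and> eval_word G ?ks w = g"
      "reduced_word (length ?ks) w' \<and> eval_word G ?ks w' = g"
    then have red: "reduced_word (n * ?r + 1) w" "reduced_word (n * ?r + 1) w'"
      and eq: "eval_word G ?ks w = eval_word G ?ks w'" using len by auto
    let ?ex = "\<lambda>w. concat (map (expand_letter n ?r) w)"
    note ew = eval_expand_word[OF gs reduced_word_imp_over[OF red(1)]]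
    note ew' = eval_expand_word[OF gs reduced_word_imp_over[OF red(2)]]
    have "reduce_word (?ex w) = reduce_word (?ex w')"
      by (rule free_basis_eval_eq_imp_reduce_eq[OF fb]) (use ew ew' eq in auto)
    moreover have "foldr (coset_act n ?r) (reduce_word v) (0, []) = foldr (coset_act n ?r) v (0, [])"
      if "word_over (?r + 1) v" for v
      using foldr_act_reduce_word[where m = "?r + 1" and \<Omega> = "coset_states n ?r" and act = "coset_act n ?r",
          OF coset_act_inverse that] n by (auto simp: coset_states_def)
    moreover have "foldr (coset_act n ?r) (?ex v) (0, []) = (0, v)" if "reduced_word (n * ?r + 1) v" for v
      using that
    proof (induction v)
      case (Cons x v)
      then have "reduced_word (n * ?r + 1) v" "fst x < n * ?r + 1" by (auto simp: reduced_word_Cons)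
      then show ?case
        using Cons coset_act_expand_letter[of x n ?r v] n letter_mult_of_reduced[OF Cons.prems] by simp
    qed simp
    ultimately show "w = w'" using ew(2) ew'(2) red by (metis prod.inject)
  qed
qed

lemma eval_word_hom:
  assumes "group H" "\<phi> \<in> hom G H" "set gs \<subseteq> carrier G" "word_over (length gs) w"
  shows "\<phi> (eval_word G gs w) = eval_word H (map \<phi> gs) w"
proof -
  note closed = eval_word_closed[OF assms(3)]
  interpret group_hom G H \<phi>
    using assms by (simp add: group_hom_def group_hom_axioms_def is_group)
  show ?thesis
    using assms(4)
  proof (induction w)
    case (Cons x w)
    obtain i e where x: "x = (i, e)" by force
    have "gs ! i \<in> carrier G" "eval_word G gs w \<in> carrier G"
      using Cons.prems x assms(3) closed[of w] by auto
    then show ?case using Cons x by auto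
  qed simp
qed

lemma free_basis_of_injective_hom:
  assumes "group H" "\<phi> \<in> hom G H" "inj_on \<phi> (carrier G)" "set gs \<subseteq> carrier G"
    and "\<And>g. g \<in> carrier G \<Longrightarrow>
       \<exists>!w. reduced_word (length gs) w \<and> eval_word H (map \<phi> gs) w = \<phi> g"
  shows "free_basis G gs"
proof -
  have "(reduced_word (length gs) w \<and> eval_word H (map \<phi> gs) w = \<phi> g) =
      (reduced_word (length gs) w \<and> eval_word G gs w = g)" if "g \<in> carrier G" for g w
    using eval_word_hom[OF assms(1,2,4), of w] eval_word_closed[OF assms(4), of w]
      reduced_word_imp_over[of "length gs" w] inj_onD[OF assms(3)] that by metis
  then show ?thesis using assms(4,5) by (simp add: free_basis_def)
qed

end

lemma kummer_list_hom:
  assumes "group G" "group H" "\<phi> \<in> hom G H" "set xs \<subseteq> carrier G" "xs \<noteq> []"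
  shows "map \<phi> (kummer_list G n xs) = kummer_list H n (map \<phi> xs)"
proof -
  interpret group_hom G H \<phi>
    using assms by (simp add: group_hom_def group_hom_axioms_def)
  have l: "last xs \<in> carrier G" and bl: "set (butlast xs) \<subseteq> carrier G"
    using assms in_set_butlastD[of _ xs] by auto
  have "\<phi> (conj_by G a (last xs [^]\<^bsub>G\<^esub> j)) = conj_by H (\<phi> a) (\<phi> (last xs) [^]\<^bsub>H\<^esub> j)"
    if "a \<in> set (butlast xs)" for a and j :: nat
    using that bl l by (auto simp: conj_by_def hom_nat_pow)
  then show ?thesis
    using l assms(5)
    by (simp add: kummer_list_def map_concat o_def map_butlast[symmetric] last_map hom_nat_pow
        cong: map_cong)
qed

text \<open>
  For \<open>A = a\<^sub>r \<cdots> a\<^sub>1\<close> the product telescopes: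
  \<open>b\<^sup>n A\<^bsup>b^(n-1)\<^esup> \<cdots> A\<^bsup>b\<^esup> A = (b A)\<^sup>n\<close>.
\<close>

lemma (in group) foldr_mult_append:
  assumes "set xs \<subseteq> carrier G" "set ys \<subseteq> carrier G"
  shows "foldr (mult G) (xs @ ys) \<one> = foldr (mult G) xs \<one> \<otimes> foldr (mult G) ys \<one>"
    and "foldr (mult G) xs \<one> \<in> carrier G"
proof -
  have cl: "foldr (mult G) zs \<one> \<in> carrier G" if "set zs \<subseteq> carrier G" for zs
    using that by (induction zs) auto
  show "foldr (mult G) xs \<one> \<in> carrier G" by (rule cl[OF assms(1)])
  show "foldr (mult G) (xs @ ys) \<one> = foldr (mult G) xs \<one> \<otimes> foldr (mult G) ys \<one>"
    using assms(1) by (induction xs) (auto simp: cl assms m_assoc)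
qed

lemma (in group) kummer_list_product:
  assumes "set (as @ [b]) \<subseteq> carrier G"
  shows "foldr (mult G) (rev (kummer_list G n (as @ [b]))) \<one> =
     foldr (mult G) (rev (as @ [b])) \<one> [^] n"
proof -
  let ?P = "\<lambda>xs. foldr (mult G) xs \<one>"
  let ?v = "\<lambda>n. concat (map (\<lambda>j. map (\<lambda>a. conj_by G a (b [^] j)) as) [0..<n])"
  have b: "b \<in> carrier G" and as: "set as \<subseteq> carrier G" using assms by auto
  have A: "?P (rev as) \<in> carrier G" using foldr_mult_append(2)[of "rev as" "[]"] as by simp
  have conj: "?P (rev (map (\<lambda>a. conj_by G a c) as)) = conj_by G (?P (rev as)) c"
    if c: "c \<in> carrier G" for c
    using as
  proof (induction as)
    case Nil
    then show ?case using c by (simp add: conj_by_def)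
  next
    case (Cons a as)
    have P: "?P (rev as) \<in> carrier G" using foldr_mult_append(2)[of "rev as" "[]"] Cons.prems by simp
    have "set (rev (map (\<lambda>a. conj_by G a c) as)) \<subseteq> carrier G"
      using Cons.prems c by (auto simp: subset_iff)
    from foldr_mult_append(1)[OF this, of "[conj_by G a c]"]
    have "?P (rev (map (\<lambda>a. conj_by G a c) (a # as))) =
        conj_by G (?P (rev as)) c \<otimes> conj_by G a c"
      using Cons c by simp
    moreover have "?P (rev (a # as)) = ?P (rev as) \<otimes> a"
      using Cons.prems foldr_mult_append(1)[of "rev as" "[a]"] by simp
    moreover have "conj_by G x c \<otimes> conj_by G a c = conj_by G (x \<otimes> a) c" if "x \<in> carrier G" for x
    proof -
      have "c \<otimes> (inv c \<otimes> (a \<otimes> c)) = a \<otimes> c" using c Cons.prems by (simp flip: m_assoc)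
      then show ?thesis using that c Cons.prems by (simp add: conj_by_def m_assoc)
    qed
    ultimately show ?case using P by simp
  qed
  have vcl: "set (?v n) \<subseteq> carrier G" for n using as b by (auto simp: subset_iff)
  have main: "b [^] n \<otimes> ?P (rev (?v n)) = (b \<otimes> ?P (rev as)) [^] n" for n
  proof (induction n)
    case (Suc n)
    let ?A = "?P (rev as)" and ?V = "?P (rev (?v n))"
    have V: "?V \<in> carrier G" using foldr_mult_append(2)[of "rev (?v n)" "[]"] vcl[of n] by simp
    have "rev (?v (Suc n)) = rev (map (\<lambda>a. conj_by G a (b [^] n)) as) @ rev (?v n)" by simp
    then have "?P (rev (?v (Suc n))) = conj_by G ?A (b [^] n) \<otimes> ?V"
    proof -
      have "set (rev (map (\<lambda>a. conj_by G a (b [^] n)) as)) \<subseteq> carrier G" using as b by auto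
      then show ?thesis
        using foldr_mult_append(1)[of "rev (map (\<lambda>a. conj_by G a (b [^] n)) as)" "rev (?v n)"]
          conj[of "b [^] n"] b vcl[of n] \<open>rev (?v (Suc n)) = _\<close> by (metis nat_pow_closed set_rev)
    qed
    moreover have "b [^] Suc n \<otimes> (conj_by G ?A (b [^] n) \<otimes> ?V) = (b \<otimes> ?A) \<otimes> (b [^] n \<otimes> ?V)"
    proof -
      have "b \<otimes> c \<otimes> (conj_by G ?A c \<otimes> V) = (b \<otimes> ?A) \<otimes> (c \<otimes> V)"
        if c: "c \<in> carrier G" and V: "V \<in> carrier G" for c V
      proof -
        have "c \<otimes> (inv c \<otimes> y) = y" if "y \<in> carrier G" for y
          using c that by (simp flip: m_assoc)
        then show ?thesis using A b c V by (simp add: conj_by_def m_assoc)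
      qed
      from this[of "b [^] n" ?V] show ?thesis
        using V b nat_pow_Suc2[OF b, of n] by simp
    qed
    ultimately have "b [^] Suc n \<otimes> ?P (rev (?v (Suc n))) = (b \<otimes> ?A) \<otimes> (b \<otimes> ?A) [^] n"
      using Suc.IH A b by simp
    also have "\<dots> = (b \<otimes> ?A) [^] Suc n" using A b nat_pow_Suc2[of "b \<otimes> ?A" n] by simp
    finally show ?case .
  qed simp
  show ?thesis
    using main[of n] by (simp add: kummer_list_def)
qed

section \<open>The fundamental group of a topological space\<close>

definition path_homotopic :: "'a topology \<Rightarrow> (real \<Rightarrow> 'a) \<Rightarrow> (real \<Rightarrow> 'a) \<Rightarrow> bool" where
  "path_homotopic X p q \<longleftrightarrow>
     homotopic_with (\<lambda>r. r 0 = p 0 \<and> r 1 = p 1) (top_of_set {0..1}) X p q"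

lemma path_homotopic_imp:
  assumes "path_homotopic X p q"
  shows "pathin X p" "pathin X q" "q 0 = p 0" "q 1 = p 1"
  using homotopic_with_imp_continuous_maps[OF assms[unfolded path_homotopic_def]]
    homotopic_with_imp_property[OF assms[unfolded path_homotopic_def]]
  by (auto simp: pathin_def)

lemma path_homotopic_refl: "pathin X p \<Longrightarrow> path_homotopic X p p"
  by (simp add: path_homotopic_def pathin_def)

lemma path_homotopic_sym: "path_homotopic X p q \<Longrightarrow> path_homotopic X q p"
  using path_homotopic_imp[of X p q] homotopic_with_symD[of _ "top_of_set {0..1}" X p q]
  by (simp add: path_homotopic_def)

lemma path_homotopic_trans: "path_homotopic X p q \<Longrightarrow> path_homotopic X q r \<Longrightarrow> path_homotopic X p r"
  using path_homotopic_imp[of X p q] homotopic_with_trans[of _ "top_of_set {0..1}" X p q r]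
  by (simp add: path_homotopic_def)

lemma path_homotopic_compose:
  "path_homotopic X p q \<Longrightarrow> continuous_map X Y f \<Longrightarrow> path_homotopic Y (f \<circ> p) (f \<circ> q)"
  unfolding path_homotopic_def
  by (erule homotopic_with_compose_continuous_map_left) auto

text \<open>
  Two reparametrisations with the same end points are joined by a linear homotopy inside the unit
  interval. Associativity, units and inverses of the fundamental group are all instances of this.
\<close>

lemma path_homotopic_reparam:
  assumes "pathin X p" "continuous_on {0..1} f" "continuous_on {0..1} g"
    and "f ` {0..1} \<subseteq> {0..1}" "g ` {0..1} \<subseteq> {0..1::real}" "f 0 = g 0" "f 1 = g 1"
  shows "path_homotopic X (p \<circ> f) (p \<circ> g)"
proof -
  have "homotopic_paths {0..1} f g"
  proof (rule homotopic_paths_linear)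
    show "closed_segment (f t) (g t) \<subseteq> {0..1}" if "t \<in> {0..1}" for t
    proof (rule closed_segment_subset)
      show "f t \<in> {0..1}" "g t \<in> {0..1}" using that assms(4,5) by blast+
    qed simp
  qed (use assms in \<open>auto simp: path_def pathstart_def pathfinish_def\<close>)
  then have "homotopic_with (\<lambda>r. r 0 = f 0 \<and> r 1 = f 1) (top_of_set {0..1}) (top_of_set {0..1}) f g"
    by (simp add: homotopic_paths_def pathstart_def pathfinish_def)
  then show ?thesis
    unfolding path_homotopic_def
    by (rule homotopic_with_compose_continuous_map_left) (use assms in \<open>auto simp: pathin_def\<close>)
qed

lemma path_homotopic_concat:
  assumes "path_homotopic X p p'" "path_homotopic X q q'" "p 1 = q 0"
  shows "path_homotopic X (path_concat p q) (path_concat p' q')"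
proof -
  let ?I = "top_of_set {0..1::real}"
  let ?S = "prod_topology ?I ?I"
  obtain h k where h: "continuous_map ?S X h" "\<And>x. h (0, x) = p x" "\<And>x. h (1, x) = p' x"
      "\<And>t. t \<in> {0..1} \<Longrightarrow> h (t, 0) = p 0 \<and> h (t, 1) = p 1"
    and k: "continuous_map ?S X k" "\<And>x. k (0, x) = q x" "\<And>x. k (1, x) = q' x"
      "\<And>t. t \<in> {0..1} \<Longrightarrow> k (t, 0) = q 0 \<and> k (t, 1) = q 1"
    using assms(1,2) unfolding path_homotopic_def homotopic_with_def by blast
  have S: "?S = top_of_set ({0..1} \<times> {0..1})"
    by (metis prod_topology_subtopology_eu)
  let ?m = "\<lambda>y. if snd y \<le> 1/2 then (h \<circ> (\<lambda>x. (fst x, 2 * snd x))) y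
                               else (k \<circ> (\<lambda>x. (fst x, 2 * snd x - 1))) y"
  have "continuous_map ?S X ?m"
  proof (rule continuous_map_cases_le)
    show "continuous_map ?S euclideanreal snd"
      unfolding S by (auto intro!: continuous_intros)
    show "continuous_map ?S euclideanreal (\<lambda>x. 1/2)"
      by simp
    show "continuous_map (subtopology ?S {y \<in> topspace ?S. snd y \<le> 1/2}) X (h \<circ> (\<lambda>x. (fst x, 2 * snd x)))"
      unfolding S
      by (intro continuous_map_compose[OF _ h(1)[unfolded S]])
         (auto simp: subtopology_subtopology intro!: continuous_intros)
    show "continuous_map (subtopology ?S {y \<in> topspace ?S. 1/2 \<le> snd y}) X (k \<circ> (\<lambda>x. (fst x, 2 * snd x - 1)))"
      unfolding S
      by (intro continuous_map_compose[OF _ k(1)[unfolded S]])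
         (auto simp: subtopology_subtopology intro!: continuous_intros)
    show "(h \<circ> (\<lambda>x. (fst x, 2 * snd x))) y = (k \<circ> (\<lambda>x. (fst x, 2 * snd x - 1))) y"
      if "y \<in> topspace ?S" "snd y = 1/2" for y
    proof -
      obtain a b where y: "y = (a, b)" by force
      then have "a \<in> {0..1}" "2 * b = 1" using that by (auto simp: S)
      then show ?thesis using h(4)[of a] k(4)[of a] assms(3) y by simp
    qed
  qed
  then show ?thesis
    unfolding path_homotopic_def homotopic_with_def
    using h k by (intro exI[of _ ?m]) (auto simp: path_concat_def)
qed

lemma pathin_concat:
  "pathin X p \<Longrightarrow> pathin X q \<Longrightarrow> p 1 = q 0 \<Longrightarrow> pathin X (path_concat p q)"
  using path_homotopic_imp(1)[OF path_homotopic_concat[OF path_homotopic_refl path_homotopic_refl]] .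

lemma pathin_reparam:
  "pathin X p \<Longrightarrow> continuous_on {0..1} f \<Longrightarrow> f ` {0..1} \<subseteq> {0..1::real} \<Longrightarrow> pathin X (p \<circ> f)"
  using path_homotopic_imp(1)[OF path_homotopic_reparam, of X p f f] by simp

lemma path_concat_endpoints [simp]: "path_concat p q 0 = p 0" "path_concat p q 1 = q 1"
  by (auto simp: path_concat_def)

lemma path_homotopic_concat_assoc:
  assumes "pathin X p" "pathin X q" "pathin X r" "p 1 = q 0" "q 1 = r 0"
  shows "path_homotopic X (path_concat (path_concat p q) r) (path_concat p (path_concat q r))"
proof -
  \<comment> \<open>The piecewise linear change of parameter with slopes 2, 1 and 1/2 is concave, hence a minimum of its three pieces.\<close>
  let ?f = "\<lambda>s::real. min (2 * s) (min (s + 1/4) (s / 2 + 1/2))"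
  let ?P = "path_concat p (path_concat q r)"
  have P: "pathin X ?P" using assms by (auto intro!: pathin_concat)
  have "path_homotopic X (?P \<circ> ?f) (?P \<circ> (\<lambda>s. s))"
  proof (rule path_homotopic_reparam[OF P])
    show "continuous_on {0..1} ?f" by (intro continuous_intros) auto
    show "?f ` {0..1} \<subseteq> {0..1}" by (auto simp: min_def)
  qed (auto intro!: continuous_intros)
  moreover have "?P \<circ> ?f = path_concat (path_concat p q) r"
  proof
    fix s :: real
    consider "s \<le> 1/4" | "1/4 < s" "s \<le> 1/2" | "1/2 < s" by linarith
    then show "(?P \<circ> ?f) s = path_concat (path_concat p q) r s"
    proof cases
      case 1
      then have "?f s = 2 * s" by simp
      then show ?thesis using 1 by (simp add: path_concat_def)
    next
      case 2
      then have "?f s = s + 1/4" by simp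
      moreover have "2 * (2 * (s + 1/4) - 1) = 2 * (2 * s) - (1::real)" by simp
      ultimately show ?thesis using 2 unfolding path_concat_def comp_def by simp
    next
      case 3
      then have "?f s = s / 2 + 1/2" by simp
      moreover have "2 * (2 * (s / 2 + 1/2) - 1) - 1 = 2 * s - (1::real)" by simp
      ultimately show ?thesis using 3 unfolding path_concat_def comp_def by simp
    qed
  qed
  ultimately show ?thesis by (simp add: o_def)
qed

lemma path_homotopic_concat_const:
  assumes p: "pathin X p"
  shows "path_homotopic X (path_concat (\<lambda>_. p 0) p) p" "path_homotopic X (path_concat p (\<lambda>_. p 1)) p"
proof -
  let ?f = "\<lambda>s::real. max 0 (2 * s - 1)" and ?g = "\<lambda>s::real. min 1 (2 * s)"
  have f: "?f s = (if s \<le> 1/2 then 0 else 2 * s - 1)" for s by (simp add: max_def)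
  have g: "?g s = (if s \<le> 1/2 then 2 * s else 1)" for s by (simp add: min_def)
  have "path_homotopic X (p \<circ> ?f) (p \<circ> (\<lambda>s. s))"
  proof (rule path_homotopic_reparam[OF p])
    show "continuous_on {0..1} ?f" by (intro continuous_intros)
    show "?f ` {0..1} \<subseteq> {0..1}" unfolding f by auto
  qed auto
  moreover have "p \<circ> ?f = path_concat (\<lambda>_. p 0) p"
    by (rule ext) (simp only: path_concat_def comp_def f if_distrib[of p])
  ultimately show "path_homotopic X (path_concat (\<lambda>_. p 0) p) p" by (simp only: comp_def)
  have "path_homotopic X (p \<circ> ?g) (p \<circ> (\<lambda>s. s))"
  proof (rule path_homotopic_reparam[OF p])
    show "continuous_on {0..1} ?g" by (intro continuous_intros)
    show "?g ` {0..1} \<subseteq> {0..1}" unfolding g by auto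
  qed auto
  moreover have "p \<circ> ?g = path_concat p (\<lambda>_. p 1)"
    by (rule ext) (simp only: path_concat_def comp_def g if_distrib[of p])
  ultimately show "path_homotopic X (path_concat p (\<lambda>_. p 1)) p" by (simp only: comp_def)
qed

lemma path_homotopic_concat_reverse:
  assumes p: "pathin X p"
  shows "path_homotopic X (path_concat p (\<lambda>s. p (1 - s))) (\<lambda>_. p 0)"
proof -
  \<comment> \<open>Running through a path and back is the path composed with a tent function.\<close>
  let ?f = "\<lambda>s::real. 1 - \<bar>2 * s - 1\<bar>"
  have f: "?f s = (if s \<le> 1/2 then 2 * s else 1 - (2 * s - 1))" for s by (simp add: abs_if)
  have "path_homotopic X (p \<circ> ?f) (p \<circ> (\<lambda>s. 0))"
  proof (rule path_homotopic_reparam[OF p])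
    show "continuous_on {0..1} ?f" by (intro continuous_intros)
    show "?f ` {0..1} \<subseteq> {0..1}" unfolding f by auto
  qed auto
  moreover have "p \<circ> ?f = path_concat p (\<lambda>s. p (1 - s))"
    by (rule ext) (simp only: path_concat_def comp_def f if_distrib[of p])
  ultimately show ?thesis by (simp only: comp_def)
qed

lemma pathin_reverse: "pathin X p \<Longrightarrow> pathin X (\<lambda>s. p (1 - s))"
  using pathin_reparam[of X p "\<lambda>s. 1 - s"] continuous_on_diff[OF continuous_on_const continuous_on_id]
  by (auto simp: o_def)

lemma path_class_conv: "path_class X p = {q. path_homotopic X p q}"
  by (simp add: path_class_def path_homotopic_def)

lemma path_class_eqI: "path_homotopic X p q \<Longrightarrow> path_class X p = path_class X q"
  unfolding path_class_conv using path_homotopic_sym path_homotopic_trans by blast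

definition loop_in :: "'a topology \<Rightarrow> 'a \<Rightarrow> (real \<Rightarrow> 'a) \<Rightarrow> bool" where
  "loop_in X x p \<longleftrightarrow> pathin X p \<and> p 0 = x \<and> p 1 = x"

lemma carrier_fundamental_group:
  "carrier (fundamental_group X x) = path_class X ` {p. loop_in X x p}"
  by (auto simp: fundamental_group_def loop_in_def)

lemma path_class_carrier: "loop_in X x p \<Longrightarrow> path_class X p \<in> carrier (fundamental_group X x)"
  by (auto simp: carrier_fundamental_group)

lemma loop_in_concat: "loop_in X x p \<Longrightarrow> loop_in X x q \<Longrightarrow> loop_in X x (path_concat p q)"
  by (auto simp: loop_in_def intro!: pathin_concat)

lemma loop_in_reverse: "loop_in X x p \<Longrightarrow> loop_in X x (\<lambda>s. p (1 - s))"
  by (auto simp: loop_in_def intro!: pathin_reverse)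

lemma mult_path_class:
  assumes "loop_in X x p" "loop_in X x q"
  shows "path_class X p \<otimes>\<^bsub>fundamental_group X x\<^esub> path_class X q = path_class X (path_concat p q)"
proof -
  have "path_class X (path_concat p' q') = path_class X (path_concat p q)"
    if "p' \<in> path_class X p" "q' \<in> path_class X q" for p' q'
    using that assms
    by (intro path_class_eqI[symmetric] path_homotopic_concat) (auto simp: path_class_conv loop_in_def)
  moreover have "p \<in> path_class X p" "q \<in> path_class X q"
    using assms by (auto simp: path_class_conv loop_in_def intro!: path_homotopic_refl)
  ultimately have "(\<Union>p'\<in>path_class X p. \<Union>q'\<in>path_class X q. path_class X (path_concat p' q')) =
      path_class X (path_concat p q)" by blast
  then show ?thesis by (simp add: fundamental_group_def)
qed

lemma one_fundamental_group: "\<one>\<^bsub>fundamental_group X x\<^esub> = path_class X (\<lambda>_. x)"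
  by (simp add: fundamental_group_def)

lemma group_fundamental_group:
  assumes "x \<in> topspace X"
  shows "group (fundamental_group X x)"
proof (rule groupI)
  let ?G = "fundamental_group X x"
  have c: "loop_in X x (\<lambda>_. x)" using assms by (simp add: loop_in_def)
  show "\<one>\<^bsub>?G\<^esub> \<in> carrier ?G"
    using c by (simp add: one_fundamental_group path_class_carrier)
  show "g \<otimes>\<^bsub>?G\<^esub> h \<in> carrier ?G" if "g \<in> carrier ?G" "h \<in> carrier ?G" for g h
    using that by (auto simp: carrier_fundamental_group mult_path_class loop_in_concat)
  show "g \<otimes>\<^bsub>?G\<^esub> h \<otimes>\<^bsub>?G\<^esub> k = g \<otimes>\<^bsub>?G\<^esub> (h \<otimes>\<^bsub>?G\<^esub> k)"
    if gh: "g \<in> carrier ?G" "h \<in> carrier ?G" "k \<in> carrier ?G" for g h k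
  proof -
    obtain p q r where l: "loop_in X x p" "loop_in X x q" "loop_in X x r"
      and "g = path_class X p" "h = path_class X q" "k = path_class X r"
      using gh by (auto simp: carrier_fundamental_group)
    moreover have "path_class X (path_concat (path_concat p q) r) = path_class X (path_concat p (path_concat q r))"
      using l by (intro path_class_eqI path_homotopic_concat_assoc) (auto simp: loop_in_def)
    ultimately show ?thesis by (simp add: mult_path_class loop_in_concat)
  qed
  show "\<one>\<^bsub>?G\<^esub> \<otimes>\<^bsub>?G\<^esub> g = g" if g0: "g \<in> carrier ?G" for g
  proof -
    obtain p where l: "loop_in X x p" and g: "g = path_class X p"
      using g0 by (auto simp: carrier_fundamental_group)
    then have "path_homotopic X (path_concat (\<lambda>_. x) p) p"
      using path_homotopic_concat_const(1)[of X p] by (auto simp: loop_in_def)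
    then show ?thesis by (simp add: g one_fundamental_group mult_path_class[OF c l] path_class_eqI)
  qed
  show "\<exists>h\<in>carrier ?G. h \<otimes>\<^bsub>?G\<^esub> g = \<one>\<^bsub>?G\<^esub>" if g0: "g \<in> carrier ?G" for g
  proof -
    obtain p where l: "loop_in X x p" and g: "g = path_class X p"
      using g0 by (auto simp: carrier_fundamental_group)
    note r = loop_in_reverse[OF l]
    have "path_homotopic X (path_concat (\<lambda>s. p (1 - s)) p) (\<lambda>_. x)"
      using path_homotopic_concat_reverse[of X "\<lambda>s. p (1 - s)"] r by (auto simp: loop_in_def)
    then have "path_class X (\<lambda>s. p (1 - s)) \<otimes>\<^bsub>?G\<^esub> g = \<one>\<^bsub>?G\<^esub>"
      by (simp add: g one_fundamental_group mult_path_class[OF r l] path_class_eqI)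
    then show ?thesis using path_class_carrier[OF r] by blast
  qed
qed

lemma inv_path_class:
  assumes "loop_in X x p"
  shows "inv\<^bsub>fundamental_group X x\<^esub> (path_class X p) = path_class X (\<lambda>s. p (1 - s))"
proof -
  have "x \<in> topspace X" using assms path_start_in_topspace by (auto simp: loop_in_def)
  then interpret group "fundamental_group X x" by (rule group_fundamental_group)
  note r = loop_in_reverse[OF assms]
  have "path_homotopic X (path_concat (\<lambda>s. p (1 - s)) p) (\<lambda>_. x)"
    using path_homotopic_concat_reverse[of X "\<lambda>s. p (1 - s)"] r by (auto simp: loop_in_def)
  then have "path_class X (\<lambda>s. p (1 - s)) \<otimes>\<^bsub>fundamental_group X x\<^esub> path_class X p = \<one>\<^bsub>fundamental_group X x\<^esub>"
    by (simp add: one_fundamental_group mult_path_class[OF r assms] path_class_eqI)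
  then show ?thesis using inv_equality path_class_carrier[OF r] path_class_carrier[OF assms] by blast
qed

lemma pi1_map_path_class:
  assumes "continuous_map X Y f" "pathin X p"
  shows "pi1_map Y f (path_class X p) = path_class Y (f \<circ> p)"
proof -
  have "path_class Y (f \<circ> q) = path_class Y (f \<circ> p)" if "q \<in> path_class X p" for q
    using that assms(1) by (intro path_class_eqI[symmetric] path_homotopic_compose) (auto simp: path_class_conv)
  moreover have "p \<in> path_class X p" using assms by (simp add: path_class_conv path_homotopic_refl)
  ultimately have "(\<Union>q\<in>path_class X p. path_class Y (f \<circ> q)) = path_class Y (f \<circ> p)" by blast
  then show ?thesis by (simp add: pi1_map_def)
qed

lemma loop_in_compose: "continuous_map X Y f \<Longrightarrow> loop_in X x p \<Longrightarrow> loop_in Y (f x) (f \<circ> p)"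
  by (auto simp: loop_in_def intro: pathin_compose)

lemma path_concat_compose: "f \<circ> path_concat p q = path_concat (f \<circ> p) (f \<circ> q)"
  by (auto simp: path_concat_def)

lemma pi1_map_hom:
  assumes "continuous_map X Y f"
  shows "pi1_map Y f \<in> hom (fundamental_group X x) (fundamental_group Y (f x))"
proof (rule homI)
  fix g h assume "g \<in> carrier (fundamental_group X x)" "h \<in> carrier (fundamental_group X x)"
  then obtain p q where l: "loop_in X x p" "loop_in X x q" and gh: "g = path_class X p" "h = path_class X q"
    by (auto simp: carrier_fundamental_group)
  show "pi1_map Y f (g \<otimes>\<^bsub>fundamental_group X x\<^esub> h) =
      pi1_map Y f g \<otimes>\<^bsub>fundamental_group Y (f x)\<^esub> pi1_map Y f h"
    using l loop_in_concat[OF l] loop_in_compose[OF assms l(1)] loop_in_compose[OF assms l(2)]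
    by (simp add: gh mult_path_class pi1_map_path_class[OF assms] loop_in_def path_concat_compose)
next
  fix g assume "g \<in> carrier (fundamental_group X x)"
  then obtain p where l: "loop_in X x p" and g: "g = path_class X p"
    by (auto simp: carrier_fundamental_group)
  then show "pi1_map Y f g \<in> carrier (fundamental_group Y (f x))"
    using path_class_carrier[OF loop_in_compose[OF assms l]]
    by (simp add: pi1_map_path_class[OF assms] loop_in_def)
qed

lemma pi1_map_compose:
  assumes "continuous_map X Y f" "continuous_map Y Z h" "g \<in> carrier (fundamental_group X x)"
  shows "pi1_map Z h (pi1_map Y f g) = pi1_map Z (h \<circ> f) g"
proof -
  obtain p where p: "loop_in X x p" "g = path_class X p"
    using assms by (auto simp: carrier_fundamental_group)
  then have "pathin X p" "pathin Y (f \<circ> p)"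
    using assms by (auto simp: loop_in_def intro: pathin_compose)
  then show ?thesis
    using assms p by (simp add: pi1_map_path_class continuous_map_compose[OF assms(1,2)] o_assoc)
qed

section \<open>Loops and winding numbers in the punctured plane\<close>

text \<open>
  The homotopy lemmas for paths ask for \<open>path p\<close> and for the inclusion of the image separately;
  bundling the two keeps the computations with long concatenations short.
\<close>

definition path_in :: "'a::topological_space set \<Rightarrow> (real \<Rightarrow> 'a) \<Rightarrow> bool" where
  "path_in T p \<longleftrightarrow> path p \<and> path_image p \<subseteq> T"

lemma path_in_join: "path_in T p \<Longrightarrow> path_in T q \<Longrightarrow> pathfinish p = pathstart q \<Longrightarrow> path_in T (p +++ q)"
  by (simp add: path_in_def subset_path_image_join)

lemma path_in_reversepath [simp]: "path_in T (reversepath p) \<longleftrightarrow> path_in T p"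
  by (simp add: path_in_def)

lemma path_in_mono: "path_in T p \<Longrightarrow> T \<subseteq> T' \<Longrightarrow> path_in T' p"
  by (auto simp: path_in_def)

lemma path_in_compose: "path_in T p \<Longrightarrow> continuous_on T f \<Longrightarrow> f ` T \<subseteq> T' \<Longrightarrow> path_in T' (f \<circ> p)"
  unfolding path_in_def by (auto simp: path_image_compose intro!: path_continuous_image elim: continuous_on_subset)

lemma pathin_iff_path_in: "pathin (top_of_set T) p \<longleftrightarrow> path_in T p"
  by (auto simp: pathin_canon_iff path_in_def path_image_def)

lemma loop_in_top_of_set:
  "loop_in (top_of_set T) x p \<longleftrightarrow> path_in T p \<and> pathstart p = x \<and> pathfinish p = x"
  by (auto simp: loop_in_def pathin_iff_path_in pathstart_def pathfinish_def)

lemma path_class_eq_homotopic: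
  "homotopic_paths T p q \<Longrightarrow> path_class (top_of_set T) p = path_class (top_of_set T) q"
  by (rule path_class_eqI) (simp add: path_homotopic_def homotopic_paths_def pathstart_def pathfinish_def)

lemma path_class_eq_imp_homotopic:
  "path_class (top_of_set T) p = path_class (top_of_set T) q \<Longrightarrow> path_in T q \<Longrightarrow> homotopic_paths T p q"
  using path_class_top_of_set[of T p] path_class_top_of_set[of T q]
  by (auto simp: path_in_def)

lemma homotopic_paths_refl_in: "path_in T p \<Longrightarrow> homotopic_paths T p p"
  by (simp add: path_in_def)

lemma homotopic_join_assoc:
  "path_in T p \<Longrightarrow> path_in T q \<Longrightarrow> path_in T r \<Longrightarrow> pathfinish p = pathstart q \<Longrightarrow>
   pathfinish q = pathstart r \<Longrightarrow> homotopic_paths T ((p +++ q) +++ r) (p +++ q +++ r)"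
  by (rule homotopic_paths_sym) (simp add: path_in_def homotopic_paths_assoc)

lemma homotopic_join_left:
  "homotopic_paths T q q' \<Longrightarrow> path_in T p \<Longrightarrow> pathfinish p = pathstart q \<Longrightarrow>
   homotopic_paths T (p +++ q) (p +++ q')"
  by (rule homotopic_paths_join) (auto simp: path_in_def)

lemma homotopic_join_right:
  "homotopic_paths T p p' \<Longrightarrow> path_in T q \<Longrightarrow> pathfinish p = pathstart q \<Longrightarrow>
   homotopic_paths T (p +++ q) (p' +++ q)"
  by (rule homotopic_paths_join) (auto simp: path_in_def)

text \<open>The loop \<open>c\<close> moved to another base point along \<open>d\<close>.\<close>

definition lasso :: "(real \<Rightarrow> 'a::real_normed_vector) \<Rightarrow> (real \<Rightarrow> 'a) \<Rightarrow> real \<Rightarrow> 'a" where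
  "lasso d c = d +++ c +++ reversepath d"

lemma lasso_endpoints [simp]: "pathstart (lasso d c) = pathstart d" "pathfinish (lasso d c) = pathstart d"
  by (simp_all add: lasso_def)

lemma path_in_lasso:
  "path_in T d \<Longrightarrow> path_in T c \<Longrightarrow> pathfinish d = pathstart c \<Longrightarrow> pathfinish c = pathstart c \<Longrightarrow>
   path_in T (lasso d c)"
  by (simp add: lasso_def path_in_join)

lemma lasso_homotopic:
  assumes "path_in T d" "homotopic_paths T c c'" "pathfinish d = pathstart c" "pathfinish c = pathstart c"
  shows "homotopic_paths T (lasso d c) (lasso d c')"
  unfolding lasso_def using assms
  by (intro homotopic_join_left homotopic_join_right) auto

lemma lasso_lasso:
  assumes "path_in T b" "path_in T d" "path_in T c" "pathfinish b = pathstart d"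
    "pathfinish d = pathstart c" "pathfinish c = pathstart c"
  shows "homotopic_paths T (lasso (b +++ d) c) (lasso b (lasso d c))"
proof -
  let ?b = "reversepath b" and ?d = "reversepath d"
  have "homotopic_paths T ((b +++ d) +++ (c +++ (?d +++ ?b))) (b +++ d +++ (c +++ (?d +++ ?b)))"
    using assms by (intro homotopic_join_assoc path_in_join) auto
  moreover have "homotopic_paths T (b +++ d +++ ((c +++ ?d) +++ ?b)) (b +++ d +++ (c +++ (?d +++ ?b)))"
    using assms by (intro homotopic_join_left homotopic_join_assoc path_in_join) auto
  moreover have "homotopic_paths T (b +++ (d +++ (c +++ ?d)) +++ ?b) (b +++ d +++ ((c +++ ?d) +++ ?b))"
    using assms by (intro homotopic_join_left homotopic_join_assoc path_in_join) auto
  ultimately show ?thesis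
    unfolding lasso_def reversepath_joinpaths[OF assms(4)]
    by (meson homotopic_paths_sym homotopic_paths_trans)
qed

lemma homotopic_reverse_join:
  "path_in T d \<Longrightarrow> homotopic_paths T (reversepath d +++ d) (linepath (pathfinish d) (pathfinish d))"
  using homotopic_paths_linv[of d T] by (simp add: path_in_def)

text \<open>
  The inner tails cancel, so moving loops to another base point is multiplicative up to homotopy.
\<close>

lemma lasso_join:
  assumes "path_in T d" "path_in T c" "path_in T c'" "pathfinish d = pathstart c"
    "pathfinish c = pathstart c" "pathstart c' = pathstart c" "pathfinish c' = pathstart c"
  shows "homotopic_paths T (lasso d c +++ lasso d c') (lasso d (c +++ c'))"
proof -
  let ?d = "reversepath d" and ?e = "linepath (pathfinish d) (pathfinish d)"
  have e: "path_in T ?e" using assms(1) pathfinish_in_path_image[of d] by (auto simp: path_in_def)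
  note pi = assms e path_in_join
  have "homotopic_paths T ((d +++ c +++ ?d) +++ (d +++ c' +++ ?d)) (d +++ (c +++ ?d) +++ (d +++ c' +++ ?d))"
    using pi by (intro homotopic_join_assoc path_in_join) auto
  moreover have "homotopic_paths T (d +++ (c +++ ?d) +++ (d +++ c' +++ ?d)) (d +++ c +++ ?d +++ (d +++ c' +++ ?d))"
    using pi by (intro homotopic_join_left homotopic_join_assoc path_in_join) auto
  moreover have "homotopic_paths T (d +++ c +++ (?d +++ d) +++ (c' +++ ?d)) (d +++ c +++ ?d +++ (d +++ c' +++ ?d))"
    using pi by (intro homotopic_join_left homotopic_join_assoc path_in_join) auto
  moreover have "homotopic_paths T (d +++ c +++ (?d +++ d) +++ (c' +++ ?d)) (d +++ c +++ ?e +++ (c' +++ ?d))"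
    using pi by (intro homotopic_join_left homotopic_join_right homotopic_reverse_join path_in_join) auto
  moreover have "homotopic_paths T (d +++ c +++ ?e +++ (c' +++ ?d)) (d +++ c +++ (c' +++ ?d))"
  proof (intro homotopic_join_left)
    have "path_in T (c' +++ ?d)" using pi by (intro path_in_join) auto
    then show "homotopic_paths T (?e +++ c' +++ ?d) (c' +++ ?d)"
      using homotopic_paths_lid[of "c' +++ ?d" T] assms by (simp add: path_in_def)
  qed (use pi in auto)
  moreover have "homotopic_paths T (d +++ (c +++ c') +++ ?d) (d +++ c +++ (c' +++ ?d))"
    using pi by (intro homotopic_join_left homotopic_join_assoc path_in_join) auto
  ultimately show ?thesis
    unfolding lasso_def by (meson homotopic_paths_sym homotopic_paths_trans)
qed

lemma lasso_const:
  assumes "path_in T d"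
  shows "homotopic_paths T (lasso d (linepath (pathfinish d) (pathfinish d))) (linepath (pathstart d) (pathstart d))"
proof -
  let ?e = "linepath (pathfinish d) (pathfinish d)"
  have "homotopic_paths T (?e +++ reversepath d) (reversepath d)"
    using homotopic_paths_lid[of "reversepath d" T] assms by (simp add: path_in_def)
  then have "homotopic_paths T (d +++ ?e +++ reversepath d) (d +++ reversepath d)"
    using assms by (intro homotopic_join_left) auto
  then show ?thesis
    unfolding lasso_def using homotopic_paths_rinv[of d T] assms
    by (auto simp: path_in_def intro: homotopic_paths_trans)
qed

lemma lasso_compose: "f \<circ> lasso d c = lasso (f \<circ> d) (f \<circ> c)"
  by (simp add: lasso_def path_compose_join path_compose_reversepath)

abbreviation loop_class :: "complex set \<Rightarrow> (real \<Rightarrow> complex) \<Rightarrow> (real \<Rightarrow> complex) set" where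
  "loop_class S \<equiv> path_class (top_of_set (- S))"

lemma pi1_mult:
  assumes "path_in (- S) p" "path_in (- S) q" "pathstart p = t0" "pathfinish p = t0"
    "pathstart q = t0" "pathfinish q = t0"
  shows "loop_class S p \<otimes>\<^bsub>pi1_compl S t0\<^esub> loop_class S q = loop_class S (p +++ q)"
  using mult_path_class[of "top_of_set (- S)" t0 p q] assms
  by (simp add: loop_in_top_of_set path_concat_eq_joinpaths)

lemma pi1_inv:
  assumes "path_in (- S) p" "pathstart p = t0" "pathfinish p = t0"
  shows "inv\<^bsub>pi1_compl S t0\<^esub> loop_class S p = loop_class S (reversepath p)"
  using inv_path_class[of "top_of_set (- S)" t0 p] assms
  by (simp add: loop_in_top_of_set reversepath_def)

lemma pi1_one: "\<one>\<^bsub>pi1_compl S t0\<^esub> = loop_class S (linepath t0 t0)"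
  by (simp add: one_fundamental_group linepath_refl)

lemma pi1_carrier_iff:
  "g \<in> carrier (pi1_compl S t0) \<longleftrightarrow>
     (\<exists>p. path_in (- S) p \<and> pathstart p = t0 \<and> pathfinish p = t0 \<and> g = loop_class S p)"
  by (auto simp: carrier_fundamental_group loop_in_top_of_set)

lemma positive_meridian_iff:
  "positive_meridian S t0 s g \<longleftrightarrow>
     (\<exists>\<epsilon> d. 0 < \<epsilon> \<and> cball s \<epsilon> \<inter> S = {s} \<and> path_in (- S) d \<and> pathstart d = t0 \<and>
        pathfinish d = s + of_real \<epsilon> \<and> g = loop_class S (lasso d (circlepath s \<epsilon>)))"
  by (auto simp: positive_meridian_def path_in_def lasso_def)

lemma large_circle_iff:
  "large_circle S t0 g \<longleftrightarrow>
     (\<exists>R d. 0 < R \<and> S \<subseteq> ball 0 R \<and> path_in (- S) d \<and> pathstart d = t0 \<and>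
        pathfinish d = of_real R \<and> g = loop_class S (lasso d (circlepath 0 R)))"
  by (auto simp: large_circle_def path_in_def lasso_def)

lemma path_in_circlepath:
  "0 < \<epsilon> \<Longrightarrow> sphere s \<epsilon> \<subseteq> T \<Longrightarrow> path_in T (circlepath s \<epsilon>)"
  by (simp add: path_in_def)

lemma meridian_circle:
  assumes "0 < \<epsilon>" "cball s \<epsilon> \<inter> S = {s}"
  shows "path_in (- S) (circlepath s \<epsilon>)"
proof (rule path_in_circlepath[OF assms(1)], rule subsetI, rule ComplI)
  fix x assume x: "x \<in> sphere s \<epsilon>" "x \<in> S"
  then have "x \<in> cball s \<epsilon> \<inter> S" by simp
  then have "x = s" unfolding assms(2) by simp
  then show False using x(1) assms(1) by simp
qed

text \<open>
  Conjugation by a loop only changes the tail of a meridian.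
\<close>

lemma positive_meridian_conj:
  assumes "positive_meridian S t0 s g" "h \<in> carrier (pi1_compl S t0)"
  shows "positive_meridian S t0 s (conj_by (pi1_compl S t0) g h)"
proof -
  obtain \<epsilon> d where e: "0 < \<epsilon>" "cball s \<epsilon> \<inter> S = {s}" and d: "path_in (- S) d" "pathstart d = t0"
      "pathfinish d = s + of_real \<epsilon>" and g: "g = loop_class S (lasso d (circlepath s \<epsilon>))"
    using assms(1) by (auto simp: positive_meridian_iff)
  obtain b where b: "path_in (- S) b" "pathstart b = t0" "pathfinish b = t0" and h: "h = loop_class S b"
    using assms(2) by (auto simp: pi1_carrier_iff)
  note c = meridian_circle[OF e]
  let ?L = "lasso d (circlepath s \<epsilon>)"
  have L: "path_in (- S) ?L" using c d by (intro path_in_lasso) auto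
  have "conj_by (pi1_compl S t0) g h = loop_class S ((reversepath b +++ ?L) +++ b)"
    unfolding conj_by_def g h using b L d by (simp add: pi1_inv pi1_mult path_in_join)
  also have "\<dots> = loop_class S (lasso (reversepath b) ?L)"
  proof (rule path_class_eq_homotopic)
    have "homotopic_paths (- S) ((reversepath b +++ ?L) +++ b) (reversepath b +++ ?L +++ b)"
      by (rule homotopic_join_assoc) (use b L d in simp_all)
    then show "homotopic_paths (- S) ((reversepath b +++ ?L) +++ b) (lasso (reversepath b) ?L)"
      unfolding lasso_def[of "reversepath b"] reversepath_reversepath .
  qed
  also have "\<dots> = loop_class S (lasso (reversepath b +++ d) (circlepath s \<epsilon>))"
  proof (rule path_class_eq_homotopic, rule homotopic_paths_sym)
    show "homotopic_paths (- S) (lasso (reversepath b +++ d) (circlepath s \<epsilon>)) (lasso (reversepath b) ?L)"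
      by (rule lasso_lasso) (use b c d in simp_all)
  qed
  finally show ?thesis
    unfolding positive_meridian_iff using e d b
    by (intro exI[of _ \<epsilon>] exI[of _ "reversepath b +++ d"]) (simp add: path_in_join)
qed

text \<open>
  The choice of representative is immaterial for classes in the complement of a set that contains
  the point (\<open>class_winding_eq\<close>).
\<close>

definition class_winding :: "(real \<Rightarrow> complex) set \<Rightarrow> complex \<Rightarrow> complex" where
  "class_winding g z = winding_number (SOME p. p \<in> g) z"

lemma class_winding_eq:
  assumes "path_in (- S) p" "z \<in> S"
  shows "class_winding (loop_class S p) z = winding_number p z"
proof -
  have "p \<in> loop_class S p" using assms by (simp add: path_class_top_of_set path_in_def)
  then have "(SOME q. q \<in> loop_class S p) \<in> loop_class S p"
    by (rule someI[of "\<lambda>q. q \<in> loop_class S p"])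
  then have "homotopic_paths (- S) p (SOME q. q \<in> loop_class S p)" by (simp add: path_class_top_of_set)
  then have "homotopic_paths (- {z}) p (SOME q. q \<in> loop_class S p)"
    by (rule homotopic_paths_subset) (use assms in auto)
  then show ?thesis unfolding class_winding_def by (simp add: winding_number_homotopic_paths)
qed

lemma not_in_path_image: "path_in (- S) p \<Longrightarrow> z \<in> S \<Longrightarrow> z \<notin> path_image p"
  by (auto simp: path_in_def)

lemma class_winding_mult:
  assumes "g \<in> carrier (pi1_compl S t0)" "h \<in> carrier (pi1_compl S t0)" "z \<in> S"
  shows "class_winding (g \<otimes>\<^bsub>pi1_compl S t0\<^esub> h) z = class_winding g z + class_winding h z"
proof -
  obtain p q where p: "path_in (- S) p" "pathstart p = t0" "pathfinish p = t0" "g = loop_class S p"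
    and q: "path_in (- S) q" "pathstart q = t0" "pathfinish q = t0" "h = loop_class S q"
    using assms(1,2) by (auto simp: pi1_carrier_iff)
  have "path_in (- S) (p +++ q)" using p q by (intro path_in_join) auto
  moreover have "winding_number (p +++ q) z = winding_number p z + winding_number q z"
    using p q not_in_path_image[OF p(1) assms(3)] not_in_path_image[OF q(1) assms(3)]
    by (intro winding_number_join) (auto simp: path_in_def)
  ultimately show ?thesis
    unfolding p(4) q(4) using p q assms(3)
    by (simp add: pi1_mult class_winding_eq)
qed

lemma class_winding_int:
  assumes "g \<in> carrier (pi1_compl S t0)" "z \<in> S"
  shows "class_winding g z \<in> \<int>"
proof -
  obtain p where p: "path_in (- S) p" "pathstart p = t0" "pathfinish p = t0" "g = loop_class S p"
    using assms(1) by (auto simp: pi1_carrier_iff)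
  then show ?thesis
    using integer_winding_number[of p z] not_in_path_image[OF p(1) assms(2)] assms(2)
    by (simp add: class_winding_eq path_in_def)
qed

lemma winding_number_lasso:
  assumes "path_in (- {z}) d" "path_in (- {z}) c" "pathfinish d = pathstart c" "pathfinish c = pathstart c"
  shows "winding_number (lasso d c) z = winding_number c z"
proof -
  have "path_in (- {z}) (c +++ reversepath d)" using assms by (intro path_in_join) auto
  then show ?thesis
    using assms unfolding lasso_def
    by (simp add: path_in_def winding_number_join winding_number_reversepath)
qed

lemma class_winding_lasso:
  assumes "path_in (- S) d" "path_in (- S) c" "pathfinish d = pathstart c" "pathfinish c = pathstart c" "z \<in> S"
  shows "class_winding (loop_class S (lasso d c)) z = winding_number c z"
proof -
  have "path_in (- {z}) d" "path_in (- {z}) c" using assms by (auto intro: path_in_mono)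
  then show ?thesis using assms by (simp add: class_winding_eq path_in_lasso winding_number_lasso)
qed

lemma class_winding_meridian:
  assumes "positive_meridian S t0 s g" "z \<in> S"
  shows "class_winding g z = (if z = s then 1 else 0)"
proof -
  obtain \<epsilon> d where e: "0 < \<epsilon>" "cball s \<epsilon> \<inter> S = {s}" and d: "path_in (- S) d" "pathstart d = t0"
      "pathfinish d = s + of_real \<epsilon>" and g: "g = loop_class S (lasso d (circlepath s \<epsilon>))"
    using assms(1) by (auto simp: positive_meridian_iff)
  have w: "class_winding g z = winding_number (circlepath s \<epsilon>) z"
    unfolding g using meridian_circle[OF e] d assms(2) by (intro class_winding_lasso) auto
  show ?thesis
  proof (cases "z = s")
    case True
    then show ?thesis using w e by (simp add: winding_number_circlepath_centre)
  next
    case False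
    then have "z \<notin> cball s \<epsilon>" using e(2) assms(2) by blast
    then have "winding_number (circlepath s \<epsilon>) z = 0"
      using e by (intro winding_number_zero_outside[of _ "cball s \<epsilon>"]) auto
    then show ?thesis using w False by simp
  qed
qed

lemma class_winding_large_circle:
  assumes "large_circle S t0 g" "z \<in> S"
  shows "class_winding g z = 1"
proof -
  obtain R d where e: "0 < R" "S \<subseteq> ball 0 R" and d: "path_in (- S) d" "pathstart d = t0"
      "pathfinish d = of_real R" and g: "g = loop_class S (lasso d (circlepath 0 R))"
    using assms(1) by (auto simp: large_circle_iff)
  have "path_in (- S) (circlepath 0 R)"
    using e by (intro path_in_circlepath) (auto simp: subset_iff)
  then have "class_winding g z = winding_number (circlepath 0 R) z"
    unfolding g using d assms(2) by (intro class_winding_lasso) auto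
  then show ?thesis using e assms(2) by (auto simp: winding_number_circlepath)
qed

lemma positive_meridian_carrier:
  assumes "positive_meridian S t0 s g"
  shows "g \<in> carrier (pi1_compl S t0)"
proof -
  obtain \<epsilon> d where e: "0 < \<epsilon>" "cball s \<epsilon> \<inter> S = {s}" and d: "path_in (- S) d" "pathstart d = t0"
      "pathfinish d = s + of_real \<epsilon>" and g: "g = loop_class S (lasso d (circlepath s \<epsilon>))"
    using assms(1) by (auto simp: positive_meridian_iff)
  have "path_in (- S) (lasso d (circlepath s \<epsilon>))"
    using d meridian_circle[OF e] by (intro path_in_lasso) auto
  then show ?thesis using g d by (auto simp: pi1_carrier_iff)
qed

text \<open>
  In a retract of the punctured plane the winding number classifies paths with given end points.
\<close>

lemma homotopic_in_retract:
  assumes r: "continuous_on (- {s}) r" "r ` (- {s}) \<subseteq> T" "\<And>z. z \<in> T \<Longrightarrow> r z = z" "T \<subseteq> - {s}"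
    and p: "path_in T p" and q: "path_in T q" "pathstart q = pathstart p" "pathfinish q = pathfinish p"
    and w: "winding_number p s = winding_number q s"
  shows "homotopic_paths T p q"
proof -
  have "homotopic_paths (- {s}) p q"
    using winding_number_homotopic_paths_eq[of p s q] p q w r(4) by (auto simp: path_in_def)
  then have "homotopic_paths T (r \<circ> p) (r \<circ> q)"
    by (rule homotopic_paths_continuous_image) (use r in auto)
  moreover have "homotopic_paths T x (r \<circ> x)" if "path_in T x" for x
  proof (rule homotopic_paths_eq)
    fix t :: real assume "t \<in> {0..1}"
    then have "x t \<in> path_image x" unfolding path_image_def by (rule imageI)
    then show "x t = (r \<circ> x) t" using that r(3) by (auto simp: path_in_def)
  qed (use that in \<open>auto simp: path_in_def\<close>)
  ultimately show ?thesis
    using p q by (meson homotopic_paths_sym homotopic_paths_trans)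
qed

lemma punctured_disc_retraction:
  fixes s :: complex
  assumes \<epsilon>: "0 < \<epsilon>"
  obtains r where "continuous_on (- {s}) r" "r ` (- {s}) \<subseteq> cball s \<epsilon> - {s}"
    "\<And>z. z \<in> cball s \<epsilon> - {s} \<Longrightarrow> r z = z"
proof
  let ?m = "\<lambda>z. min 1 (\<epsilon> / norm (z - s))"
  let ?r = "\<lambda>z. s + of_real (?m z) * (z - s)"
  show "continuous_on (- {s}) ?r" by (intro continuous_intros) auto
  have m: "0 < ?m z" "?m z * norm (z - s) \<le> \<epsilon>" if "z \<noteq> s" for z
  proof -
    show "0 < ?m z" using that \<epsilon> by simp
    have "?m z * norm (z - s) \<le> \<epsilon> / norm (z - s) * norm (z - s)" by (intro mult_right_mono) auto
    then show "?m z * norm (z - s) \<le> \<epsilon>" using that by simp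
  qed
  show "?r ` (- {s}) \<subseteq> cball s \<epsilon> - {s}"
  proof (rule image_subsetI)
    fix z assume "z \<in> - {s}"
    then have z: "z \<noteq> s" by simp
    have "norm (of_real (?m z) * (z - s)) = ?m z * norm (z - s)"
      using m(1)[OF z] by (simp only: norm_mult norm_of_real abs_of_pos)
    then have "dist s (?r z) \<le> \<epsilon>" using m(2)[OF z] by (simp only: dist_norm norm_minus_commute[of s]) simp
    moreover have "?r z \<noteq> s" using m(1)[OF z] z by (metis add_cancel_left_right less_irrefl mult_eq_0_iff of_real_eq_0_iff right_minus_eq)
    ultimately show "?r z \<in> cball s \<epsilon> - {s}" by simp
  qed
  show "?r z = z" if "z \<in> cball s \<epsilon> - {s}" for z
  proof -
    have "norm (z - s) \<le> \<epsilon>" "0 < norm (z - s)"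
      using that by (auto simp: dist_norm norm_minus_commute)
    then have "1 \<le> \<epsilon> / norm (z - s)" by (simp add: le_divide_eq)
    then have "?m z = 1" by simp
    then show ?thesis by simp
  qed
qed

lemma homotopic_in_punctured_disc:
  assumes "0 < \<epsilon>" "path_in (cball s \<epsilon> - {s}) p" "path_in (cball s \<epsilon> - {s}) q"
    "pathstart q = pathstart p" "pathfinish q = pathfinish p" "winding_number p s = winding_number q s"
  shows "homotopic_paths (cball s \<epsilon> - {s}) p q"
proof -
  obtain r where r: "continuous_on (- {s}) r" "r ` (- {s}) \<subseteq> cball s \<epsilon> - {s}"
    "\<And>z. z \<in> cball s \<epsilon> - {s} \<Longrightarrow> r z = z"
    using punctured_disc_retraction[OF assms(1), of s] by blast
  show ?thesis by (rule homotopic_in_retract[OF r _ assms(2-6)]) auto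
qed

lemma homotopic_in_circle:
  fixes p q :: "real \<Rightarrow> complex"
  assumes "0 < R" "path_in (sphere 0 R) p" "path_in (sphere 0 R) q"
    "pathstart q = pathstart p" "pathfinish q = pathfinish p" "winding_number p 0 = winding_number q 0"
  shows "homotopic_paths (sphere 0 R) p q"
proof (rule homotopic_in_retract)
  show "continuous_on (- {0}) (\<lambda>z::complex. of_real (R / norm z) * z)" by (intro continuous_intros) auto
qed (use assms in \<open>auto simp: norm_mult norm_divide split: if_splits\<close>)

lemma punctured_disc_path:
  fixes s :: complex
  assumes "0 < \<epsilon>" "a \<in> cball s \<epsilon> - {s}" "b \<in> cball s \<epsilon> - {s}"
  shows "\<exists>p. path_in (cball s \<epsilon> - {s}) p \<and> pathstart p = a \<and> pathfinish p = b"
proof -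
  have "path_connected (- {s})" by (rule path_connected_punctured_universe) simp
  then obtain p where p: "path p" "path_image p \<subseteq> - {s}" "pathstart p = a" "pathfinish p = b"
    using assms unfolding path_connected_def by (metis ComplI DiffE)
  obtain r where r: "continuous_on (- {s}) r" "r ` (- {s}) \<subseteq> cball s \<epsilon> - {s}"
    "\<And>z. z \<in> cball s \<epsilon> - {s} \<Longrightarrow> r z = z"
    using punctured_disc_retraction[OF assms(1), of s] by blast
  have "path_in (cball s \<epsilon> - {s}) (r \<circ> p)"
    using p r by (intro path_in_compose[of "- {s}"]) (auto simp: path_in_def)
  then show ?thesis using p r(3)[OF assms(2)] r(3)[OF assms(3)]
    by (intro exI[of _ "r \<circ> p"]) (simp add: pathstart_def pathfinish_def)
qed

text \<open>
  If \<open>p = exp q\<close> then the \<open>n\<close>-th power of \<open>p\<close> is \<open>exp (n q)\<close>.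
\<close>

lemma winding_number_power:
  assumes "path_in (- {0}) p"
  shows "winding_number ((\<lambda>z. z ^ n) \<circ> p) 0 = of_nat n * winding_number p 0"
proof -
  have "path p" "0 \<notin> path_image p" using assms by (auto simp: path_in_def)
  then obtain q where q: "path q" "pathfinish q - pathstart q = 2 * of_real pi * \<i> * winding_number p 0"
    "\<And>t. t \<in> {0..1} \<Longrightarrow> p t = 0 + exp (q t)"
    by (rule winding_number_as_continuous_log) blast
  let ?q = "\<lambda>t. of_nat n * q t"
  have "winding_number ((\<lambda>z. z ^ n) \<circ> p) 0 = winding_number (exp \<circ> ?q) 0"
    using q(3) by (intro winding_number_cong) (simp add: exp_of_nat_mult)
  also have "\<dots> = (pathfinish ?q - pathstart ?q) / (2 * of_real pi * \<i>)"
  proof (rule winding_number_compose_exp)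
    show "path ?q" using q(1) unfolding path_def by (intro continuous_intros)
  qed
  also have "pathfinish ?q - pathstart ?q = of_nat n * (2 * of_real pi * \<i> * winding_number p 0)"
    unfolding q(2)[symmetric] by (simp add: pathfinish_def pathstart_def algebra_simps)
  also have "\<dots> / (2 * of_real pi * \<i>) = of_nat n * winding_number p 0"
  proof -
    have "c \<noteq> 0 \<Longrightarrow> a * (c * w) / c = a * w" for a c w :: complex by simp
    moreover have "2 * of_real pi * \<i> \<noteq> 0" by simp
    ultimately show ?thesis .
  qed
  finally show ?thesis .
qed

text \<open>
  On the disc, \<open>z\<^sup>n - s\<^sup>n = (z - s) u(z)\<close> with \<open>u\<close> free of zeros, so \<open>u\<close> has a continuous logarithm and
  contributes nothing to the winding number.
\<close>

lemma winding_number_power_small_circle: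
  assumes e: "0 < \<epsilon>" and s: "s \<noteq> 0" and inj: "\<And>z. z \<in> cball s \<epsilon> \<Longrightarrow> z ^ n = s ^ n \<Longrightarrow> z = s" and n: "0 < n"
  shows "winding_number ((\<lambda>z. z ^ n) \<circ> circlepath s \<epsilon>) (s ^ n) = 1"
proof -
  let ?u = "\<lambda>z. \<Sum>i<n. s ^ (n - Suc i) * z ^ i"
  have fac: "z ^ n - s ^ n = (z - s) * ?u z" for z by (rule power_diff_sumr2)
  have "?u z \<noteq> 0" if "z \<in> cball s \<epsilon>" for z
  proof (cases "z = s")
    case True
    have "?u s = (\<Sum>i<n. s ^ (n - 1))" by (intro sum.cong) (auto simp flip: power_add)
    then show ?thesis using True s n by simp
  next
    case False
    then show ?thesis using fac[of z] inj[OF that] by auto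
  qed
  moreover have "continuous_on (cball s \<epsilon>) ?u" by (intro continuous_intros)
  ultimately obtain l where l: "continuous_on (cball s \<epsilon>) l" "\<And>z. z \<in> cball s \<epsilon> \<Longrightarrow> ?u z = exp (l z)"
    using continuous_logarithm_on_cball[of s \<epsilon> ?u] by blast
  let ?c = "circlepath s \<epsilon>"
  let ?q = "\<lambda>t. of_real (ln \<epsilon>) + 2 * of_real pi * \<i> * of_real t + l (?c t)"
  have ct: "?c t = s + of_real \<epsilon> * exp (2 * of_real pi * \<i> * of_real t)" for t
    by (simp add: circlepath)
  have cin: "?c t \<in> cball s \<epsilon>" for t using e by (simp add: ct dist_norm norm_mult)
  have "path ?q"
    unfolding path_def using cin path_circlepath[of s \<epsilon>]
    by (intro continuous_intros continuous_on_compose2[OF l(1)]) (auto simp: path_def)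
  have "exp (?q t) = ?c t ^ n - s ^ n" for t
  proof -
    have "exp (?q t) = of_real \<epsilon> * exp (2 * of_real pi * \<i> * of_real t) * ?u (?c t)"
      using e by (simp add: exp_add l(2)[OF cin] exp_of_real)
    then show ?thesis unfolding fac by (simp add: ct)
  qed
  then have "winding_number (\<lambda>t. ((\<lambda>z. z ^ n) \<circ> ?c) t - s ^ n) 0 = winding_number (exp \<circ> ?q) 0"
    by (simp add: o_def)
  also have "\<dots> = (pathfinish ?q - pathstart ?q) / (2 * of_real pi * \<i>)"
    by (rule winding_number_compose_exp[OF \<open>path ?q\<close>])
  also have "\<dots> = 1"
  proof -
    have "?c 1 = ?c 0" by (simp add: ct)
    then have "pathfinish ?q - pathstart ?q = 2 * of_real pi * \<i>"
      by (simp add: pathfinish_def pathstart_def)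
    then show ?thesis by simp
  qed
  finally show ?thesis by (subst winding_number_offset) simp
qed

lemma covering_space_restrict:
  assumes cov: "covering_space c p S" and T: "T \<subseteq> S"
  shows "covering_space (c \<inter> p -` T) p T"
proof
  show "continuous_on (c \<inter> p -` T) p"
    using covering_space_imp_continuous[OF cov] by (rule continuous_on_subset) auto
  show "p ` (c \<inter> p -` T) = T" using covering_space_imp_surjective[OF cov] T by auto
  fix x assume x: "x \<in> T"
  then obtain U v where U: "x \<in> U" "openin (top_of_set S) U" and v: "\<Union>v = c \<inter> p -` U"
      "\<And>u. u \<in> v \<Longrightarrow> openin (top_of_set c) u" "pairwise disjnt v"
      "\<And>u. u \<in> v \<Longrightarrow> \<exists>q. homeomorphism u U p q"
    using cov T unfolding covering_space_def by (meson subsetD)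
  let ?v = "(\<lambda>u. u \<inter> p -` T) ` v"
  show "\<exists>U'. x \<in> U' \<and> openin (top_of_set T) U' \<and>
      (\<exists>v. \<Union>v = (c \<inter> p -` T) \<inter> p -` U' \<and> (\<forall>u\<in>v. openin (top_of_set (c \<inter> p -` T)) u) \<and>
        pairwise disjnt v \<and> (\<forall>u\<in>v. \<exists>q. homeomorphism u U' p q))"
  proof (intro exI[of _ "T \<inter> U"] exI[of _ ?v] conjI ballI)
    show "x \<in> T \<inter> U" using x U by simp
    show "openin (top_of_set T) (T \<inter> U)"
      using U(2) T by (metis inf.absorb_iff2 openin_subtopology_Int2 subtopology_subtopology)
    show "\<Union>?v = (c \<inter> p -` T) \<inter> p -` (T \<inter> U)" using v(1) by auto
    show "pairwise disjnt ?v" using v(3) by (auto simp: pairwise_def disjnt_def)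
    fix u assume "u \<in> ?v"
    then obtain u0 where u0: "u0 \<in> v" "u = u0 \<inter> p -` T" by auto
    have "u0 \<subseteq> c" using v(1) u0 by auto
    then have "u = (c \<inter> p -` T) \<inter> u0" using u0 by auto
    then show "openin (top_of_set (c \<inter> p -` T)) u"
      using v(2)[OF u0(1)] openin_subtopology_Int2[of "top_of_set c" u0 "c \<inter> p -` T"]
      by (simp add: subtopology_subtopology Int_absorb1)
    obtain q where q: "homeomorphism u0 U p q" using v(4)[OF u0(1)] by blast
    have "p ` u = T \<inter> U" using homeomorphism_image1[OF q] u0(2) by auto
    then show "\<exists>q. homeomorphism u (T \<inter> U) p q"
      using homeomorphism_of_subsets[OF q, of u "T \<inter> U"] u0(2) by auto
  qed
qed

section \<open>Lifting loops along the power map\<close>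

lemma lasso_homotopic_tail:
  assumes "homotopic_paths T d d'" "path_in T c" "pathfinish d = pathstart c" "pathfinish c = pathstart c"
  shows "homotopic_paths T (lasso d c) (lasso d' c)"
  unfolding lasso_def
proof (intro homotopic_paths_join assms(1))
  show "homotopic_paths T c c" using assms(2) by (rule homotopic_paths_refl_in)
  show "homotopic_paths T (reversepath d) (reversepath d')"
    using assms(1) by (simp add: homotopic_paths_reversepath)
qed (use assms in auto)

text \<open>
  The powers of a lasso are lassos with the same tail, and their loops stay in \<open>T\<close>; this matters for
  circles, where the winding number alone then determines the loop up to homotopy in \<open>T\<close>.
\<close>

lemma lasso_power:
  assumes d: "path_in (- S) d" and c: "path_in T c" "pathstart c = pathfinish d" "pathfinish c = pathfinish d"
    and T: "T \<subseteq> - S" and z: "z \<in> S"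
  shows "\<exists>c'. path_in T c' \<and> pathstart c' = pathfinish d \<and> pathfinish c' = pathfinish d \<and>
     winding_number c' z = of_nat m * winding_number c z \<and>
     loop_class S (lasso d c) [^]\<^bsub>pi1_compl S (pathstart d)\<^esub> m = loop_class S (lasso d c')"
proof (induction m)
  case 0
  define e where "e = linepath (pathfinish d) (pathfinish d)"
  have ends: "pathstart e = pathfinish d" "pathfinish e = pathfinish d"
    unfolding e_def by (rule pathstart_linepath, rule pathfinish_linepath)
  have in_T: "pathfinish d \<in> T"
    using c pathstart_in_path_image[of c] by (auto simp: path_in_def)
  then have "pathfinish d \<noteq> z" using T z by auto
  then have "winding_number e z = 0" unfolding e_def by (rule winding_number_trivial[OF not_sym])
  moreover have "path_in T e" using in_T by (simp add: path_in_def e_def)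
  moreover have "loop_class S (lasso d e) = \<one>\<^bsub>pi1_compl S (pathstart d)\<^esub>"
    unfolding pi1_one e_def by (rule path_class_eq_homotopic[OF lasso_const[OF d]])
  ultimately show ?case using ends by (intro exI[of _ e]) simp
next
  case (Suc m)
  then obtain c' where c': "path_in T c'" "pathstart c' = pathfinish d" "pathfinish c' = pathfinish d"
     "winding_number c' z = of_nat m * winding_number c z"
     "loop_class S (lasso d c) [^]\<^bsub>pi1_compl S (pathstart d)\<^esub> m = loop_class S (lasso d c')" by blast
  have S: "path_in (- S) c" "path_in (- S) c'" using c(1) c'(1) T by (auto intro: path_in_mono)
  have "winding_number (c' +++ c) z = winding_number c' z + winding_number c z"
    using c c' S z not_in_path_image[OF S(1) z] not_in_path_image[OF S(2) z]
    by (intro winding_number_join) (auto simp: path_in_def)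
  then have "winding_number (c' +++ c) z = of_nat (Suc m) * winding_number c z"
    using c'(4) by (simp add: algebra_simps)
  moreover have "path_in T (c' +++ c)" using c c' by (intro path_in_join) auto
  moreover have "loop_class S (lasso d c') \<otimes>\<^bsub>pi1_compl S (pathstart d)\<^esub> loop_class S (lasso d c) = loop_class S (lasso d c' +++ lasso d c)"
    using d c c' S by (intro pi1_mult path_in_lasso) auto
  moreover have "loop_class S (lasso d c' +++ lasso d c) = loop_class S (lasso d (c' +++ c))"
    using d c c' S by (intro path_class_eq_homotopic lasso_join) auto
  ultimately show ?case using c c' by (intro exI[of _ "c' +++ c"]) simp
qed

text \<open>
  The covering of \<open>\<complex> - S\<close> by \<open>\<complex> - S\<^sub>n\<close> under the power map, with base point \<open>t0n\<close> upstairs. As \<open>0 \<in> S\<close>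
  the branch point is removed.
\<close>

locale power_cover =
  fixes n :: nat and S :: "complex set" and t0n :: complex
  assumes n: "0 < n" and zero: "0 \<in> S" and base: "t0n ^ n \<notin> S"
begin

definition Sn :: "complex set" where "Sn = {t. t ^ n \<in> S}"

abbreviation pow :: "complex \<Rightarrow> complex" where "pow \<equiv> \<lambda>z. z ^ n"

abbreviation "G \<equiv> pi1_compl S (t0n ^ n)"
abbreviation "P \<equiv> pi1_compl Sn t0n"
abbreviation "\<phi> \<equiv> pi1_map (top_of_set (- S)) pow"

lemma zero_Sn: "0 \<in> Sn" using zero n by (simp add: Sn_def zero_power)

lemma covering: "covering_space (- Sn) pow (- S)"
proof -
  have "- {0} \<inter> pow -` (- S) = - Sn"
    using zero_Sn by (auto simp: Sn_def)
  then show ?thesis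
    using covering_space_restrict[OF covering_space_power_punctured_plane[OF n], of "- S"] zero by simp
qed

lemma power_continuous: "continuous_on A pow"
  by (intro continuous_intros)

lemma power_image: "pow ` (- Sn) \<subseteq> - S"
  by (auto simp: Sn_def)

lemma power_continuous_map: "continuous_map (top_of_set (- Sn)) (top_of_set (- S)) pow"
  using power_image by (auto intro: power_continuous)

lemma group_G: "group G" and group_P: "group P"
  using base by (auto intro!: group_fundamental_group simp: Sn_def)

lemma \<phi>_hom: "\<phi> \<in> hom P G"
  by (rule pi1_map_hom[OF power_continuous_map])

lemma path_in_power: "path_in (- Sn) p \<Longrightarrow> path_in (- S) (pow \<circ> p)"
  by (rule path_in_compose[OF _ power_continuous power_image])

lemma \<phi>_class: "path_in (- Sn) p \<Longrightarrow> \<phi> (loop_class Sn p) = loop_class S (pow \<circ> p)"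
  by (rule pi1_map_path_class[OF power_continuous_map]) (simp add: pathin_iff_path_in)

lemma \<phi>_inj: "inj_on \<phi> (carrier P)"
proof (rule inj_onI)
  fix g h assume "g \<in> carrier P" "h \<in> carrier P" and eq: "\<phi> g = \<phi> h"
  then obtain p q where p: "path_in (- Sn) p" "pathstart p = t0n" "g = loop_class Sn p"
    and q: "path_in (- Sn) q" "pathstart q = t0n" "h = loop_class Sn q"
    by (auto simp: pi1_carrier_iff)
  have pS: "path_in (- S) (pow \<circ> p)" and qS: "path_in (- S) (pow \<circ> q)"
    using p q by (auto intro: path_in_power)
  have "homotopic_paths (- S) (pow \<circ> p) (pow \<circ> q)"
    using eq p q by (intro path_class_eq_imp_homotopic[OF _ qS]) (simp add: \<phi>_class)
  then have "homotopic_paths (- Sn) p q"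
    using p q pS qS
    by (intro covering_space_lift_homotopic_paths[OF covering, of "pow \<circ> p" "pow \<circ> q"])
       (auto simp: path_in_def)
  then show "g = h" using p q by (simp add: path_class_eq_homotopic)
qed

lemma lift_path:
  assumes "path_in (- S) d" "pathstart d = a ^ n"
  obtains d' where "path_in (- Sn) d'" "pathstart d' = a" "\<And>t. t \<in> {0..1} \<Longrightarrow> d' t ^ n = d t"
proof -
  have "a ^ n \<in> - S" using assms pathstart_in_path_image[of d] by (auto simp: path_in_def)
  then have "a \<in> - Sn" by (simp add: Sn_def)
  moreover have "path d" "path_image d \<subseteq> - S" using assms(1) by (auto simp: path_in_def)
  ultimately obtain h where "path h" "path_image h \<subseteq> - Sn" "pathstart h = a"
      "\<And>t. t \<in> {0..1} \<Longrightarrow> h t ^ n = d t"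
    using covering_space_lift_path_strong[OF covering _ _ _ assms(2)] by blast
  then show ?thesis using that[of h] by (simp add: path_in_def)
qed

text \<open>
  A lasso upstairs whose tail lifts \<open>d\<close> lies over the lasso with tail \<open>d\<close>, and its loop matters
  only up to homotopy downstairs.
\<close>

lemma \<phi>_lasso:
  assumes d': "path_in (- Sn) d'" and lift: "\<And>t. t \<in> {0..1} \<Longrightarrow> d' t ^ n = d t"
    and L: "path_in (- Sn) L" "pathstart L = pathfinish d'" "pathfinish L = pathfinish d'"
    and c: "homotopic_paths (- S) (pow \<circ> L) c"
  shows "\<phi> (loop_class Sn (lasso d' L)) = loop_class S (lasso d c)"
proof -
  have "homotopic_paths (- S) (pow \<circ> d') d"
    using path_in_power[OF d'] lift by (intro homotopic_paths_eq) (auto simp: path_in_def)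
  moreover from this have "path_in (- S) d" "pathfinish d = pow (pathfinish d')"
    using homotopic_paths_imp_path homotopic_paths_imp_subset homotopic_paths_imp_pathfinish
    by (fastforce simp: path_in_def pathfinish_compose)+
  ultimately have "homotopic_paths (- S) (lasso (pow \<circ> d') (pow \<circ> L)) (lasso d c)"
    using path_in_power[OF L(1)] L c
    by (intro homotopic_paths_trans[OF lasso_homotopic_tail lasso_homotopic])
       (auto simp: pathfinish_compose pathstart_compose)
  moreover have "path_in (- Sn) (lasso d' L)" using d' L by (intro path_in_lasso) auto
  ultimately show ?thesis by (simp add: \<phi>_class lasso_compose path_class_eq_homotopic)
qed

text \<open>
  Lift the tail \<open>d\<close> and let \<open>f\<close> be the branch of the \<open>n\<close>-th root on the disc about \<open>s\<close> that
  continues this lift. The lift of the circle about \<open>s\<close> is a closed curve about \<open>s' = f s\<close>, but in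
  general not a round circle. So a small round circle about \<open>s'\<close> is joined to the lifted tail by
  a path \<open>a\<close> inside the image of the punctured disc; downstairs the resulting loop winds once
  around \<open>s\<close>, and in a punctured disc this determines its homotopy class.
\<close>

lemma meridian_lift:
  assumes g: "positive_meridian S (t0n ^ n) s g" and s: "s \<in> S" "s \<noteq> 0"
  obtains s' h where "s' ^ n = s" "positive_meridian Sn t0n s' h" "\<phi> h = g"
proof -
  obtain \<epsilon> d where e: "0 < \<epsilon>" "cball s \<epsilon> \<inter> S = {s}" and d: "path_in (- S) d" "pathstart d = t0n ^ n"
      "pathfinish d = s + of_real \<epsilon>" and gd: "g = loop_class S (lasso d (circlepath s \<epsilon>))"
    using g by (auto simp: positive_meridian_iff)
  obtain d' where d': "path_in (- Sn) d'" "pathstart d' = t0n" "\<And>t. t \<in> {0..1} \<Longrightarrow> d' t ^ n = d t"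
    using lift_path[OF d(1,2)] by blast
  have disc: "cball s \<epsilon> - {s} \<subseteq> - S" using e(2) by blast
  have q: "pathfinish d' ^ n = s + of_real \<epsilon>" using d'(3)[of 1] d(3) by (simp add: pathfinish_def)
  have nz: "z \<noteq> 0" if "z \<in> cball s \<epsilon>" for z
  proof
    assume "z = 0"
    then have "0 \<in> cball s \<epsilon> \<inter> S" using that zero by simp
    then show False unfolding e(2) using s(2) by simp
  qed
  obtain l where l: "continuous_on (cball s \<epsilon>) l" "\<And>z. z \<in> cball s \<epsilon> \<Longrightarrow> z = exp (l z)"
    using continuous_logarithm_on_cball[OF continuous_on_id nz] by blast
  define f where "f z = pathfinish d' * exp ((l z - l (s + of_real \<epsilon>)) / of_nat n)" for z
  have base_in: "s + of_real \<epsilon> \<in> cball s \<epsilon>" using e(1) by (simp add: dist_norm)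
  have f0: "f (s + of_real \<epsilon>) = pathfinish d'" by (simp add: f_def)
  have fn: "f z ^ n = z" if "z \<in> cball s \<epsilon>" for z
  proof -
    have "f z ^ n = (s + of_real \<epsilon>) * exp (of_nat n * ((l z - l (s + of_real \<epsilon>)) / of_nat n))"
      unfolding f_def power_mult_distrib q exp_of_nat_mult ..
    also have "\<dots> = (s + of_real \<epsilon>) * (exp (l z) / exp (l (s + of_real \<epsilon>)))"
      using n by (simp add: exp_diff)
    also have "\<dots> = z" using l(2)[OF that] l(2)[OF base_in] nz[OF base_in] by simp
    finally show ?thesis .
  qed
  have fc: "continuous_on (cball s \<epsilon>) f"
    unfolding f_def using n by (intro continuous_intros l(1)) auto
  have finj: "inj_on f (cball s \<epsilon>)" by (rule inj_on_inverseI[of _ pow]) (rule fn)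
  define s' where "s' = f s"
  have s'n: "s' ^ n = s" using fn[of s] e(1) by (simp add: s'_def)
  have s'0: "s' \<noteq> 0" using s'n s(2) n by (auto simp: zero_power)
  \<comment> \<open>By invariance of domain the image of the disc is a neighbourhood of \<open>s'\<close>, so small circles about \<open>s'\<close> lie in it.\<close>
  have "open (f ` ball s \<epsilon>)"
    using fc finj by (intro invariance_of_domain) (auto intro: continuous_on_subset inj_on_subset)
  moreover have "s' \<in> f ` ball s \<epsilon>" using e(1) by (auto simp: s'_def)
  ultimately obtain \<epsilon>' where e': "0 < \<epsilon>'" "cball s' \<epsilon>' \<subseteq> f ` ball s \<epsilon>"
    using open_contains_cball by blast
  have small: "z ^ n \<in> ball s \<epsilon>" "f (z ^ n) = z" "z ^ n = s \<Longrightarrow> z = s'" if "z \<in> cball s' \<epsilon>'" for z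
  proof -
    obtain w where w: "w \<in> ball s \<epsilon>" "z = f w" using e'(2) \<open>z \<in> cball s' \<epsilon>'\<close> by blast
    have zw: "z ^ n = w" using fn[of w] w by simp
    show "z ^ n \<in> ball s \<epsilon>" "f (z ^ n) = z" unfolding zw using w by simp_all
    show "z = s'" if "z ^ n = s" using that w(2) unfolding zw s'_def by simp
  qed
  have s'Sn: "s' \<in> Sn" using s'n s by (simp add: Sn_def)
  have m: "cball s' \<epsilon>' \<inter> Sn = {s'}"
  proof (intro equalityI subsetI)
    fix z assume z: "z \<in> cball s' \<epsilon>' \<inter> Sn"
    then have "z ^ n \<in> cball s \<epsilon> \<inter> S" using small(1)[of z] by (simp add: Sn_def)
    then show "z \<in> {s'}" unfolding e(2) using small(3)[of z] z by simp
  qed (use e'(1) s'Sn in auto)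
  let ?w = "(s' + of_real \<epsilon>') ^ n"
  have end_in: "s' + of_real \<epsilon>' \<in> cball s' \<epsilon>'" using e'(1) by (simp add: dist_norm)
  have "?w \<noteq> s" using small(3)[OF end_in] e'(1) by auto
  then obtain b where b: "path_in (cball s \<epsilon> - {s}) b" "pathstart b = s + of_real \<epsilon>" "pathfinish b = ?w"
    using punctured_disc_path[OF e(1), of "s + of_real \<epsilon>" s ?w] small(1)[OF end_in] base_in e(1) by auto
  let ?T = "f ` (cball s \<epsilon> - {s})"
  have fT: "pow ` ?T \<subseteq> cball s \<epsilon> - {s}"
  proof (rule image_subsetI)
    fix z assume "z \<in> ?T"
    then obtain w where w: "w \<in> cball s \<epsilon> - {s}" "z = f w" by (rule imageE)
    then show "z ^ n \<in> cball s \<epsilon> - {s}" using fn[of w] by simp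
  qed
  then have T: "?T \<subseteq> - Sn" using disc by (auto simp: Sn_def)
  define a where "a = f \<circ> b"
  have a: "path_in ?T a" "pathstart a = pathfinish d'" "pathfinish a = s' + of_real \<epsilon>'"
    using path_in_compose[OF b(1), of f ?T] fc b f0 small(2)[OF end_in]
    by (auto simp: a_def pathstart_compose pathfinish_compose intro: continuous_on_subset)
  let ?c = "circlepath s' \<epsilon>'"
  have c: "path_in ?T ?c"
  proof (rule path_in_circlepath[OF e'(1)], rule subsetI)
    fix z assume z: "z \<in> sphere s' \<epsilon>'"
    then have zc: "z \<in> cball s' \<epsilon>'" and "z \<noteq> s'" using e'(1) by auto
    then have "z ^ n \<in> cball s \<epsilon> - {s}" using small(1,3)[OF zc] by auto
    then show "z \<in> ?T" using small(2)[OF zc] by (metis imageI)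
  qed
  have aSn: "path_in (- Sn) a" and cSn: "path_in (- Sn) ?c" using a(1) c T by (auto intro: path_in_mono)
  have L: "path_in ?T (lasso a ?c)" using a c by (intro path_in_lasso) auto
  have pL: "path_in (cball s \<epsilon> - {s}) (pow \<circ> lasso a ?c)"
    by (rule path_in_compose[OF L power_continuous fT])
  have "winding_number (pow \<circ> lasso a ?c) s = winding_number (pow \<circ> ?c) s"
    unfolding lasso_compose
  proof (rule winding_number_lasso)
    have "pow ` ?T \<subseteq> - {s}" using fT by auto
    then show "path_in (- {s}) (pow \<circ> a)" "path_in (- {s}) (pow \<circ> ?c)"
      using path_in_compose[OF a(1) power_continuous] path_in_compose[OF c power_continuous] by blast+
  qed (use a in \<open>auto simp: pathfinish_compose pathstart_compose\<close>)
  also have "\<dots> = 1"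
    using winding_number_power_small_circle[OF e'(1) s'0 _ n] small(3) s'n by simp
  also have "\<dots> = winding_number (circlepath s \<epsilon>) s"
    using e(1) by (simp add: winding_number_circlepath_centre)
  finally have "homotopic_paths (cball s \<epsilon> - {s}) (pow \<circ> lasso a ?c) (circlepath s \<epsilon>)"
    using e(1) pL a(2) q
    by (intro homotopic_in_punctured_disc path_in_circlepath) (auto simp: pathfinish_compose pathstart_compose)
  then have hom: "homotopic_paths (- S) (pow \<circ> lasso a ?c) (circlepath s \<epsilon>)"
    using disc by (rule homotopic_paths_subset)
  let ?h = "loop_class Sn (lasso (d' +++ a) ?c)"
  have "?h = loop_class Sn (lasso d' (lasso a ?c))"
    using d' a aSn cSn by (intro path_class_eq_homotopic lasso_lasso) auto
  also have "\<phi> \<dots> = g"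
    unfolding gd using d' L T a by (intro \<phi>_lasso[OF d'(1,3) _ _ _ hom]) (auto intro: path_in_mono)
  finally have "\<phi> ?h = g" .
  moreover have "positive_meridian Sn t0n s' ?h"
    unfolding positive_meridian_iff using e'(1) m d' a aSn
    by (intro exI[of _ \<epsilon>'] exI[of _ "d' +++ a"]) (simp add: path_in_join)
  ultimately show ?thesis using that s'n by blast
qed

text \<open>
  The lift of the tail need not end on the positive real axis but at another \<open>n\<close>-th root of \<open>R\<close>.
  An arc \<open>a\<close> of the circle corrects this, and it does not change the homotopy class downstairs,
  since loops in a circle are classified by their winding number.
\<close>

lemma circle_lift:
  assumes R: "0 < R" "sphere 0 R \<inter> S = {}" and d: "path_in (- S) d" "pathstart d = t0n ^ n" "pathfinish d = of_real R"
  obtains d' where "path_in (- Sn) d'" "pathstart d' = t0n" "pathfinish d' = of_real (root n R)"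
    "\<phi> (loop_class Sn (lasso d' (circlepath 0 (root n R)))) = loop_class S (lasso d (circlepath 0 R)) [^]\<^bsub>G\<^esub> n"
proof -
  let ?R = "root n R"
  have R': "0 < ?R" "?R ^ n = R" using R n by auto
  obtain e where e: "path_in (- Sn) e" "pathstart e = t0n" "\<And>t. t \<in> {0..1} \<Longrightarrow> e t ^ n = d t"
    using lift_path[OF d(1,2)] by blast
  have q: "pathfinish e ^ n = of_real R" using e(3)[of 1] d(3) by (simp add: pathfinish_def)
  \<comment> \<open>The lifted tail ends somewhere on the circle of radius \<open>root n R\<close>.\<close>
  have "norm (pathfinish e) ^ n = ?R ^ n" using arg_cong[OF q, of norm] R R' by (simp add: norm_power)
  then have ne: "norm (pathfinish e) = ?R" using R' n by (metis norm_ge_zero less_imp_le power_eq_imp_eq_base)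
  let ?T = "sphere (0::complex) ?R"
  have pT: "pow ` ?T \<subseteq> sphere 0 R" using R' by (auto simp: norm_power)
  have S: "sphere 0 R \<subseteq> - S" using R by auto
  have T: "?T \<subseteq> - Sn" using pT S by (auto simp: Sn_def)
  have "path_connected ?T" by (rule path_connected_sphere) simp
  moreover have "pathfinish e \<in> ?T" "of_real ?R \<in> ?T" using ne R' by auto
  ultimately obtain a where a: "path_in ?T a" "pathstart a = pathfinish e" "pathfinish a = of_real ?R"
    unfolding path_connected_def path_in_def by metis
  let ?c = "circlepath 0 ?R"
  have c: "path_in ?T ?c" using R' by (intro path_in_circlepath) auto
  have L: "path_in ?T (lasso a ?c)" using a c by (intro path_in_lasso) auto
  have T0: "?T \<subseteq> - {0}" using R' by auto
  have "winding_number (pow \<circ> lasso a ?c) 0 = of_nat n * winding_number (lasso a ?c) 0"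
    by (rule winding_number_power[OF path_in_mono[OF L T0]])
  also have "winding_number (lasso a ?c) 0 = winding_number ?c 0"
    using a by (intro winding_number_lasso path_in_mono[OF a(1) T0] path_in_mono[OF c T0]) auto
  also have "winding_number ?c 0 = 1" using R' by (simp add: winding_number_circlepath_centre)
  finally have w: "winding_number (pow \<circ> lasso a ?c) 0 = of_nat n * 1" .
  have "path_in (sphere 0 R) (circlepath 0 R)" using R by (intro path_in_circlepath) auto
  then obtain c' where c': "path_in (sphere 0 R) c'" "pathstart c' = of_real R" "pathfinish c' = of_real R"
     "winding_number c' 0 = of_nat n * winding_number (circlepath 0 R) 0"
     "loop_class S (lasso d (circlepath 0 R)) [^]\<^bsub>G\<^esub> n = loop_class S (lasso d c')"
    using lasso_power[OF d(1) _ _ _ S zero, of "circlepath 0 R" n] d by auto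
  have pL: "path_in (sphere 0 R) (pow \<circ> lasso a ?c)"
    by (rule path_in_compose[OF L power_continuous pT])
  have w': "winding_number (pow \<circ> lasso a ?c) 0 = winding_number c' 0"
    unfolding w c'(4) using R by (simp add: winding_number_circlepath_centre)
  have "homotopic_paths (sphere 0 R) (pow \<circ> lasso a ?c) c'"
    using c' a(2) q
    by (intro homotopic_in_circle[OF R(1) pL c'(1) _ _ w']) (auto simp: pathfinish_compose pathstart_compose)
  then have hom: "homotopic_paths (- S) (pow \<circ> lasso a ?c) c'"
    using S by (rule homotopic_paths_subset)
  have aSn: "path_in (- Sn) a" and cSn: "path_in (- Sn) ?c" using a(1) c T by (auto intro: path_in_mono)
  have "loop_class Sn (lasso (e +++ a) ?c) = loop_class Sn (lasso e (lasso a ?c))"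
    using e a aSn cSn by (intro path_class_eq_homotopic lasso_lasso) auto
  also have "\<phi> \<dots> = loop_class S (lasso d c')"
    using L T a by (intro \<phi>_lasso[OF e(1,3) _ _ _ hom]) (auto intro: path_in_mono)
  finally show ?thesis
    using that[of "e +++ a"] e a aSn c'(5) by (simp add: path_in_join)
qed

end

section \<open>The geometric basis upstairs\<close>

lemma class_winding_product:
  assumes z: "z \<in> S" and t0: "t0 \<notin> S" and hs: "set hs \<subseteq> carrier (pi1_compl S t0)"
  shows "class_winding (foldr (mult (pi1_compl S t0)) (rev hs) (one (pi1_compl S t0))) z =
     (\<Sum>h\<leftarrow>hs. class_winding h z)"
proof -
  interpret group "pi1_compl S t0" by (rule group_fundamental_group) (use t0 in simp)
  have 1: "class_winding \<one>\<^bsub>pi1_compl S t0\<^esub> z = 0"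
    using class_winding_mult[OF one_closed one_closed z] by simp
  have "class_winding (foldr (mult (pi1_compl S t0)) ks (one (pi1_compl S t0))) z =
     (\<Sum>h\<leftarrow>ks. class_winding h z)" if "set ks \<subseteq> carrier (pi1_compl S t0)" for ks
    using that
  proof (induction ks)
    case (Cons k ks)
    have "foldr (mult (pi1_compl S t0)) ks (one (pi1_compl S t0)) \<in> carrier (pi1_compl S t0)"
      using foldr_mult_append(2)[of ks "[]"] Cons.prems by simp
    then show ?case using Cons class_winding_mult[OF _ _ z] by simp
  qed (simp add: 1)
  from this[of "rev hs"] show ?thesis using hs by (simp add: rev_map[symmetric])
qed

text \<open>
  The winding number of the product about a puncture counts the meridians about that puncture,
  so a product that is a large circle involves every puncture exactly once.
\<close>

lemma meridians_of_large_circle: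
  assumes t0: "t0 \<notin> S" and len: "length hs = length ts"
    and mer: "\<And>i. i < length ts \<Longrightarrow> positive_meridian S t0 (ts ! i) (hs ! i)"
    and large: "large_circle S t0 (foldr (mult (pi1_compl S t0)) (rev hs) (one (pi1_compl S t0)))"
  shows "distinct ts" "set ts = S"
proof -
  have carr: "set hs \<subseteq> carrier (pi1_compl S t0)"
    using mer positive_meridian_carrier len by (force simp: in_set_conv_nth)
  have card1: "card {i. i < length ts \<and> ts ! i = z} = 1" if z: "z \<in> S" for z
  proof -
    have "1 = (\<Sum>h\<leftarrow>hs. class_winding h z)"
      using class_winding_large_circle[OF large z] class_winding_product[OF z t0 carr] by simp
    also have "\<dots> = (\<Sum>i<length ts. class_winding (hs ! i) z)"
      by (simp add: sum_list_sum_nth len atLeast0LessThan)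
    also have "\<dots> = (\<Sum>i<length ts. if ts ! i = z then 1 else 0)"
      using class_winding_meridian[OF mer z] by (intro sum.cong) auto
    also have "\<dots> = of_nat (card {i. i < length ts \<and> ts ! i = z})"
      by (simp add: sum.If_cases Int_def)
    finally show ?thesis by (metis of_nat_1 of_nat_eq_iff)
  qed
  have sub: "ts ! i \<in> S" if "i < length ts" for i
    using mer[OF that] by (auto simp: positive_meridian_iff)
  show "distinct ts"
    unfolding distinct_conv_nth
  proof (intro allI impI notI)
    fix i j assume ij: "i < length ts" "j < length ts" "i \<noteq> j" "ts ! i = ts ! j"
    have "card {i, j} \<le> card {l. l < length ts \<and> ts ! l = ts ! i}"
      by (rule card_mono) (use ij in auto)
    then show False using card1[OF sub[OF ij(1)]] ij(3) by simp
  qed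
  show "set ts = S"
  proof
    show "set ts \<subseteq> S" using sub by (auto simp: in_set_conv_nth)
    show "S \<subseteq> set ts"
    proof
      fix z assume "z \<in> S"
      from card1[OF this] have "{i. i < length ts \<and> ts ! i = z} \<noteq> {}" by (metis card.empty zero_neq_one)
      then show "z \<in> set ts" by auto
    qed
  qed
qed

context power_cover
begin

lemma class_winding_\<phi>:
  assumes "g \<in> carrier P"
  shows "class_winding (\<phi> g) 0 = of_nat n * class_winding g 0"
proof -
  obtain p where p: "path_in (- Sn) p" "g = loop_class Sn p" using assms by (auto simp: pi1_carrier_iff)
  have "path_in (- {0}) p" using p(1) zero_Sn by (auto intro: path_in_mono)
  then show ?thesis
    using p path_in_power[OF p(1)] by (simp add: \<phi>_class class_winding_eq zero zero_Sn winding_number_power)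
qed

lemma meridian_power_lift:
  assumes "positive_meridian S (t0n ^ n) 0 g"
  obtains h where "positive_meridian Sn t0n 0 h" "\<phi> h = g [^]\<^bsub>G\<^esub> n"
proof -
  obtain \<epsilon> d where e: "0 < \<epsilon>" "cball 0 \<epsilon> \<inter> S = {0}" and d: "path_in (- S) d" "pathstart d = t0n ^ n"
      "pathfinish d = 0 + of_real \<epsilon>" and g: "g = loop_class S (lasso d (circlepath 0 \<epsilon>))"
    using assms by (auto simp: positive_meridian_iff)
  have "sphere 0 \<epsilon> \<inter> S = {}"
  proof (rule ccontr)
    assume "sphere 0 \<epsilon> \<inter> S \<noteq> {}"
    then obtain z where z: "z \<in> sphere 0 \<epsilon>" "z \<in> S" by blast
    then have "z \<in> cball 0 \<epsilon> \<inter> S" by simp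
    then show False unfolding e(2) using z(1) e(1) by simp
  qed
  then obtain d' where d': "path_in (- Sn) d'" "pathstart d' = t0n" "pathfinish d' = of_real (root n \<epsilon>)"
    "\<phi> (loop_class Sn (lasso d' (circlepath 0 (root n \<epsilon>)))) = g [^]\<^bsub>G\<^esub> n"
    using circle_lift[OF e(1) _ d(1,2)] d(3) g by auto
  have r: "0 < root n \<epsilon>" "root n \<epsilon> ^ n = \<epsilon>" using n e(1) by auto
  have "cball 0 (root n \<epsilon>) \<inter> Sn = {0}"
  proof (intro equalityI subsetI)
    fix z assume z: "z \<in> cball 0 (root n \<epsilon>) \<inter> Sn"
    then have "norm z ^ n \<le> root n \<epsilon> ^ n" by (intro power_mono) auto
    then have "z ^ n \<in> cball 0 \<epsilon> \<inter> S" using z r by (simp add: norm_power Sn_def)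
    then show "z \<in> {0}" unfolding e(2) by simp
  qed (use r zero_Sn in auto)
  then have "positive_meridian Sn t0n 0 (loop_class Sn (lasso d' (circlepath 0 (root n \<epsilon>))))"
    unfolding positive_meridian_iff using r d' by (intro exI[of _ "root n \<epsilon>"] exI[of _ d']) simp
  then show ?thesis using d'(4) that by blast
qed

lemma large_circle_power_lift:
  assumes "large_circle S (t0n ^ n) g"
  obtains h where "large_circle Sn t0n h" "h \<in> carrier P" "\<phi> h = g [^]\<^bsub>G\<^esub> n"
proof -
  obtain R d where R: "0 < R" "S \<subseteq> ball 0 R" and d: "path_in (- S) d" "pathstart d = t0n ^ n"
      "pathfinish d = of_real R" and g: "g = loop_class S (lasso d (circlepath 0 R))"
    using assms by (auto simp: large_circle_iff)
  have "sphere 0 R \<inter> S = {}" using R(2) by force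
  then obtain d' where d': "path_in (- Sn) d'" "pathstart d' = t0n" "pathfinish d' = of_real (root n R)"
    "\<phi> (loop_class Sn (lasso d' (circlepath 0 (root n R)))) = g [^]\<^bsub>G\<^esub> n"
    using circle_lift[OF R(1) _ d] g by auto
  have r: "0 < root n R" "root n R ^ n = R" using n R(1) by auto
  have ball: "Sn \<subseteq> ball 0 (root n R)"
  proof
    fix z assume "z \<in> Sn"
    then have "norm z ^ n < root n R ^ n" using R(2) r by (auto simp: Sn_def norm_power subset_iff)
    then have "norm z < root n R" using r by (intro power_less_imp_less_base[of "norm z" n]) auto
    then show "z \<in> ball 0 (root n R)" by simp
  qed
  have large: "large_circle Sn t0n (loop_class Sn (lasso d' (circlepath 0 (root n R))))"
    unfolding large_circle_iff using r d' ball by (intro exI[of _ "root n R"] exI[of _ d']) simp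
  have "path_in (- Sn) (circlepath 0 (root n R))"
    using r ball by (intro path_in_circlepath) (auto simp: subset_iff)
  then have "path_in (- Sn) (lasso d' (circlepath 0 (root n R)))"
    using d' by (intro path_in_lasso) auto
  then have "loop_class Sn (lasso d' (circlepath 0 (root n R))) \<in> carrier P"
    using d' by (auto simp: pi1_carrier_iff)
  then show ?thesis using large d'(4) that by blast
qed

lemma foldr_mult_\<phi>:
  "set hs \<subseteq> carrier P \<Longrightarrow> foldr (mult P) hs (one P) \<in> carrier P \<and>
     \<phi> (foldr (mult P) hs (one P)) = foldr (mult G) (map \<phi> hs) (one G)"
proof (induction hs)
  case Nil
  then show ?case
    using group.is_monoid[OF group_P] hom_one[OF \<phi>_hom group_P group_G] by (simp add: monoid.one_closed)
next
  case (Cons h hs)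
  then show ?case
    using hom_mult[OF \<phi>_hom] group.is_monoid[OF group_P] by (simp add: monoid.m_closed)
qed

text \<open>
  Each member of the Kummer list lifts to a meridian; the remaining properties of a geometric
  basis are transported along the injection \<open>\<phi>\<close>. The exponent of \<open>b\<close> in an element is its winding
  number about \<open>0\<close>.
\<close>

lemma kummer_geometric_basis:
  assumes gb: "geometric_basis ts (t0n ^ n) gs" and ts: "set ts = S" "last ts = 0"
  obtains tsn hs where "set tsn = Sn" "geometric_basis tsn t0n hs" "set hs \<subseteq> carrier P"
    "map \<phi> hs = kummer_list G n gs"
proof -
  have "ts \<noteq> []" using ts(1) zero by auto
  then obtain ss where ss: "ts = ss @ [0]" using ts(2) by (metis append_butlast_last_id)
  have len: "length gs = length ts" and fb: "free_basis G gs" and dist: "distinct ts"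
    and mer: "\<And>i. i < length ts \<Longrightarrow> positive_meridian S (t0n ^ n) (ts ! i) (gs ! i)"
    and large: "large_circle S (t0n ^ n) (foldr (mult G) (rev gs) (one G))"
    using gb unfolding geometric_basis_def ts(1) by auto
  define r where "r = length ss"
  have "gs \<noteq> []" using len ss by auto
  then obtain as b where gs: "gs = as @ [b]" by (metis append_butlast_last_id)
  have r: "length as = r" using len ss gs by (simp add: r_def)
  interpret group G by (rule group_G)
  have carr: "set (as @ [b]) \<subseteq> carrier G" using fb gs by (simp add: free_basis_def)
  then have b: "b \<in> carrier G" by simp
  have merb: "positive_meridian S (t0n ^ n) 0 b"
    using mer[of r] by (simp add: ss gs r_def[symmetric] nth_append r)
  have mera: "positive_meridian S (t0n ^ n) (ss ! i) (as ! i)" and ssi: "ss ! i \<in> S" "ss ! i \<noteq> 0"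
    if "i < r" for i
  proof -
    show "positive_meridian S (t0n ^ n) (ss ! i) (as ! i)"
      using mer[of i] that by (simp add: ss gs r_def[symmetric] nth_append r)
    have "ss ! i \<in> set ss" using that by (simp add: r_def)
    then show "ss ! i \<in> S" "ss ! i \<noteq> 0" using ts(1) dist by (auto simp: ss)
  qed
  let ?ks = "kummer_list G n gs"
  have lenk: "length ?ks = n * r + 1" by (simp add: length_kummer_list gs r)
  have "\<exists>s h. positive_meridian Sn t0n s h \<and> \<phi> h = ?ks ! p" if "p < n * r + 1" for p
    using that
  proof (cases rule: kummer_index_cases)
    case (conj j i)
    have "positive_meridian S (t0n ^ n) (ss ! i) (conj_by G (as ! i) (b [^]\<^bsub>G\<^esub> j))"
      using mera[OF conj(2)] b by (intro positive_meridian_conj) auto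
    then obtain s h where "positive_meridian Sn t0n s h" "\<phi> h = conj_by G (as ! i) (b [^]\<^bsub>G\<^esub> j)"
      using meridian_lift ssi[OF conj(2)] by metis
    then show ?thesis
      using kummer_list_nth[of j n i as G b] conj by (auto simp: gs r)
  next
    case power
    obtain h where "positive_meridian Sn t0n 0 h" "\<phi> h = b [^]\<^bsub>G\<^esub> n"
      using meridian_power_lift[OF merb] by blast
    then show ?thesis using kummer_list_nth_last[of G n as b] power by (auto simp: gs r)
  qed
  then obtain sf hf where sh: "\<And>p. p < n * r + 1 \<Longrightarrow> positive_meridian Sn t0n (sf p) (hf p)"
    "\<And>p. p < n * r + 1 \<Longrightarrow> \<phi> (hf p) = ?ks ! p" by metis
  define tsn hs where "tsn = map sf [0..<n * r + 1]" and "hs = map hf [0..<n * r + 1]"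
  have map: "map \<phi> hs = ?ks"
    by (rule nth_equalityI) (simp_all add: hs_def lenk sh(2) del: upt_Suc)
  have lens: "length hs = length tsn" by (simp add: hs_def tsn_def)
  have mern: "positive_meridian Sn t0n (tsn ! i) (hs ! i)" if "i < length tsn" for i
    using that sh(1) by (simp add: hs_def tsn_def del: upt_Suc)
  have hsc: "set hs \<subseteq> carrier P"
    using mern positive_meridian_carrier lens by (force simp: in_set_conv_nth)
  have t0n: "t0n \<notin> Sn" using base by (simp add: Sn_def)
  have largen: "large_circle Sn t0n (foldr (mult P) (rev hs) (one P))"
  proof -
    obtain h where h: "large_circle Sn t0n h" "h \<in> carrier P"
      "\<phi> h = foldr (mult G) (rev gs) (one G) [^]\<^bsub>G\<^esub> n"
      using large_circle_power_lift[OF large] by blast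
    have f: "foldr (mult P) (rev hs) (one P) \<in> carrier P"
      "\<phi> (foldr (mult P) (rev hs) (one P)) = foldr (mult G) (rev ?ks) (one G)"
      using foldr_mult_\<phi>[of "rev hs"] hsc map by (simp_all add: rev_map[symmetric])
    have "\<phi> h = \<phi> (foldr (mult P) (rev hs) (one P))"
      unfolding h(3) f(2) using kummer_list_product[OF carr, of n] by (simp only: gs)
    then have "h = foldr (mult P) (rev hs) (one P)"
      using inj_onD[OF \<phi>_inj _ h(2) f(1)] by blast
    then show ?thesis using h(1) by simp
  qed
  note tsn = meridians_of_large_circle[OF t0n lens mern largen]
  \<comment> \<open>Winding numbers of loops are integers, so the floor only changes the type.\<close>
  let ?\<omega> = "\<lambda>g. \<lfloor>Re (class_winding g 0)\<rfloor>"
  have "free_basis P hs"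
  proof (rule group.free_basis_of_injective_hom[OF group_P group_G \<phi>_hom \<phi>_inj hsc])
    fix g assume g: "g \<in> carrier P"
    have "\<exists>!w. reduced_word (length (kummer_list G n (as @ [b]))) w \<and>
        eval_word G (kummer_list G n (as @ [b])) w = \<phi> g"
    proof (rule kummer_list_free[where \<omega> = ?\<omega>])
      show "free_basis G (as @ [b])" "0 < n" using fb gs n by auto
      show "\<phi> g \<in> carrier G" using hom_in_carrier[OF \<phi>_hom g] .
      show "?\<omega> (x \<otimes>\<^bsub>G\<^esub> y) = ?\<omega> x + ?\<omega> y" if xy: "x \<in> carrier G" "y \<in> carrier G" for x y
      proof -
        obtain i j :: int where "class_winding x 0 = of_int i" "class_winding y 0 = of_int j"
          using class_winding_int[OF xy(1) zero] class_winding_int[OF xy(2) zero] by (auto elim!: Ints_cases)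
        then show ?thesis using class_winding_mult[OF xy zero] by simp
      qed
      show "?\<omega> a = 0" if a: "a \<in> set as" for a
      proof -
        obtain i where "i < r" "a = as ! i" using a r by (auto simp: in_set_conv_nth)
        then show ?thesis using class_winding_meridian[OF mera zero, of i] ssi[of i] by auto
      qed
      show "?\<omega> b = 1" using class_winding_meridian[OF merb zero] by simp
      obtain i :: int where "class_winding g 0 = of_int i"
        using class_winding_int[OF g zero_Sn] by (auto elim!: Ints_cases)
      then have "class_winding (\<phi> g) 0 = of_int (int n * i)" using class_winding_\<phi>[OF g] by simp
      moreover have "Re (of_int j) = of_int j" for j by simp
      ultimately have "?\<omega> (\<phi> g) = int n * i" by (simp only: floor_of_int)
      then show "int n dvd ?\<omega> (\<phi> g)" by simp
    qed
    then show "\<exists>!w. reduced_word (length hs) w \<and> eval_word G (map \<phi> hs) w = \<phi> g"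
      unfolding map gs using arg_cong[OF map, of length] gs by simp
  qed
  then have "free_basis (pi1_compl (set tsn) t0n) hs"
    "\<forall>i<length tsn. positive_meridian (set tsn) t0n (tsn ! i) (hs ! i)"
    "large_circle (set tsn) t0n
       (foldr (mult (pi1_compl (set tsn) t0n)) (rev hs) (one (pi1_compl (set tsn) t0n)))"
    using mern largen by (simp_all only: tsn(2)) simp
  then have "geometric_basis tsn t0n hs"
    unfolding geometric_basis_def using tsn(1) lens by blast
  then show ?thesis using that[OF tsn(2) _ hsc map] by blast
qed

end

section \<open>Continuous families of finite sets\<close>

lemma mem_topspace_ordered_conf:
  "c \<in> topspace (ordered_conf k A) \<longleftrightarrow> c \<in> {..<k} \<rightarrow>\<^sub>E A \<and> inj_on c {..<k}"
  by (simp add: ordered_conf_def)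

lemma mem_topspace_unordered_conf:
  "Y \<in> topspace (unordered_conf k A) \<longleftrightarrow> finite Y \<and> card Y = k \<and> Y \<subseteq> A"
proof
  assume "Y \<in> topspace (unordered_conf k A)"
  then obtain c where c: "c \<in> {..<k} \<rightarrow>\<^sub>E A" "inj_on c {..<k}" "Y = c ` {..<k}"
    by (auto simp: topspace_unordered_conf mem_topspace_ordered_conf)
  then have "card Y = k" by (simp add: card_image)
  moreover have "Y \<subseteq> A" using c(1,3) by auto
  ultimately show "finite Y \<and> card Y = k \<and> Y \<subseteq> A" using c(3) by simp
next
  assume Y: "finite Y \<and> card Y = k \<and> Y \<subseteq> A"
  then obtain h where h: "bij_betw h {..<k} Y"
    using ex_bij_betw_nat_finite[of Y] by (auto simp: atLeast0LessThan)
  have im: "restrict h {..<k} ` {..<k} = Y"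
    using h by (simp add: bij_betw_def)
  have "inj_on (restrict h {..<k}) {..<k}" using h by (simp add: bij_betw_def inj_on_def)
  then have "restrict h {..<k} \<in> topspace (ordered_conf k A)"
    using im Y by (auto simp: mem_topspace_ordered_conf)
  then show "Y \<in> topspace (unordered_conf k A)"
    using im topspace_unordered_conf[of k A] by (metis image_eqI)
qed

lemma ordered_conf_ball:
  assumes V: "openin (ordered_conf k A) V" and y: "y \<in> V"
  shows "\<exists>\<epsilon>>0. \<forall>z\<in>topspace (ordered_conf k A). (\<forall>i<k. dist (z i) (y i) < \<epsilon>) \<longrightarrow> z \<in> V"
proof -
  obtain T where T: "openin (product_topology (\<lambda>_. top_of_set A) {..<k}) T"
    and VT: "V = T \<inter> {c. inj_on c {..<k}}"
    using V unfolding ordered_conf_def openin_subtopology by blast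
  have "y \<in> T" using y VT by blast
  then obtain U where U: "\<And>i. i < k \<Longrightarrow> openin (top_of_set A) (U i)" "y \<in> Pi\<^sub>E {..<k} U" "Pi\<^sub>E {..<k} U \<subseteq> T"
    using T unfolding openin_product_topology_alt by (metis lessThan_iff)
  have "\<exists>e>0. \<forall>w\<in>A. dist w (y i) < e \<longrightarrow> w \<in> U i" if "i < k" for i
    using U(1)[OF that] U(2) that unfolding openin_euclidean_subtopology_iff by (auto simp: PiE_iff)
  then obtain e where e: "\<And>i. i < k \<Longrightarrow> e i > 0" "\<And>i w. i < k \<Longrightarrow> w \<in> A \<Longrightarrow> dist w (y i) < e i \<Longrightarrow> w \<in> U i"
    by metis
  show ?thesis
  proof (intro exI conjI ballI impI)
    show "0 < Min (insert 1 (e ` {..<k}))" using e(1) by auto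
    fix z assume z1: "z \<in> topspace (ordered_conf k A)" and z2: "\<forall>i<k. dist (z i) (y i) < Min (insert 1 (e ` {..<k}))"
    have "z i \<in> U i" if "i < k" for i
    proof (rule e(2)[OF that])
      show "z i \<in> A" using z1 that by (auto simp: mem_topspace_ordered_conf PiE_iff)
      have "Min (insert 1 (e ` {..<k})) \<le> e i" using that by (intro Min_le) auto
      then show "dist (z i) (y i) < e i" using z2 that by (blast intro: order.strict_trans2)
    qed
    moreover have "z \<in> extensional {..<k}" "inj_on z {..<k}"
      using z1 by (auto simp: mem_topspace_ordered_conf PiE_iff)
    ultimately have "z \<in> Pi\<^sub>E {..<k} U" "inj_on z {..<k}" by (auto simp: PiE_iff)
    then show "z \<in> V" using U(3) VT by blast
  qed
qed

lemma finite_separated: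
  fixes Y :: "complex set"
  assumes "finite Y"
  obtains d where "0 < d" "\<And>a b. a \<in> Y \<Longrightarrow> b \<in> Y \<Longrightarrow> a \<noteq> b \<Longrightarrow> d \<le> dist a b"
proof
  let ?D = "insert 1 ((\<lambda>(a, b). dist a b) ` {(a, b) \<in> Y \<times> Y. a \<noteq> b})"
  have "finite {(a, b) \<in> Y \<times> Y. a \<noteq> b}"
    by (rule finite_subset[of _ "Y \<times> Y"]) (use assms in auto)
  then have fin: "finite ?D" by simp
  show "0 < Min ?D" by (subst Min_gr_iff[OF fin]) auto
  show "Min ?D \<le> dist a b" if "a \<in> Y" "b \<in> Y" "a \<noteq> b" for a b
    using fin that by (intro Min_le) auto
qed

text \<open>
  For sets of a fixed finite size, lower hemicontinuity suffices for continuity: if every point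
  of \<open>f x\<close> has a point of \<open>f x'\<close> nearby, then by counting it has exactly one, and this matching
  enumerates \<open>f x'\<close> close to \<open>f x\<close>.
\<close>

lemma continuous_map_unordered_conf:
  assumes top: "\<And>x. x \<in> topspace X \<Longrightarrow> f x \<in> topspace (unordered_conf k A)"
    and near: "\<And>x w \<delta>. x \<in> topspace X \<Longrightarrow> w \<in> f x \<Longrightarrow> 0 < \<delta> \<Longrightarrow>
       \<exists>W. openin X W \<and> x \<in> W \<and> (\<forall>x'\<in>W. \<exists>z\<in>f x'. dist z w < \<delta>)"
  shows "continuous_map X (unordered_conf k A) f"
  unfolding continuous_map
proof (intro conjI allI impI)
  show "f ` topspace X \<subseteq> topspace (unordered_conf k A)" by (rule image_subsetI) (rule top)
  fix U assume U: "openin (unordered_conf k A) U"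
  show "openin X {x \<in> topspace X. f x \<in> U}"
  proof (rule openin_subopen[THEN iffD2], rule ballI)
    fix x assume "x \<in> {x \<in> topspace X. f x \<in> U}"
    then have x: "x \<in> topspace X" "f x \<in> U" by auto
    have U': "U \<subseteq> (\<lambda>c. c ` {..<k}) ` topspace (ordered_conf k A)"
      "openin (ordered_conf k A) {c \<in> topspace (ordered_conf k A). c ` {..<k} \<in> U}"
      using U unfolding openin_unordered_conf by simp_all
    obtain y where y: "y \<in> topspace (ordered_conf k A)" "f x = y ` {..<k}"
      using subsetD[OF U'(1) x(2)] by (rule imageE)
    have inj: "inj_on y {..<k}" using y by (simp add: mem_topspace_ordered_conf)
    have "y \<in> {c \<in> topspace (ordered_conf k A). c ` {..<k} \<in> U}" using x(2) y by simp
    from ordered_conf_ball[OF U'(2) this] obtain \<epsilon> where \<epsilon>0: "0 < \<epsilon>"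
      and \<epsilon>1: "\<forall>z\<in>topspace (ordered_conf k A). (\<forall>i<k. dist (z i) (y i) < \<epsilon>) \<longrightarrow>
        z \<in> {c \<in> topspace (ordered_conf k A). c ` {..<k} \<in> U}"
      by (elim exE conjE)
    have \<epsilon>: "z ` {..<k} \<in> U" if "z \<in> topspace (ordered_conf k A)" "\<forall>i<k. dist (z i) (y i) < \<epsilon>" for z
      using \<epsilon>1 that by simp
    obtain d where d: "0 < d" "\<And>a b. a \<in> f x \<Longrightarrow> b \<in> f x \<Longrightarrow> a \<noteq> b \<Longrightarrow> d \<le> dist a b"
      using finite_separated[of "f x"] y(2) by auto
    \<comment> \<open>Discs of radius \<open>d / 2\<close> about the points of \<open>f x\<close> are disjoint, so no point is matched twice.\<close>
    define \<delta> where "\<delta> = min \<epsilon> (d / 2)"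
    have "0 < \<delta>" using \<epsilon>0 d by (simp add: \<delta>_def)
    then have "\<exists>W. openin X W \<and> x \<in> W \<and> (\<forall>x'\<in>W. \<exists>z\<in>f x'. dist z (y i) < \<delta>)" if "i < k" for i
      using near[OF x(1), of "y i" \<delta>] y(2) that by auto
    then obtain W where W: "\<And>i. i < k \<Longrightarrow> openin X (W i) \<and> x \<in> W i \<and> (\<forall>x'\<in>W i. \<exists>z\<in>f x'. dist z (y i) < \<delta>)"
      by metis
    let ?W = "topspace X \<inter> \<Inter>(W ` {..<k})"
    have "?W \<subseteq> {x \<in> topspace X. f x \<in> U}"
    proof
      fix x' assume x': "x' \<in> ?W"
      then have "\<exists>z\<in>f x'. dist z (y i) < \<delta>" if "i < k" for i using W[OF that] that by blast
      then obtain z where z: "\<And>i. i < k \<Longrightarrow> z i \<in> f x'" "\<And>i. i < k \<Longrightarrow> dist (z i) (y i) < \<delta>"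
        by metis
      have fx': "finite (f x')" "card (f x') = k" "f x' \<subseteq> A"
        using top[of x'] x' mem_topspace_unordered_conf[of "f x'" k A] by auto
      have injz: "inj_on z {..<k}"
      proof (rule inj_onI, rule ccontr)
        fix i j assume ij: "i \<in> {..<k}" "j \<in> {..<k}" "z i = z j" "i \<noteq> j"
        then have "y i \<noteq> y j" using inj by (auto simp: inj_on_def)
        then have "d \<le> dist (y i) (y j)" using d(2) y(2) ij by auto
        also have "\<dots> \<le> dist (z i) (y i) + dist (z j) (y j)"
          using dist_triangle3[of "y i" "y j" "z i"] ij(3) by simp
        also have "\<dots> < d" using z(2)[of i] z(2)[of j] ij by (simp add: \<delta>_def)
        finally show False by simp
      qed
      have im: "z ` {..<k} = f x'"
        using z(1) fx' injz by (intro card_subset_eq) (auto simp: card_image)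
      have "restrict z {..<k} \<in> topspace (ordered_conf k A)"
        using im fx' injz by (auto simp: mem_topspace_ordered_conf inj_on_def)
      then have "restrict z {..<k} ` {..<k} \<in> U"
        by (rule \<epsilon>) (use z(2) in \<open>auto simp: \<delta>_def\<close>)
      then show "x' \<in> {x \<in> topspace X. f x \<in> U}" using im x' by auto
    qed
    moreover have "openin X ?W"
    proof (cases "k = 0")
      case False
      then have "openin X (\<Inter>(W ` {..<k}))" using W by (intro openin_Inter) auto
      then show ?thesis by auto
    qed auto
    ultimately show "\<exists>T. openin X T \<and> x \<in> T \<and> T \<subseteq> {x \<in> topspace X. f x \<in> U}"
      using x(1) W by (intro exI[of _ ?W]) auto
  qed
qed

text \<open>Up to the leading coefficient, the modulus of \<open>p(w)\<close> is the product of the distances of \<open>w\<close> to the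
  roots; if all of them were at least \<open>\<delta>\<close>, the value would be too large.\<close>

lemma poly_root_nearby:
  fixes p :: "complex poly"
  assumes "0 < \<delta>" "norm (poly p w) < norm (lead_coeff p) * \<delta> ^ degree p"
  shows "\<exists>z. poly p z = 0 \<and> dist z w < \<delta>"
proof (rule ccontr)
  assume "\<nexists>z. poly p z = 0 \<and> dist z w < \<delta>"
  then have far: "\<delta> \<le> dist z w" if "poly p z = 0" for z using that by (meson not_le)
  have "p \<noteq> 0" using assms by auto
  then obtain A where A: "size A = degree p" "p = smult (lead_coeff p) (\<Prod>x\<in>#A. [:-x, 1:])"
    using alg_closed_imp_factorization by blast
  have prod: "\<delta> ^ size B \<le> norm (poly (\<Prod>x\<in>#B. [:-x, 1:]) w)" if "B \<subseteq># A" for B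
    using that
  proof (induction B)
    case (add x B)
    have "x \<in># A" using add.prems by (meson mset_subset_eqD union_single_eq_member)
    then have "poly (\<Prod>x\<in>#A. [:-x, 1:]) x = 0"
      by (subst poly_prod_mset) (auto simp: prod_mset_zero_iff)
    then have "poly p x = 0" by (subst A(2)) simp
    from far[OF this] have "\<delta> \<le> norm (w - x)" by (simp only: dist_norm norm_minus_commute)
    moreover have "\<delta> ^ size B \<le> norm (poly (\<Prod>x\<in>#B. [:-x, 1:]) w)"
      using add by (meson mset_subset_eq_insertD subset_mset.less_imp_le)
    ultimately have "\<delta> * \<delta> ^ size B \<le> norm (w - x) * norm (poly (\<Prod>x\<in>#B. [:-x, 1:]) w)"
      using assms(1) by (intro mult_mono) auto
    moreover have "poly (\<Prod>y\<in>#add_mset x B. [:-y, 1:]) w = (w - x) * poly (\<Prod>y\<in>#B. [:-y, 1:]) w"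
      by (simp add: algebra_simps)
    ultimately show ?case by (simp only: norm_mult size_add_mset power_Suc)
  qed simp
  have "norm (poly p w) = norm (lead_coeff p) * norm (poly (\<Prod>x\<in>#A. [:-x, 1:]) w)"
    by (subst A(2)) (simp add: norm_mult)
  moreover have "\<delta> ^ degree p \<le> norm (poly (\<Prod>x\<in>#A. [:-x, 1:]) w)"
    using prod[of A] A(1) by simp
  ultimately show False using assms(2) mult_left_mono[of _ _ "norm (lead_coeff p)"] by (metis norm_ge_zero not_le)
qed

lemma nth_root_nearby:
  fixes w v :: complex
  assumes "0 < n" "0 < \<delta>" "dist v (w ^ n) < \<delta> ^ n"
  shows "\<exists>z. z ^ n = v \<and> dist z w < \<delta>"
proof -
  let ?p = "monom 1 n + [:-v:]"
  have deg: "degree ?p = n"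
    using assms(1) by (subst degree_add_eq_left) (auto simp: degree_monom_eq)
  then have "lead_coeff ?p = 1" using assms(1) by (simp add: coeff_pCons split: nat.split)
  then have "norm (poly ?p w) < norm (lead_coeff ?p) * \<delta> ^ degree ?p"
    using assms(3) deg by (simp add: poly_monom dist_norm norm_minus_commute)
  from poly_root_nearby[OF assms(2) this] show ?thesis by (simp add: poly_monom)
qed

text \<open>
  By the criterion above it suffices to follow a single root, and the configurations that meet a
  given disc form an open set.
\<close>

lemma continuous_map_nth_roots:
  assumes n: "0 < n"
  shows "continuous_map (unordered_conf k (- {0})) (unordered_conf (n * k) (- {0})) (\<lambda>c. {y. y ^ n \<in> c})"
proof (rule continuous_map_unordered_conf)
  fix c assume "c \<in> topspace (unordered_conf k (- {0}))"
  then have c: "finite c" "card c = k" "0 \<notin> c" by (auto simp: mem_topspace_unordered_conf)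
  have eq: "{y. y ^ n \<in> c} = (\<Union>v\<in>c. {y. y ^ n = v})" by auto
  have roots: "finite {y. y ^ n = v}" "card {y. y ^ n = v} = n" if "v \<in> c" for v
    using that c n card_nth_roots[of v n] finite_nth_roots[of n v] by auto
  have "card {y. y ^ n \<in> c} = (\<Sum>v\<in>c. card {y. y ^ n = v})"
    unfolding eq using c roots by (intro card_UN_disjoint) auto
  then show "{y. y ^ n \<in> c} \<in> topspace (unordered_conf (n * k) (- {0}))"
    using c roots n eq by (auto simp: mem_topspace_unordered_conf zero_power[OF n])
next
  fix c w and \<delta> :: real
  assume c: "c \<in> topspace (unordered_conf k (- {0}))" and w: "w \<in> {y. y ^ n \<in> c}" and \<delta>: "0 < \<delta>"
  let ?X = "unordered_conf k (- {0})" and ?O = "ordered_conf k (- {0})"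
  let ?W = "{c' \<in> topspace ?X. \<exists>v\<in>c'. dist v (w ^ n) < \<delta> ^ n}"
  have "{z \<in> topspace ?O. z ` {..<k} \<in> ?W} = (\<Union>i<k. {z \<in> topspace ?O. z i \<in> ball (w ^ n) (\<delta> ^ n)})"
    by (auto simp: topspace_unordered_conf dist_commute)
  moreover have "openin ?O {z \<in> topspace ?O. z i \<in> ball (w ^ n) (\<delta> ^ n)}" if "i < k" for i
  proof (rule openin_continuous_map_preimage[where Y = euclidean])
    have "continuous_map (product_topology (\<lambda>_. top_of_set (- {0})) {..<k}) (top_of_set (- {0})) (\<lambda>z. z i)"
      using that by (intro continuous_map_product_projection) simp
    then show "continuous_map ?O euclidean (\<lambda>z. z i)"
      unfolding ordered_conf_def
      by (intro continuous_map_from_subtopology) (rule continuous_map_into_fulltopology)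
  qed simp
  ultimately have "openin ?O {z \<in> topspace ?O. z ` {..<k} \<in> ?W}" by auto
  then have "openin ?X ?W"
    unfolding openin_unordered_conf by (auto simp: topspace_unordered_conf)
  moreover have "c \<in> ?W" using c w \<delta> by force
  moreover have "\<forall>c'\<in>?W. \<exists>z\<in>{y. y ^ n \<in> c'}. dist z w < \<delta>"
    using nth_root_nearby[OF n \<delta>] by (simp, metis)
  ultimately show "\<exists>W. openin ?X W \<and> c \<in> W \<and> (\<forall>c'\<in>W. \<exists>z\<in>{y. y ^ n \<in> c'}. dist z w < \<delta>)" by blast
qed

section \<open>Pull-back of curves under the Kummer cover\<close>

lemma poly_sum_le:
  fixes p :: "'a :: comm_semiring_1 poly"
  shows "degree p \<le> N \<Longrightarrow> poly p x = (\<Sum>i\<le>N. coeff p i * x ^ i)"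
  unfolding poly_altdef
  by (rule sum.mono_neutral_left) (auto simp: coeff_eq_0)

lemma poly_euler:
  fixes p :: "'a :: idom poly"
  assumes "degree p \<le> N"
  shows "x * poly (pderiv p) x = (\<Sum>i\<le>N. of_nat i * coeff p i * x ^ i)"
proof -
  let ?g = "\<lambda>i. of_nat i * coeff p i * x ^ i"
  have "degree (pderiv p) \<le> N"
    using assms by (intro degree_le) (simp add: coeff_pderiv coeff_eq_0)
  from poly_sum_le[OF this, of x] have "x * poly (pderiv p) x = (\<Sum>i\<le>N. ?g (Suc i))"
    by (simp add: coeff_pderiv sum_distrib_left algebra_simps)
  also have "\<dots> = (\<Sum>i\<le>Suc N. ?g i)" by (subst sum.atMost_Suc_shift) simp
  also have "\<dots> = (\<Sum>i\<le>N. ?g i)" using assms by (simp add: coeff_eq_0)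
  finally show ?thesis .
qed

text \<open>The polynomial \<open>F(x, Y, z)\<close> in the remaining variable \<open>Y\<close>.\<close>

definition slice :: "complex \<Rightarrow> complex \<Rightarrow> tpoly \<Rightarrow> complex poly" where
  "slice x z = map_poly (\<lambda>q. poly (poly q [:z:]) x)"

lemma coeff_slice: "coeff (slice x z F) b = poly (poly (coeff F b) [:z:]) x"
  by (simp add: slice_def coeff_map_poly)

lemma poly_slice: "poly (slice x z F) y = eval3 F x y z"
  by (induction F) (auto simp: slice_def eval3_def map_poly_pCons)

lemma eval3_mult: "eval3 (F * G) x y z = eval3 F x y z * eval3 G x y z"
  by (simp add: eval3_def)

lemma slice_mult: "slice x z (F * G) = slice x z F * slice x z G"
  by (rule poly_eq_poly_eq_iff[THEN iffD1], rule ext) (simp add: poly_slice eval3_mult)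

lemma slice_pderiv: "slice x z (deriv_Y F) = pderiv (slice x z F)"
  by (rule poly_eqI) (simp add: coeff_slice coeff_pderiv deriv_Y_def of_nat_poly)

lemma eval3_deriv_Y: "eval3 (deriv_Y F) x y z = poly (pderiv (slice x z F)) y"
  by (simp flip: poly_slice add: slice_pderiv)

definition coeff3 :: "tpoly \<Rightarrow> nat \<Rightarrow> nat \<Rightarrow> nat \<Rightarrow> complex" where
  "coeff3 F a b c = coeff (coeff (coeff F b) c) a"

lemma homogeneous_iff: "homogeneous k F \<longleftrightarrow> (\<forall>a b c. coeff3 F a b c \<noteq> 0 \<longrightarrow> a + b + c = k)"
  by (simp add: homogeneous_def coeff3_def)

lemma homogeneous_degrees:
  assumes "homogeneous k F"
  shows "degree F \<le> k" "degree (coeff F b) \<le> k" "degree (coeff (coeff F b) c) \<le> k"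
proof -
  have z: "coeff (coeff (coeff F b) c) a = 0" if "k < a \<or> k < b \<or> k < c" for a b c
    using assms that by (force simp: homogeneous_def)
  show "degree (coeff (coeff F b) c) \<le> k" by (rule degree_le) (simp add: z)
  show "degree (coeff F b) \<le> k" by (rule degree_le) (auto simp: z poly_eq_iff)
  show "degree F \<le> k" by (rule degree_le) (auto simp: z poly_eq_iff)
qed

lemma eval3_sum:
  assumes "homogeneous k F"
  shows "eval3 F x y z = (\<Sum>b\<le>k. \<Sum>c\<le>k. \<Sum>a\<le>k. coeff3 F a b c * x ^ a * z ^ c * y ^ b)"
proof -
  note deg = homogeneous_degrees[OF assms]
  have "degree (slice x z F) \<le> k"
    using deg(1) by (intro degree_le) (simp add: coeff_slice coeff_eq_0)
  from poly_sum_le[OF this, of y] have "eval3 F x y z = (\<Sum>b\<le>k. coeff (slice x z F) b * y ^ b)"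
    by (simp only: poly_slice)
  also have "\<dots> = (\<Sum>b\<le>k. (\<Sum>c\<le>k. (\<Sum>a\<le>k. coeff3 F a b c * x ^ a) * z ^ c) * y ^ b)"
    by (simp add: coeff_slice poly_sum_le[OF deg(2)] poly_sum poly_power poly_sum_le[OF deg(3)] coeff3_def)
  finally show ?thesis by (simp add: sum_distrib_right)
qed

lemma eval3_scale:
  assumes "homogeneous k F"
  shows "eval3 F (s * x) (s * y) (s * z) = s ^ k * eval3 F x y z"
  unfolding eval3_sum[OF assms] sum_distrib_left
proof (intro sum.cong refl)
  fix a b c
  show "coeff3 F a b c * (s * x) ^ a * (s * z) ^ c * (s * y) ^ b =
      s ^ k * (coeff3 F a b c * x ^ a * z ^ c * y ^ b)"
  proof (cases "coeff3 F a b c = 0")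
    case False
    then have "k = a + b + c" using assms by (auto simp: homogeneous_iff)
    then show ?thesis by (simp add: power_mult_distrib power_add)
  qed simp
qed

lemma coeff_deriv_X: "coeff (coeff (deriv_X F) b) c = pderiv (coeff (coeff F b) c)"
  by (simp add: deriv_X_def coeff_map_poly)

lemma coeff_deriv_Z: "coeff (deriv_Z F) b = pderiv (coeff F b)"
  by (simp add: deriv_Z_def coeff_map_poly)

lemma eval3_slice_sum:
  assumes "\<And>b. k < b \<Longrightarrow> coeff G b = 0"
  shows "eval3 G x y z = (\<Sum>b\<le>k. poly (poly (coeff G b) [:z:]) x * y ^ b)"
proof -
  have "degree (slice x z G) \<le> k" by (rule degree_le) (simp add: coeff_slice assms)
  from poly_sum_le[OF this, of y] show ?thesis by (simp only: poly_slice coeff_slice)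
qed

text \<open>
  Compare the coefficients: the operators \<open>x \<partial>\<^sub>x\<close>, \<open>y \<partial>\<^sub>y\<close> and \<open>z \<partial>\<^sub>z\<close> multiply the monomial with exponents
  \<open>a\<close>, \<open>b\<close>, \<open>c\<close> by these exponents, whose sum is \<open>k\<close>.
\<close>

lemma euler3:
  assumes "homogeneous k F"
  shows "x * eval3 (deriv_X F) x y z + y * eval3 (deriv_Y F) x y z + z * eval3 (deriv_Z F) x y z =
     of_nat k * eval3 F x y z"
proof -
  note deg = homogeneous_degrees[OF assms]
  let ?m = "\<lambda>a b c. coeff3 F a b c * x ^ a * z ^ c * y ^ b"
  have F0: "coeff F b = 0" if "k < b" for b using deg(1) that by (simp add: coeff_eq_0)
  have dX0: "coeff (deriv_X F) b = 0" if "k < b" for b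
    by (rule poly_eqI) (simp add: coeff_deriv_X F0[OF that])
  have dX: "degree (coeff (deriv_X F) b) \<le> k" for b
    using deg(2)[of b] by (intro degree_le) (simp add: coeff_deriv_X coeff_eq_0)
  have "eval3 (deriv_X F) x y z =
      (\<Sum>b\<le>k. (\<Sum>c\<le>k. poly (pderiv (coeff (coeff F b) c)) x * z ^ c) * y ^ b)"
    using dX0 by (subst eval3_slice_sum[of k])
      (simp_all add: coeff_deriv_X poly_sum_le[OF dX] poly_sum poly_power)
  then have "x * eval3 (deriv_X F) x y z =
      (\<Sum>b\<le>k. (\<Sum>c\<le>k. (x * poly (pderiv (coeff (coeff F b) c)) x) * z ^ c) * y ^ b)"
    by (simp add: sum_distrib_left sum_distrib_right mult.assoc)
  then have X: "x * eval3 (deriv_X F) x y z = (\<Sum>b\<le>k. \<Sum>c\<le>k. \<Sum>a\<le>k. of_nat a * ?m a b c)"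
    by (simp add: poly_euler[OF deg(3)] sum_distrib_right coeff3_def mult.assoc)
  have "eval3 (deriv_Z F) x y z = (\<Sum>b\<le>k. poly (poly (pderiv (coeff F b)) [:z:]) x * y ^ b)"
    using F0 by (subst eval3_slice_sum[of k]) (simp_all add: coeff_deriv_Z)
  then have "z * eval3 (deriv_Z F) x y z =
      (\<Sum>b\<le>k. poly ([:z:] * poly (pderiv (coeff F b)) [:z:]) x * y ^ b)"
    by (simp add: sum_distrib_left mult.assoc)
  also have "\<dots> = (\<Sum>b\<le>k. (\<Sum>c\<le>k. of_nat c * poly (coeff (coeff F b) c) x * z ^ c) * y ^ b)"
    by (simp only: poly_euler[OF deg(2)] poly_sum) (simp add: poly_power)
  finally have Z: "z * eval3 (deriv_Z F) x y z = (\<Sum>b\<le>k. \<Sum>c\<le>k. \<Sum>a\<le>k. of_nat c * ?m a b c)"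
    by (simp add: poly_sum_le[OF deg(3)] sum_distrib_right sum_distrib_left coeff3_def mult.assoc)
  have "degree (slice x z F) \<le> k" by (rule degree_le) (simp add: coeff_slice F0)
  from poly_euler[OF this, of y] have "y * eval3 (deriv_Y F) x y z =
      (\<Sum>b\<le>k. of_nat b * (\<Sum>c\<le>k. (\<Sum>a\<le>k. coeff3 F a b c * x ^ a) * z ^ c) * y ^ b)"
    by (simp add: eval3_deriv_Y coeff_slice poly_sum_le[OF deg(2)] poly_sum poly_power
        poly_sum_le[OF deg(3)] coeff3_def)
  then have Y: "y * eval3 (deriv_Y F) x y z = (\<Sum>b\<le>k. \<Sum>c\<le>k. \<Sum>a\<le>k. of_nat b * ?m a b c)"
    by (simp add: sum_distrib_right sum_distrib_left mult.assoc)
  have "of_nat a * ?m a b c + of_nat b * ?m a b c + of_nat c * ?m a b c = of_nat k * ?m a b c" for a b c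
  proof (cases "coeff3 F a b c = 0")
    case False
    then have "k = a + b + c" using assms by (auto simp: homogeneous_iff)
    then show ?thesis by (simp add: algebra_simps)
  qed simp
  then show ?thesis
    unfolding X Y Z eval3_sum[OF assms]
    by (simp add: sum.distrib[symmetric] sum_distrib_left)
qed

lemma homogeneous_deriv_Y: "homogeneous (Suc k) F \<Longrightarrow> homogeneous k (deriv_Y F)"
  unfolding homogeneous_iff
proof (intro allI impI)
  fix a b c
  assume F: "\<forall>a b c. coeff3 F a b c \<noteq> 0 \<longrightarrow> a + b + c = Suc k" and "coeff3 (deriv_Y F) a b c \<noteq> 0"
  then have "coeff3 F a (Suc b) c \<noteq> 0"
    by (auto simp: coeff3_def deriv_Y_def coeff_pderiv of_nat_poly)
  then show "a + b + c = k" using F by fastforce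
qed

lemma homogeneous_var_Y_mult: "homogeneous k F \<Longrightarrow> homogeneous (Suc k) (var_Y * F)"
  unfolding homogeneous_iff coeff3_def var_Y_def
  by (auto simp: coeff_pCons split: nat.splits)

lemma homogeneous_vars: "homogeneous 1 var_Y" "homogeneous 1 var_Z"
  unfolding homogeneous_def var_Y_def var_Z_def
  by (auto simp: coeff_pCons split: nat.splits)

lemma eval3_vars [simp]: "eval3 var_Y x y z = y" "eval3 var_Z x y z = z" "eval3 var_X x y z = x"
  by (simp_all add: eval3_def var_Y_def var_Z_def var_X_def)

lemma line_form_eq: "line_form t = [:[:[:0, 1:], [:-t:]:]:]"
  by (simp add: line_form_def var_X_def const3_def var_Z_def)

lemma eval3_line_form:
  "eval3 (line_form t) x y z = x - t * z"
  "eval3 (deriv_X (line_form t)) x y z = 1"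
  "eval3 (deriv_Y (line_form t)) x y z = 0"
  "eval3 (deriv_Z (line_form t)) x y z = - t"
  by (simp_all add: line_form_eq eval3_def deriv_X_def deriv_Y_def deriv_Z_def map_poly_pCons pderiv_pCons)

text \<open>
  At a common point the line has gradient \<open>(1, 0, - t)\<close>. If \<open>\<partial>\<^sub>y G\<close> vanishes there, Euler's relation
  says that the gradient of \<open>G\<close> is a multiple of it; otherwise the two gradients are independent.
  The point \<open>P\<^sub>y\<close>, which lies on every line of the pencil, is not on \<open>G = 0\<close>, so common points are
  affine.
\<close>

lemma transversal_line_iff:
  assumes G: "homogeneous (Suc m) G" and Py: "eval3 G 0 1 0 \<noteq> 0"
  shows "transversal (line_form t) G \<longleftrightarrow>
     (\<forall>y. eval3 G t y 1 = 0 \<longrightarrow> eval3 (deriv_Y G) t y 1 \<noteq> 0)"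
proof (intro iffI allI impI)
  fix y assume tr: "transversal (line_form t) G" and y: "eval3 G t y 1 = 0"
  show "eval3 (deriv_Y G) t y 1 \<noteq> 0"
  proof
    assume d: "eval3 (deriv_Y G) t y 1 = 0"
    let ?gx = "eval3 (deriv_X G) t y 1"
    have z: "eval3 (deriv_Z G) t y 1 = - (t * ?gx)"
      using euler3[OF G, of t y 1] y d by (simp add: add_eq_0_iff)
    have pt: "(t, y, 1::complex) \<noteq> (0, 0, 0) \<and> eval3 (line_form t) t y 1 = 0 \<and> eval3 G t y 1 = 0"
      using y by (simp add: eval3_line_form)
    have "\<forall>D\<in>{deriv_X, deriv_Y, deriv_Z}.
        - ?gx * eval3 (D (line_form t)) t y 1 + 1 * eval3 (D G) t y 1 = 0"
      by (simp add: eval3_line_form d z)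
    with mp[OF tr[unfolded transversal_def, THEN spec, THEN spec, THEN spec] pt]
    have "(1::complex) = 0" by blast
    then show False by simp
  qed
next
  assume simple: "\<forall>y. eval3 G t y 1 = 0 \<longrightarrow> eval3 (deriv_Y G) t y 1 \<noteq> 0"
  show "transversal (line_form t) G"
    unfolding transversal_def
  proof (intro allI impI)
    fix x y z a b
    assume pt: "(x, y, z) \<noteq> (0, 0, 0) \<and> eval3 (line_form t) x y z = 0 \<and> eval3 G x y z = 0"
      and ab: "\<forall>D\<in>{deriv_X, deriv_Y, deriv_Z}. a * eval3 (D (line_form t)) x y z + b * eval3 (D G) x y z = 0"
    have x: "x = t * z" using pt by (simp add: eval3_line_form)
    have z: "z \<noteq> 0"
    proof
      assume "z = 0"
      then have "y \<noteq> 0" "eval3 G (y * 0) (y * 1) (y * 0) = 0" using pt x by auto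
      then show False using eval3_scale[OF G, of y 0 1 0] Py by simp
    qed
    have "eval3 G t (y / z) 1 = 0"
      using eval3_scale[OF G, of z t "y / z" 1] z pt x by (simp add: mult.commute)
    then have "eval3 (deriv_Y G) x y z \<noteq> 0"
      using simple eval3_scale[OF homogeneous_deriv_Y[OF G], of z t "y / z" 1] z x by (simp add: mult.commute)
    then have "b = 0" using ab by (simp add: eval3_line_form)
    then show "a = 0 \<and> b = 0" using ab by (simp add: eval3_line_form)
  qed
qed

definition simple_nonzero_roots :: "complex poly \<Rightarrow> bool" where
  "simple_nonzero_roots f \<longleftrightarrow> poly f 0 \<noteq> 0 \<and> (\<forall>y. poly f y = 0 \<longrightarrow> poly (pderiv f) y \<noteq> 0)"

lemma nontransversal_values_iff:
  assumes F: "homogeneous k F" and Py: "eval3 F 0 1 0 \<noteq> 0"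
  shows "t \<in> nontransversal_values F \<longleftrightarrow> \<not> simple_nonzero_roots (slice t 1 F)"
proof -
  have "slice t 1 (var_Y * F) = [:0, 1:] * slice t 1 F"
    unfolding slice_mult by (simp add: slice_def var_Y_def map_poly_pCons)
  then have "eval3 (deriv_Y (var_Y * F)) t y 1 = poly (slice t 1 F) y + y * poly (pderiv (slice t 1 F)) y" for y
    by (simp add: eval3_deriv_Y pderiv_pCons)
  moreover have "eval3 (var_Y * F) t y 1 = y * poly (slice t 1 F) y" for y
    by (simp add: eval3_mult poly_slice)
  moreover have "t \<in> nontransversal_values F \<longleftrightarrow>
      \<not> (\<forall>y. eval3 (var_Y * F) t y 1 = 0 \<longrightarrow> eval3 (deriv_Y (var_Y * F)) t y 1 \<noteq> 0)"
    using transversal_line_iff[OF homogeneous_var_Y_mult[OF F], of t] Py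
    by (simp add: nontransversal_values_def eval3_mult)
  moreover have "(\<forall>y. y * poly f y = 0 \<longrightarrow> poly f y + y * poly (pderiv f) y \<noteq> 0) \<longleftrightarrow>
      simple_nonzero_roots f" for f
  proof
    assume L: "\<forall>y. y * poly f y = 0 \<longrightarrow> poly f y + y * poly (pderiv f) y \<noteq> 0"
    show "simple_nonzero_roots f"
      unfolding simple_nonzero_roots_def using L[rule_format, of 0] L by auto
  next
    assume R: "simple_nonzero_roots f"
    show "\<forall>y. y * poly f y = 0 \<longrightarrow> poly f y + y * poly (pderiv f) y \<noteq> 0"
    proof (intro allI impI)
      fix y assume "y * poly f y = 0"
      then show "poly f y + y * poly (pderiv f) y \<noteq> 0"
        using R by (cases "y = 0") (simp_all add: simple_nonzero_roots_def)
    qed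
  qed
  ultimately show ?thesis by (simp only:)
qed

lemma lead_coeff_homogeneous:
  assumes F: "homogeneous k F" and Py: "eval3 F 0 1 0 \<noteq> 0"
  shows "degree F = k" "coeff F k = [:[:eval3 F 0 1 0:]:]"
proof -
  have "eval3 F 0 1 0 = (\<Sum>b\<le>k. coeff3 F 0 b 0)"
    using homogeneous_degrees(1)[OF F]
    by (subst eval3_slice_sum[of k]) (auto simp: coeff_eq_0 coeff3_def poly_0_coeff_0)
  also have "\<dots> = (\<Sum>b\<in>{k}. coeff3 F 0 b 0)"
    using F by (intro sum.mono_neutral_right) (force simp: homogeneous_iff)+
  finally have e: "eval3 F 0 1 0 = coeff3 F 0 k 0" by simp
  show c: "coeff F k = [:[:eval3 F 0 1 0:]:]"
  proof (intro poly_eqI)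
    fix c a
    show "coeff (coeff (coeff F k) c) a = coeff (coeff [:[:eval3 F 0 1 0:]:] c) a"
      using F e by (cases c; cases a) (force simp: homogeneous_def coeff3_def)+
  qed
  have "coeff F k \<noteq> 0" using c Py by simp
  then show "degree F = k" using homogeneous_degrees(1)[OF F] le_degree by (metis antisym)
qed

lemma slice_degree:
  assumes F: "homogeneous k F" and Py: "eval3 F 0 1 0 \<noteq> 0"
  shows "degree (slice t 1 F) = k" "lead_coeff (slice t 1 F) = eval3 F 0 1 0"
proof -
  note l = lead_coeff_homogeneous[OF assms]
  have c: "coeff (slice t 1 F) k = eval3 F 0 1 0" by (simp add: coeff_slice l(2))
  have "degree (slice t 1 F) \<le> k" using l(1) by (intro degree_le) (simp add: coeff_slice coeff_eq_0)
  moreover have "k \<le> degree (slice t 1 F)" using c Py by (intro le_degree) simp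
  ultimately show d: "degree (slice t 1 F) = k" by simp
  show "lead_coeff (slice t 1 F) = eval3 F 0 1 0" using c d by simp
qed

lemma card_simple_roots:
  assumes "simple_nonzero_roots f"
  shows "card {y. poly f y = 0} = degree f" "finite {y. poly f y = 0}"
proof -
  have sq: "rsquarefree f" and f: "f \<noteq> 0"
    using assms by (auto simp: rsquarefree_roots simple_nonzero_roots_def)
  show fin: "finite {y. poly f y = 0}" by (rule poly_roots_finite[OF f])
  have "degree f = degree (\<Prod>z | poly f z = 0. [:-z, 1:])"
    using complex_poly_decompose_rsquarefree[OF sq] f by (metis degree_smult_eq leading_coeff_0_iff)
  also have "\<dots> = (\<Sum>z | poly f z = 0. 1)"
    by (subst degree_prod_eq_sum_degree) auto
  finally show "card {y. poly f y = 0} = degree f" by simp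
qed

text \<open>
  The leading coefficient of \<open>G\<close> in \<open>Y\<close> is a constant, hence so is that of a factor \<open>H\<close>. So \<open>H\<close> keeps
  its degree in \<open>Y\<close> when \<open>X\<close> and \<open>Z\<close> are specialised, and is a unit if this degree is \<open>0\<close>. If \<open>H\<close>
  occurs twice in \<open>G\<close>, a root of its specialisation is a multiple root of that of \<open>G\<close>.
\<close>

lemma squarefree_from_slice:
  assumes G: "homogeneous m G" and Py: "eval3 G 0 1 0 \<noteq> 0" and t: "simple_nonzero_roots (slice t 1 G)"
  shows "squarefree G"
  unfolding squarefree_def
proof (intro allI impI)
  fix H assume "H ^ 2 dvd G"
  then obtain R where R: "G = H ^ 2 * R" by (elim dvdE)
  have "lead_coeff G dvd 1"
    using lead_coeff_homogeneous[OF G Py] Py by (simp add: is_unit_const_poly_iff dvd_field_iff)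
  moreover have "lead_coeff G = lead_coeff H * (lead_coeff H * lead_coeff R)"
    unfolding R power2_eq_square by (simp add: lead_coeff_mult mult.assoc)
  ultimately have u: "lead_coeff H dvd 1" by (metis dvd_mult_left)
  then obtain d where d: "lead_coeff H = [:[:d:]:]" "d \<noteq> 0"
    by (auto simp: is_unit_poly_iff dvd_field_iff)
  show "H dvd 1"
  proof (cases "degree H = 0")
    case True
    then have "H = [:lead_coeff H:]" by (metis degree_eq_zeroE lead_coeff_pCons(2) degree_0)
    then show ?thesis using u by (metis is_unit_const_poly_iff)
  next
    case False
    have "coeff (slice t 1 H) (degree H) \<noteq> 0" using d by (simp add: coeff_slice)
    then have "degree (slice t 1 H) > 0" using False le_degree by fastforce
    then obtain y where y: "poly (slice t 1 H) y = 0" using alg_closed_imp_poly_has_root by blast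
    have "slice t 1 G = slice t 1 H * (slice t 1 H * slice t 1 R)"
      unfolding R power2_eq_square slice_mult by (simp add: mult.assoc)
    then have "poly (slice t 1 G) y = 0" "poly (pderiv (slice t 1 G)) y = 0"
      using y by (simp_all add: pderiv_mult)
    then show ?thesis using t by (auto simp: simple_nonzero_roots_def)
  qed
qed

definition kummer_poly :: "nat \<Rightarrow> tpoly \<Rightarrow> tpoly" where
  "kummer_poly n F =
     map_poly (\<lambda>q. map_poly (\<lambda>r. r \<circ>\<^sub>p monom 1 n) q \<circ>\<^sub>p monom 1 n) F \<circ>\<^sub>p monom 1 n"

lemma coeff_pcompose_monom:
  fixes p :: "'a :: comm_ring_1 poly"
  assumes "0 < n"
  shows "coeff (p \<circ>\<^sub>p monom 1 n) i = (if n dvd i then coeff p (i div n) else 0)"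
proof (induction p arbitrary: i)
  case (pCons a p)
  have "coeff (pCons a p \<circ>\<^sub>p monom 1 n) i = coeff [:a:] i + coeff (monom 1 n * (p \<circ>\<^sub>p monom 1 n)) i"
    by (simp add: pcompose_pCons)
  also have "\<dots> = coeff [:a:] i + (if i < n then 0 else coeff (p \<circ>\<^sub>p monom 1 n) (i - n))"
    by (simp add: coeff_monom_mult)
  also have "\<dots> = (if n dvd i then coeff (pCons a p) (i div n) else 0)"
  proof (cases "i < n")
    case True
    then have "n dvd i \<longleftrightarrow> i = 0" using dvd_imp_le by fastforce
    then show ?thesis using True by (auto simp: coeff_pCons split: nat.splits)
  next
    case False
    then have "n dvd (i - n) \<longleftrightarrow> n dvd i" "i div n = Suc ((i - n) div n)" "i \<noteq> 0"
      using assms by (auto simp: dvd_minus_self le_div_geq)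
    then show ?thesis using pCons.IH[of "i - n"] False by (auto simp: coeff_pCons split: nat.splits)
  qed
  finally show ?case .
qed simp

lemma coeff3_kummer_poly:
  assumes n: "0 < n"
  shows "coeff3 (kummer_poly n F) a b c =
     (if n dvd a \<and> n dvd b \<and> n dvd c then coeff3 F (a div n) (b div n) (c div n) else 0)"
  by (simp add: coeff3_def kummer_poly_def coeff_pcompose_monom[OF n] coeff_map_poly)

lemma homogeneous_kummer_poly:
  assumes "0 < n" "homogeneous k F"
  shows "homogeneous (n * k) (kummer_poly n F)"
  unfolding homogeneous_iff
proof (intro allI impI)
  fix a b c assume "coeff3 (kummer_poly n F) a b c \<noteq> 0"
  then have "n dvd a" "n dvd b" "n dvd c" "a div n + b div n + c div n = k"
    using assms(2) by (auto simp: coeff3_kummer_poly[OF assms(1)] homogeneous_iff split: if_splits)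
  then show "a + b + c = n * k" by (metis dvd_mult_div_cancel distrib_left)
qed

lemma eval3_kummer_poly: "eval3 (kummer_poly n F) x y z = eval3 F (x ^ n) (y ^ n) (z ^ n)"
proof -
  let ?h = "\<lambda>r::complex poly. r \<circ>\<^sub>p monom 1 n"
  let ?H = "\<lambda>q. map_poly ?h q \<circ>\<^sub>p monom 1 n"
  have 1: "poly (poly (map_poly ?h q) [:w:]) x = poly (poly q [:w:]) (x ^ n)" for q w
    by (induction q) (auto simp: map_poly_pCons poly_pcompose poly_monom)
  have 2: "poly (poly (?H q) [:z:]) x = poly (poly q [:z ^ n:]) (x ^ n)" for q
    by (simp add: poly_pcompose poly_monom poly_const_pow 1)
  have "poly (poly (poly (map_poly ?H F) [:[:v:]:]) [:z:]) x = poly (poly (poly F [:[:v:]:]) [:z ^ n:]) (x ^ n)" for v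
    by (induction F) (auto simp: map_poly_pCons 2)
  then show ?thesis
    by (simp add: eval3_def kummer_poly_def poly_pcompose poly_monom poly_const_pow)
qed

lemma slice_kummer_poly: "slice t 1 (kummer_poly n F) = slice (t ^ n) 1 F \<circ>\<^sub>p monom 1 n"
  by (rule poly_eq_poly_eq_iff[THEN iffD1], rule ext)
     (simp add: poly_slice eval3_kummer_poly poly_pcompose poly_monom)

lemma ex_nth_root:
  fixes v :: complex
  assumes "0 < n"
  shows "\<exists>y. y ^ n = v"
proof -
  let ?\<delta> = "norm v + 1"
  have "?\<delta> ^ 1 \<le> ?\<delta> ^ n" using assms by (intro power_increasing) auto
  then have "dist v (0 ^ n) < ?\<delta> ^ n" by (simp add: zero_power[OF assms])
  then show ?thesis using nth_root_nearby[OF assms, of ?\<delta> v 0] by (auto simp: add_nonneg_pos)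
qed

text \<open>
  The \<open>n\<close>-th power map is unramified away from \<open>0\<close>, and \<open>0\<close> is not a root.
\<close>

lemma simple_nonzero_roots_power:
  assumes n: "0 < n"
  shows "simple_nonzero_roots (f \<circ>\<^sub>p monom 1 n) \<longleftrightarrow> simple_nonzero_roots f"
proof -
  have p: "poly (f \<circ>\<^sub>p monom 1 n) y = poly f (y ^ n)" for y by (simp add: poly_pcompose poly_monom)
  have d: "poly (pderiv (f \<circ>\<^sub>p monom 1 n)) y = poly (pderiv f) (y ^ n) * (of_nat n * y ^ (n - 1))" for y
    by (simp add: pderiv_pcompose poly_pcompose poly_monom pderiv_monom)
  show ?thesis
  proof
    assume L: "simple_nonzero_roots (f \<circ>\<^sub>p monom 1 n)"
    have "poly (pderiv f) v \<noteq> 0" if "poly f v = 0" for v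
    proof -
      obtain y where "y ^ n = v" using ex_nth_root[OF n] by blast
      then show ?thesis using L p d that by (auto simp: simple_nonzero_roots_def)
    qed
    then show "simple_nonzero_roots f" using L p by (auto simp: simple_nonzero_roots_def zero_power[OF n])
  next
    assume R: "simple_nonzero_roots f"
    have "poly (pderiv (f \<circ>\<^sub>p monom 1 n)) y \<noteq> 0" if "poly f (y ^ n) = 0" for y
    proof -
      have "y \<noteq> 0" using R that by (auto simp: simple_nonzero_roots_def zero_power[OF n])
      then show ?thesis using R that n by (auto simp: d simple_nonzero_roots_def)
    qed
    then show "simple_nonzero_roots (f \<circ>\<^sub>p monom 1 n)"
      using R p by (auto simp: simple_nonzero_roots_def zero_power[OF n])
  qed
qed

lemma cp2_cases:
  obtains x y z where "(x, y, z) \<noteq> (0, 0, 0)" "u = hpoint x y z"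
proof -
  obtain x y z where r: "rep_cp2 u = (x, y, z)" by (metis prod_cases3)
  have "proj_rel (rep_cp2 u) (rep_cp2 u)" by (rule Quotient_rep_reflp[OF Quotient_cp2])
  then have "(x, y, z) \<noteq> (0, 0, 0)" by (simp add: proj_rel_def r)
  moreover have "u = hpoint x y z"
    using Quotient_abs_rep[OF Quotient_cp2, of u] by (simp add: hpoint_def r)
  ultimately show ?thesis by (rule that)
qed

lemma proj_rel_refl: "(x, y, z) \<noteq> (0, 0, 0) \<Longrightarrow> proj_rel (x, y, z) (x, y, z)"
  by (auto simp: proj_rel_def intro!: exI[of _ 1])

lemma hpoint_eq_iff:
  assumes "(x, y, z) \<noteq> (0, 0, 0)" "(x', y', z') \<noteq> (0, 0, 0)"
  shows "hpoint x y z = hpoint x' y' z' \<longleftrightarrow> (\<exists>c. c \<noteq> 0 \<and> x' = c * x \<and> y' = c * y \<and> z' = c * z)"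
proof -
  have "hpoint x y z = hpoint x' y' z' \<longleftrightarrow> proj_rel (x, y, z) (x', y', z')"
    unfolding hpoint_def using Quotient_rel[OF Quotient_cp2, of "(x, y, z)" "(x', y', z')"]
      proj_rel_refl[OF assms(1)] proj_rel_refl[OF assms(2)] by simp
  also have "\<dots> \<longleftrightarrow> (\<exists>c. c \<noteq> 0 \<and> x' = c * x \<and> y' = c * y \<and> z' = c * z)"
    using assms by (simp add: proj_rel_def)
  finally show ?thesis .
qed

lemma kummer_hpoint:
  assumes "(x, y, z) \<noteq> (0, 0, 0)"
  shows "kummer n (hpoint x y z) = hpoint (x ^ n) (y ^ n) (z ^ n)"
  unfolding hpoint_def using kummer.abs_eq[of "(x, y, z)" n] proj_rel_refl[OF assms]
  by (simp add: eq_onp_def)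

lemma power_triple_nonzero:
  "0 < n \<Longrightarrow> (x, y, z :: complex) \<noteq> (0 :: complex, 0 :: complex, 0) \<Longrightarrow> (x ^ n, y ^ n, z ^ n) \<noteq> (0, 0, 0)"
  by auto

lemma hpoint_in_zero_locus:
  assumes "homogeneous k F" "(x, y, z) \<noteq> (0, 0, 0)"
  shows "hpoint x y z \<in> zero_locus F \<longleftrightarrow> eval3 F x y z = 0"
proof
  assume "hpoint x y z \<in> zero_locus F"
  then obtain x' y' z' where n: "(x', y', z') \<noteq> (0, 0, 0)" "hpoint x' y' z' = hpoint x y z"
    and e: "eval3 F x' y' z' = 0"
    unfolding zero_locus_def by fastforce
  then obtain c where "x = c * x'" "y = c * y'" "z = c * z'"
    using hpoint_eq_iff[OF n(1) assms(2)] by auto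
  then show "eval3 F x y z = 0" using eval3_scale[OF assms(1)] e by simp
qed (use assms in \<open>auto simp: zero_locus_def\<close>)

lemma kummer_vimage_zero_locus:
  assumes n: "0 < n" and F: "homogeneous k F" and G: "homogeneous m G"
    and eq: "\<And>x y z. eval3 G x y z = 0 \<longleftrightarrow> eval3 F (x ^ n) (y ^ n) (z ^ n) = 0"
  shows "kummer n -` zero_locus F = zero_locus G"
proof (rule Set.set_eqI)
  fix u
  obtain x y z where xyz: "(x, y, z) \<noteq> (0, 0, 0)" "u = hpoint x y z" by (rule cp2_cases)
  show "u \<in> kummer n -` zero_locus F \<longleftrightarrow> u \<in> zero_locus G"
    unfolding vimage_eq xyz(2) kummer_hpoint[OF xyz(1)] hpoint_in_zero_locus[OF G xyz(1)]
      hpoint_in_zero_locus[OF F power_triple_nonzero[OF n xyz(1)]] eq ..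
qed

lemma kummer_vimage_coordinate_lines:
  assumes "0 < n"
  shows "kummer n -` line_inf = line_inf" "kummer n -` line_Y = line_Y"
  unfolding line_inf_def line_Y_def using homogeneous_vars assms
  by (intro kummer_vimage_zero_locus; simp)+

lemma hpoint_eq_Py_iff:
  assumes "(x, y, z) \<noteq> (0, 0, 0)"
  shows "hpoint x y z = point_Py \<longleftrightarrow> x = 0 \<and> z = 0"
  unfolding point_Py_def
proof (subst hpoint_eq_iff[OF assms])
  show "(\<exists>c. c \<noteq> 0 \<and> 0 = c * x \<and> 1 = c * y \<and> 0 = c * z) \<longleftrightarrow> x = 0 \<and> z = 0"
    using assms by (auto intro!: exI[of _ "inverse y"])
qed simp

lemma kummer_vimage_Py:
  assumes n: "0 < n"
  shows "kummer n -` {point_Py} = {point_Py}"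
proof (rule Set.set_eqI)
  fix u
  obtain x y z where xyz: "(x, y, z) \<noteq> (0, 0, 0)" "u = hpoint x y z" by (rule cp2_cases)
  show "u \<in> kummer n -` {point_Py} \<longleftrightarrow> u \<in> {point_Py}"
    using hpoint_eq_Py_iff[OF xyz(1)] hpoint_eq_Py_iff[OF power_triple_nonzero[OF n xyz(1)]] n
    by (simp add: xyz(2) kummer_hpoint[OF xyz(1)])
qed

lemma kummer_surj:
  assumes n: "0 < n"
  shows "surj (kummer n)"
proof (rule surjI[of _ "\<lambda>u. SOME v. kummer n v = u"], rule someI_ex)
  fix u
  obtain x y z where xyz: "(x, y, z) \<noteq> (0, 0, 0)" "u = hpoint x y z" by (rule cp2_cases)
  obtain a b c where "a ^ n = x" "b ^ n = y" "c ^ n = z" using ex_nth_root[OF n] by meson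
  moreover from this have "(a, b, c) \<noteq> (0, 0, 0)" using xyz(1) n by (auto simp: zero_power[OF n])
  ultimately show "\<exists>v. kummer n v = u" using xyz(2) kummer_hpoint by metis
qed

lemma point_Py_notin_iff:
  "homogeneous k F \<Longrightarrow> point_Py \<notin> zero_locus F \<longleftrightarrow> eval3 F 0 1 0 \<noteq> 0"
  unfolding point_Py_def by (subst hpoint_in_zero_locus) auto

lemma extended_values_iff:
  assumes "homogeneous k F" "eval3 F 0 1 0 \<noteq> 0"
  shows "t \<in> extended_values F \<longleftrightarrow> t = 0 \<or> \<not> simple_nonzero_roots (slice t 1 F)"
  by (auto simp: extended_values_def nontransversal_values_iff[OF assms])

text \<open>
  Finiteness of the set of special values provides the one value at which the slice has simple
  roots, which is what squarefreeness needs.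
\<close>

lemma kummer_poly_reduced_equation:
  assumes n: "0 < n" and F: "reduced_equation k F C" and Py: "point_Py \<notin> C"
    and fin: "finite (extended_values F)"
  shows "reduced_equation (n * k) (kummer_poly n F) (kummer n -` C)"
    and "extended_values (kummer_poly n F) = {t. t ^ n \<in> extended_values F}"
proof -
  have h: "0 < k" "homogeneous k F" "C = zero_locus F" using F by (auto simp: reduced_equation_def)
  note hn = homogeneous_kummer_poly[OF n h(2)]
  have e: "eval3 F 0 1 0 \<noteq> 0" using point_Py_notin_iff[OF h(2)] Py h(3) by simp
  then have en: "eval3 (kummer_poly n F) 0 1 0 \<noteq> 0" by (simp add: eval3_kummer_poly zero_power[OF n])
  show ev: "extended_values (kummer_poly n F) = {t. t ^ n \<in> extended_values F}"
    using n by (auto simp: extended_values_iff[OF h(2) e] extended_values_iff[OF hn en]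
        slice_kummer_poly simple_nonzero_roots_power[OF n])
  have "extended_values (kummer_poly n F) = (\<Union>v\<in>extended_values F. {t. t ^ n = v})"
    unfolding ev by auto
  then have "finite (extended_values (kummer_poly n F))" using fin n by (simp add: finite_nth_roots)
  then obtain t where "t \<notin> extended_values (kummer_poly n F)"
    using ex_new_if_finite[OF infinite_UNIV_char_0] by blast
  then have "squarefree (kummer_poly n F)"
    by (intro squarefree_from_slice[OF hn en, of t]) (simp add: extended_values_iff[OF hn en])
  moreover have "kummer n -` C = zero_locus (kummer_poly n F)"
    unfolding h(3) by (rule kummer_vimage_zero_locus[OF n h(2) hn]) (simp add: eval3_kummer_poly)
  ultimately show "reduced_equation (n * k) (kummer_poly n F) (kummer n -` C)"
    using n h(1) hn by (simp add: reduced_equation_def)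
qed

lemma fibre_eq_roots:
  assumes "reduced_equation k F C"
  shows "fibre C t = {y. poly (slice t 1 F) y = 0}"
  using assms hpoint_in_zero_locus[of k F t _ 1]
  by (auto simp: fibre_def reduced_equation_def poly_slice)

lemma fibre_kummer: "0 < n \<Longrightarrow> fibre (kummer n -` C) t = {y. y ^ n \<in> fibre C (t ^ n)}"
  by (auto simp: fibre_def kummer_hpoint)

text \<open>
  The slices have constant degree and constant leading coefficient, so a small value at \<open>w\<close> forces
  a root near \<open>w\<close>.
\<close>

lemma continuous_map_fibre:
  assumes F: "reduced_equation k F C" and Py: "point_Py \<notin> C"
  shows "continuous_map (top_of_set (- extended_values F)) (unordered_conf k (- {0})) (fibre C)"
proof (rule continuous_map_unordered_conf)
  have h: "0 < k" "homogeneous k F" "C = zero_locus F" using F by (auto simp: reduced_equation_def)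
  have e: "eval3 F 0 1 0 \<noteq> 0" using point_Py_notin_iff[OF h(2)] Py h(3) by simp
  note deg = slice_degree[OF h(2) e]
  fix t assume t: "t \<in> topspace (top_of_set (- extended_values F))"
  then have simple: "simple_nonzero_roots (slice t 1 F)" by (simp add: extended_values_iff[OF h(2) e])
  have "0 \<notin> fibre C t" using simple by (simp add: fibre_eq_roots[OF F] simple_nonzero_roots_def)
  then show "fibre C t \<in> topspace (unordered_conf k (- {0}))"
    using card_simple_roots[OF simple] deg(1)
    by (auto simp: mem_topspace_unordered_conf fibre_eq_roots[OF F])
  fix w and \<delta> :: real assume w: "w \<in> fibre C t" and \<delta>: "0 < \<delta>"
  let ?r = "norm (eval3 F 0 1 0) * \<delta> ^ k"
  let ?W = "{t'. norm (poly (slice t' 1 F) w) < ?r}"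
  have "continuous_on UNIV (\<lambda>t'. norm (poly (slice t' 1 F) w))"
    unfolding poly_slice eval3_def by (intro continuous_intros)
  then have "open ?W" by (intro open_Collect_less continuous_on_const)
  then have "openin (top_of_set (- extended_values F)) (- extended_values F \<inter> ?W)"
    by (rule openin_open_Int)
  moreover have "t \<in> - extended_values F \<inter> ?W"
    using t w e \<delta> by (simp add: fibre_eq_roots[OF F])
  moreover have "\<exists>z\<in>fibre C t'. dist z w < \<delta>" if "t' \<in> - extended_values F \<inter> ?W" for t'
    using poly_root_nearby[OF \<delta>, of "slice t' 1 F" w] that deg[of t']
    by (auto simp: fibre_eq_roots[OF F])
  ultimately show "\<exists>W. openin (top_of_set (- extended_values F)) W \<and> t \<in> W \<and>
      (\<forall>t'\<in>W. \<exists>z\<in>fibre C t'. dist z w < \<delta>)" by blast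
qed

section \<open>The monodromy of the pulled-back curve\<close>

theorem proposition2p5:
  fixes C :: "cp2 set" and k n r :: nat
    and t0 t0n :: complex and ts :: "complex list"
    and \<gamma>s :: "(real \<Rightarrow> complex) set list"
    and \<tau>s :: "(real \<Rightarrow> complex set) set list"
  assumes "n \<ge> 1"
    and "reduced_curve k C" and "point_Py \<notin> C" and "\<not> line_Y \<subseteq> C"
    and "extended_braid_monodromy k C t0 ts \<gamma>s \<tau>s" and "length \<tau>s = r + 1"
    and "last ts = 0"
    and "t0n ^ n = t0"
  shows
    "let Cn = kummer n -` C;
         \<tau>sn = map (rho n k) (kummer_list (braid_group k (fibre C t0)) n \<tau>s)
     in kummer n -` {point_Py} = {point_Py} \<and>
        kummer n -` line_inf = line_inf \<and>
        kummer n -` line_Y = line_Y \<and>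
        length \<tau>sn = n * r + 1 \<and>
        set \<tau>sn \<subseteq> carrier (braid_group (n * k) (fibre Cn t0n)) \<and>
        (\<exists>tsn \<gamma>sn.
           extended_braid_monodromy (n * k) Cn t0n tsn \<gamma>sn \<tau>sn \<and>
           set tsn = {t. t ^ n \<in> set ts} \<and>
           map (pi1_map (top_of_set (- set ts)) (\<lambda>t. t ^ n)) \<gamma>sn =
             kummer_list (pi1_compl (set ts) t0) n \<gamma>s)"
proof -
  have n: "0 < n" using assms(1) by simp
  let ?Cn = "kummer n -` C" and ?B = "braid_group k (fibre C t0)"
  let ?\<tau>sn = "map (rho n k) (kummer_list ?B n \<tau>s)"
  obtain F where F: "reduced_equation k F C" and S: "set ts = extended_values F"
    and t0: "t0 \<notin> set ts" and gb: "geometric_basis ts t0 \<gamma>s" and \<tau>s: "\<tau>s = map (ext_monodromy k C) \<gamma>s"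
    using assms(5) by (auto simp: extended_braid_monodromy_def)
  have fin: "finite (extended_values F)" using S by (metis List.finite_set)
  note Fn = kummer_poly_reduced_equation[OF n F assms(3) fin]
  interpret power_cover n "set ts" t0n
    using n t0 assms(8) by unfold_locales (simp_all add: S extended_values_def)
  have Sn: "Sn = extended_values (kummer_poly n F)" by (simp only: Sn_def Fn(2)) (simp only: S)
  obtain tsn hs where tsn: "set tsn = Sn" and gbn: "geometric_basis tsn t0n hs" and hs: "set hs \<subseteq> carrier P"
    and \<phi>hs: "map \<phi> hs = kummer_list G n \<gamma>s"
    using kummer_geometric_basis[of ts \<gamma>s] gb assms(7,8) by auto
  let ?U = "unordered_conf k (- {0})" and ?V = "unordered_conf (n * k) (- {0})"
  have cC: "continuous_map (top_of_set (- set ts)) ?U (fibre C)"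
    unfolding S by (rule continuous_map_fibre[OF F assms(3)])
  note cR = continuous_map_nth_roots[OF n, of k]
  \<comment> \<open>This square of continuous maps is the whole relation between the two monodromies.\<close>
  have eq: "(\<lambda>c. {y. y ^ n \<in> c}) \<circ> (fibre C \<circ> pow) = fibre ?Cn"
    by (rule ext) (simp add: fibre_kummer[OF n])
  have cCn: "continuous_map (top_of_set (- Sn)) ?V (fibre ?Cn)"
    unfolding eq[symmetric] by (intro continuous_map_compose[OF continuous_map_compose[OF power_continuous_map cC] cR])
  have gr: "group ?B"
    unfolding braid_group_def
    using continuous_map_image_subset_topspace[OF cC] t0 by (intro group_fundamental_group) auto
  have "set \<gamma>s \<subseteq> carrier G" "\<gamma>s \<noteq> []"
    using gb assms(6,8) \<tau>s by (auto simp: geometric_basis_def free_basis_def)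
  moreover have "ext_monodromy k C \<in> hom G ?B"
    unfolding ext_monodromy_def braid_group_def using pi1_map_hom[OF cC, of t0] assms(8) by simp
  ultimately have "kummer_list ?B n \<tau>s = map (ext_monodromy k C) (kummer_list G n \<gamma>s)"
    unfolding \<tau>s using kummer_list_hom[OF group_G gr] by metis
  moreover have "rho n k (ext_monodromy k C (\<phi> h)) = ext_monodromy (n * k) ?Cn h" if "h \<in> carrier P" for h
    unfolding rho_def ext_monodromy_def eq[symmetric] pi1_map_compose[OF power_continuous_map cC that]
    by (rule pi1_map_compose[OF continuous_map_compose[OF power_continuous_map cC] cR that])
  ultimately have \<tau>sn: "?\<tau>sn = map (ext_monodromy (n * k) ?Cn) hs"
    unfolding \<phi>hs[symmetric] using hs by (auto simp: subset_iff)
  have len: "length ?\<tau>sn = n * r + 1"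
    using assms(6) by (simp add: length_kummer_list flip: length_greater_0_conv)
  have "ext_monodromy (n * k) ?Cn \<in> hom P (braid_group (n * k) (fibre ?Cn t0n))"
    unfolding ext_monodromy_def braid_group_def by (rule pi1_map_hom[OF cCn])
  then have carr: "set ?\<tau>sn \<subseteq> carrier (braid_group (n * k) (fibre ?Cn t0n))"
    unfolding \<tau>sn using hs by (auto intro: hom_in_carrier)
  note Py = kummer_vimage_Py[OF n] and lines = kummer_vimage_coordinate_lines[OF n]
  have "point_Py \<in> kummer n -` {point_Py}" unfolding Py by simp
  then have "point_Py \<notin> ?Cn" using assms(3) by simp
  moreover have "\<not> line_Y \<subseteq> ?Cn"
  proof
    assume "line_Y \<subseteq> ?Cn"
    then have "kummer n -` line_Y \<subseteq> kummer n -` C" using lines(2) by simp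
    then have "line_Y \<subseteq> C" using kummer_surj[OF n] by (metis image_mono surj_image_vimage_eq)
    then show False using assms(4) by simp
  qed
  moreover have "t0n \<notin> set tsn" using base tsn by (simp add: Sn_def)
  ultimately have "extended_braid_monodromy (n * k) ?Cn t0n tsn hs ?\<tau>sn"
    unfolding extended_braid_monodromy_def using Fn(1) tsn Sn gbn \<tau>sn by auto
  then show ?thesis
    unfolding Let_def using Py lines len carr \<phi>hs tsn assms(8)
    by (intro conjI exI[of _ tsn] exI[of _ hs]) (simp_all add: Sn_def)
qed

end
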